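(* Let $M$ be a real symmetric $n\times n$ matrix with ordered eigenvalue vector $\lambda(M)=(\lambda_1\ge\cdots\ge\lambda_n)$, let $\mathcal{O}_M$ be its symmetric Schur-Horn orbitope, and let $\Pi(\lambda(M))$ be the permutahedron of $\lambda(M)$. Every $O(n)$-orbit of faces of $\mathcal{O}_M$ intersects the pullback of a unique $\mathfrak{S}_n$-orbit of faces of the permutahedron $\Pi(\lambda(M))$. In particular, the faces of $\mathcal{O}_M$ are products of symmetric Schur-Horn orbitopes of smaller dimensions corresponding to flags in $\mathbb{R}^n$.
   Context: $\mathrm{Sym}_2\mathbb{R}^n$ is the space of real symmetric $n\times n$ matrices, on which the orthogonal group $O(n)$ acts by $g\cdot A=gAg^T$. The symmetric Schur-Horn orbitope of $M\in\mathrm{Sym}_2\mathbb{R}^n$ is $\mathcal{O}_M=\mathrm{conv}\{gMg^T: g\in O(n)\}$; $O(n)$ acts on its set of faces. For $p\in\mathbb{R}^n$, the permutahedron is $\Pi(p)=\mathrm{conv}\{(p_{\pi(1)},\dots,p_{\pi(n)}):\pi\in\mathfrak{S}_n\}$; the symmetric group $\mathfrak{S}_n$ permutes coordinates of $\mathbb{R}^n$ and hence acts on the faces of $\Pi(p)$. Let $\mathsf{D}:\mathrm{Sym}_2\mathbb{R}^n\to\mathbb{R}^n$ be the linear projection onto the diagonal; it maps $\mathcal{O}_M$ onto $\Pi(\lambda(M))$, and pullbacks of faces of $\Pi(\lambda(M))$ are taken along this map $\mathcal{O}_M\to\Pi(\lambda(M))$. A face of a convex body $K$ is a closed convex subset $F\subseteq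 K$ that contains the two endpoints of any open segment in $K$ that it intersects; this includes $\emptyset$ and $K$ itself. A flag in $\mathbb{R}^n$ is a chain of linear subspaces of $\mathbb{R}^n$ ordered by inclusion. *)

theory Defs
  imports "HOL-Analysis.Analysis"
begin

text \<open>
  The index type \<open>'n :: {finite, linorder}\<close> stands for \<open>{1 < \<dots> < n}\<close>; the order is only
  used to speak of an ordered eigenvalue vector.
\<close>

definition conj_act :: "real^'n^'n \<Rightarrow> real^'n^'n \<Rightarrow> real^'n^'n" where
  "conj_act g A = g ** A ** transpose g"

definition schur_horn_orbitope :: "real^'n^'n \<Rightarrow> (real^'n^'n) set" where
  "schur_horn_orbitope M = convex hull {conj_act g M |g. orthogonal_matrix g}"

definition perm_act :: "('n \<Rightarrow> 'n) \<Rightarrow> real^'n \<Rightarrow> real^'n" where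
  "perm_act \<pi> p = (\<chi> i. p $ \<pi> i)"

definition permutahedron :: "real^'n \<Rightarrow> (real^'n) set" where
  "permutahedron p = convex hull {perm_act \<pi> p |\<pi>. \<pi> permutes UNIV}"

definition diag_proj :: "real^'n^'n \<Rightarrow> real^'n" where
  "diag_proj A = (\<chi> i. A $ i $ i)"

text \<open>
  Multiplicity of \<open>\<mu>\<close> as an eigenvalue of the restriction of \<open>A\<close> to the subspace \<open>V\<close>. All operators
  considered are symmetric, so geometric and algebraic multiplicities agree.
\<close>

definition eig_mult_on :: "(real^'n) set \<Rightarrow> real^'n^'n \<Rightarrow> real \<Rightarrow> nat" where
  "eig_mult_on V A \<mu> = dim {v \<in> V. A *v v = \<mu> *\<^sub>R v}"

definition eigenvalue_vector ::
  "real^('n::{finite,linorder})^('n::{finite,linorder}) \<Rightarrow> real^('n::{finite,linorder})" where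
  "eigenvalue_vector M =
     (THE l. (\<forall>i j. i \<le> j \<longrightarrow> l $ j \<le> l $ i) \<and>
             (\<forall>\<mu>. card {i. l $ i = \<mu>} = eig_mult_on UNIV M \<mu>))"

text \<open>
  Orbits of faces, each orbit being a set of faces. A \<open>face_of\<close> a compact convex set is
  automatically closed, and both the empty set and the whole body are faces.
\<close>

definition orbitope_face_orbits :: "real^'n^'n \<Rightarrow> (real^'n^'n) set set set" where
  "orbitope_face_orbits M =
     {{conj_act g ` F |g. orthogonal_matrix g} |F. F face_of schur_horn_orbitope M}"

definition permutahedron_face_orbits :: "real^'n \<Rightarrow> (real^'n) set set set" where
  "permutahedron_face_orbits p =
     {{perm_act \<pi> ` G |\<pi>. \<pi> permutes UNIV} |G. G face_of permutahedron p}"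

definition pullback :: "real^'n^'n \<Rightarrow> (real^'n) set \<Rightarrow> (real^'n^'n) set" where
  "pullback M G = {A \<in> schur_horn_orbitope M. diag_proj A \<in> G}"

text \<open>
  For a subspace \<open>V\<close>, the space \<open>Sym\<^sub>2 V\<close> and the group \<open>O(V)\<close> are realised inside the
  \<open>n \<times> n\<close> matrices: operators on \<open>V\<close> are extended by zero, resp. by the identity, to the
  orthogonal complement of \<open>V\<close>. The lemmas below identify the result, through any orthonormal
  frame of \<open>V\<close>, with the symmetric matrices of size \<open>dim V\<close> and their orbitopes.
\<close>

definition symmetric_matrices_on :: "(real^'n) set \<Rightarrow> (real^'n^'n) set" where
  "symmetric_matrices_on V = {A. transpose A = A \<and> (\<forall>x \<in> orthogonal_comp V. A *v x = 0)}"

definition orthogonal_group_on :: "(real^'n) set \<Rightarrow> (real^'n^'n) set" where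
  "orthogonal_group_on V = {g. orthogonal_matrix g \<and> (\<forall>x \<in> orthogonal_comp V. g *v x = x)}"

definition schur_horn_orbitope_on :: "(real^'n) set \<Rightarrow> real^'n^'n \<Rightarrow> (real^'n^'n) set" where
  "schur_horn_orbitope_on V A = convex hull {conj_act g A |g. g \<in> orthogonal_group_on V}"

definition is_flag :: "nat \<Rightarrow> (nat \<Rightarrow> (real^'n) set) \<Rightarrow> bool" where
  "is_flag k W \<longleftrightarrow>
     W 0 = {0} \<and> W k = UNIV \<and> (\<forall>i\<le>k. subspace (W i)) \<and> (\<forall>i<k. W i \<subset> W (Suc i))"

definition flag_step :: "(nat \<Rightarrow> (real^'n) set) \<Rightarrow> nat \<Rightarrow> (real^'n) set" where
  "flag_step W i = W (Suc i) \<inter> orthogonal_comp (W i)"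

text \<open>
  The \<open>i\<close>-th block has the eigenvalues \<open>\<lambda>\<^sub>r\<close> of \<open>M\<close> with \<open>dim (W i) < r \<le> dim (W (Suc i))\<close>;
  \<open>card {l. l < j}\<close> is the zero-based position of the index \<open>j\<close>.
\<close>

definition flag_blocks ::
  "real^('n::{finite,linorder})^('n::{finite,linorder}) \<Rightarrow> nat \<Rightarrow>
     (nat \<Rightarrow> (real^('n::{finite,linorder})) set) \<Rightarrow>
     (nat \<Rightarrow> real^('n::{finite,linorder})^('n::{finite,linorder})) \<Rightarrow> bool" where
  "flag_blocks M k W N \<longleftrightarrow>
     (\<forall>i<k. N i \<in> symmetric_matrices_on (flag_step W i) \<and>
        (\<forall>\<mu>. eig_mult_on (flag_step W i) (N i) \<mu> =
              card {j. dim (W i) \<le> card {l. l < j} \<and> card {l. l < j} < dim (W (Suc i)) \<and>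
                       eigenvalue_vector M $ j = \<mu>}))"

text \<open>
  The steps of a flag are pairwise orthogonal, so the sum \<open>\<Sum>i<k. A i\<close> is the block diagonal
  matrix with blocks \<open>A i\<close> and this is the cartesian product of the orbitopes.
\<close>

definition orbitope_product ::
  "nat \<Rightarrow> (nat \<Rightarrow> (real^'n) set) \<Rightarrow> (nat \<Rightarrow> real^'n^'n) \<Rightarrow> (real^'n^'n) set" where
  "orbitope_product k W N =
     {(\<Sum>i<k. A i) |A. \<forall>i<k. A i \<in> schur_horn_orbitope_on (flag_step W i) (N i)}"

lemma schur_horn_orbitope_on_UNIV: "schur_horn_orbitope_on UNIV M = schur_horn_orbitope M"
  by (simp add: schur_horn_orbitope_on_def schur_horn_orbitope_def orthogonal_group_on_def)

lemma matrix_mul_diff_left: "A ** (B - C) = A ** B - A ** (C :: real^'m^'k)"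
  by (simp add: matrix_matrix_mult_def vec_eq_iff right_diff_distrib sum_subtractf)

lemma matrix_mul_diff_right: "(B - C) ** A = B ** A - (C :: real^'m^'k) ** A"
  by (simp add: matrix_matrix_mult_def vec_eq_iff left_diff_distrib sum_subtractf)

lemma matrix_mul_add_right: "(B + C) ** A = B ** A + (C :: real^'m^'k) ** A"
  by (simp add: matrix_matrix_mult_def vec_eq_iff distrib_right sum.distrib)

lemma linear_frame_conj:
  fixes U :: "real^'k^'n"
  shows "linear (\<lambda>X. U ** X ** transpose U)"
  by (intro linearI)
     (simp_all add: matrix_add_ldistrib matrix_mul_add_right scalar_matrix_assoc matrix_scalar_ac
        flip: scalar_matrix_assoc scalar_mult_eq_scaleR)

lemma orthogonal_comp_frame:
  fixes U :: "real^'k^'n"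
  shows "x \<in> orthogonal_comp (range ((*v) U)) \<longleftrightarrow> transpose U *v x = 0"
proof
  assume "x \<in> orthogonal_comp (range ((*v) U))"
  then have "inner x (U *v y) = 0" for y
    by (simp add: orthogonal_comp_def orthogonal_def inner_commute)
  then have "inner (transpose U *v x) y = 0" for y
    by (simp add: dot_lmul_matrix)
  then show "transpose U *v x = 0"
    by (metis inner_eq_zero_iff)
next
  assume *: "transpose U *v x = 0"
  have "inner x (U *v y) = inner (transpose U *v x) y" for y
    by (simp add: dot_lmul_matrix)
  with * show "x \<in> orthogonal_comp (range ((*v) U))"
    by (auto simp: orthogonal_comp_def orthogonal_def inner_commute)
qed

lemma symmetric_matrices_on_frame:
  fixes U :: "real^'k^'n"
  assumes U: "transpose U ** U = mat 1"
  shows "symmetric_matrices_on (range ((*v) U)) = (\<lambda>X. U ** X ** transpose U) ` {X. transpose X = X}"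
proof (intro set_eqI iffI)
  fix A assume A: "A \<in> symmetric_matrices_on (range ((*v) U))"
  define Q where "Q = U ** transpose U"
  have kill: "A *v x = 0" if "transpose U *v x = 0" for x
    using A that by (simp add: symmetric_matrices_on_def orthogonal_comp_frame
        del: transpose_matrix_vector)
  have tA: "transpose A = A" using A by (simp add: symmetric_matrices_on_def)
  have "transpose U ** (mat 1 - Q) = 0"
    by (simp add: matrix_mul_diff_left Q_def matrix_mul_assoc U)
  then have "A ** (mat 1 - Q) = 0"
    using kill by (simp add: matrix_eq flip: matrix_vector_mul_assoc del: transpose_matrix_vector)
  then have AQ: "A ** Q = A" by (simp add: matrix_mul_diff_left)
  have tQ: "transpose Q = Q" by (simp add: Q_def matrix_transpose_mul)
  have QA: "Q ** A = A" using AQ tA tQ by (metis matrix_transpose_mul)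
  have "A = Q ** A ** Q" by (simp add: AQ QA)
  also have "\<dots> = U ** (transpose U ** A ** U) ** transpose U"
    by (simp add: Q_def matrix_mul_assoc)
  finally have "A = U ** (transpose U ** A ** U) ** transpose U" .
  moreover have "transpose (transpose U ** A ** U) = transpose U ** A ** U"
    by (simp add: matrix_transpose_mul matrix_mul_assoc tA)
  ultimately show "A \<in> (\<lambda>X. U ** X ** transpose U) ` {X. transpose X = X}" by blast
next
  fix A assume "A \<in> (\<lambda>X. U ** X ** transpose U) ` {X. transpose X = X}"
  then obtain X where X: "transpose X = X" "A = U ** X ** transpose U" by auto
  have "A *v x = 0" if "transpose U *v x = 0" for x
    using that by (simp add: X flip: matrix_vector_mul_assoc)
  then show "A \<in> symmetric_matrices_on (range ((*v) U))"
    using X by (auto simp: symmetric_matrices_on_def matrix_transpose_mul matrix_mul_assoc orthogonal_comp_frame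
      simp del: transpose_matrix_vector)
qed

lemma schur_horn_orbitope_on_frame:
  fixes U :: "real^'k^'n"
  assumes U: "transpose U ** U = mat 1"
  shows "schur_horn_orbitope_on (range ((*v) U)) (U ** A ** transpose U)
       = (\<lambda>X. U ** X ** transpose U) ` schur_horn_orbitope A"
proof -
  let ?f = "\<lambda>X. U ** X ** transpose U"
  define P where "P = mat 1 - U ** transpose U"
  have UP: "transpose U ** P = 0" and PU: "P ** U = 0"
    by (simp_all add: P_def matrix_mul_diff_left matrix_mul_diff_right matrix_mul_assoc U
        flip: matrix_mul_assoc[of U])
  have tP: "transpose P = P"
  proof -
    have "transpose (X - Y) = transpose X - transpose Y" for X Y :: "real^'n^'n"
      by (simp add: transpose_def vec_eq_iff)
    then show ?thesis by (simp add: P_def matrix_transpose_mul)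
  qed
  have "{conj_act g (?f A) |g. g \<in> orthogonal_group_on (range ((*v) U))}
      = ?f ` {conj_act h A |h. orthogonal_matrix h}" (is "?L = ?R")
  proof (intro set_eqI iffI)
    fix B assume "B \<in> ?L"
    then obtain g where g: "orthogonal_matrix g" "B = conj_act g (?f A)"
      and fix_g: "\<And>x. transpose U *v x = 0 \<Longrightarrow> g *v x = x"
      by (auto simp: orthogonal_group_on_def orthogonal_comp_frame simp del: transpose_matrix_vector)
    have gP: "g ** P = P"
      using fix_g UP
      by (simp add: matrix_eq matrix_vector_mul_assoc[symmetric] del: transpose_matrix_vector)
    have gg: "transpose g ** g = mat 1" using g by (simp add: orthogonal_matrix)
    have "transpose g ** P = P" using gP gg by (metis matrix_mul_assoc matrix_mul_lid)
    then have Pg: "P ** g = P" using tP by (metis matrix_transpose_mul transpose_transpose)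
    define h where "h = transpose U ** g ** U"
    have "P ** g ** U = 0" by (simp add: Pg PU)
    then have "g ** U - U ** transpose U ** g ** U = 0"
      by (simp add: P_def matrix_mul_diff_right)
    then have gU: "g ** U = U ** h" by (simp add: h_def matrix_mul_assoc)
    have "transpose h ** h = transpose (U ** h) ** (U ** h)"
      by (simp add: matrix_transpose_mul) (metis U matrix_mul_assoc matrix_mul_lid)
    also have "\<dots> = transpose U ** (transpose g ** g) ** U"
      by (simp add: gU[symmetric] matrix_transpose_mul matrix_mul_assoc)
    finally have "orthogonal_matrix h" by (simp add: orthogonal_matrix gg U)
    moreover have "B = ?f (conj_act h A)"
    proof -
      have "B = (g ** U) ** A ** transpose (g ** U)"
        by (simp add: g(2) conj_act_def matrix_transpose_mul matrix_mul_assoc)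
      then show ?thesis by (simp add: gU conj_act_def matrix_transpose_mul matrix_mul_assoc)
    qed
    ultimately show "B \<in> ?R" by blast
  next
    fix B assume "B \<in> ?R"
    then obtain h where h: "orthogonal_matrix h" "B = ?f (conj_act h A)" by blast
    define g where "g = U ** h ** transpose U + P"
    have gU: "g ** U = U ** h"
      by (simp add: g_def matrix_mul_add_right PU U flip: matrix_mul_assoc)
    have gP: "g ** P = P"
    proof -
      have "P ** P = P"
        using UP by (subst P_def) (simp add: matrix_mul_diff_right flip: matrix_mul_assoc)
      then show ?thesis by (simp add: g_def matrix_mul_add_right UP flip: matrix_mul_assoc)
    qed
    have tg: "transpose g = U ** transpose h ** transpose U + P"
    proof -
      have "transpose (X + Y) = transpose X + transpose Y" for X Y :: "real^'n^'n"
        by (simp add: transpose_def vec_eq_iff)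
      then show ?thesis by (simp add: g_def matrix_transpose_mul matrix_mul_assoc tP)
    qed
    have hh: "transpose h ** h = mat 1" using h by (simp add: orthogonal_matrix)
    have Pg: "P ** g = P"
    proof -
      have "P ** P = P"
        using UP by (subst P_def) (simp add: matrix_mul_diff_right flip: matrix_mul_assoc)
      then show ?thesis by (simp add: g_def matrix_add_ldistrib matrix_mul_assoc PU)
    qed
    have Ug: "transpose U ** g = h ** transpose U"
      by (simp add: g_def matrix_add_ldistrib matrix_mul_assoc U UP)
    have "transpose g ** g = U ** transpose h ** (transpose U ** g) + P ** g"
      by (simp add: tg matrix_mul_add_right matrix_mul_assoc)
    also have "\<dots> = U ** (transpose h ** h) ** transpose U + P"
      by (simp add: Ug Pg matrix_mul_assoc)
    also have "\<dots> = mat 1" by (simp add: hh P_def)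
    finally have og: "orthogonal_matrix g" by (simp add: orthogonal_matrix)
    have "g *v x = x" if "transpose U *v x = 0" for x
    proof -
      have "(U ** transpose U) *v x = 0"
        using that by (simp flip: matrix_vector_mul_assoc)
      then have "P *v x = x" by (simp add: P_def matrix_vector_mult_diff_rdistrib)
      then show ?thesis using gP by (metis matrix_vector_mul_assoc)
    qed
    with og have "g \<in> orthogonal_group_on (range ((*v) U))"
      by (auto simp: orthogonal_group_on_def orthogonal_comp_frame simp del: transpose_matrix_vector)
    moreover have "B = conj_act g (?f A)"
    proof -
      have "conj_act g (?f A) = (g ** U) ** A ** transpose (g ** U)"
        by (simp add: conj_act_def matrix_transpose_mul matrix_mul_assoc)
      then show ?thesis by (simp add: h gU conj_act_def matrix_transpose_mul matrix_mul_assoc)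
    qed
    ultimately show "B \<in> ?L" by blast
  qed
  then show ?thesis
    by (simp add: schur_horn_orbitope_on_def schur_horn_orbitope_def
        convex_hull_linear_image[OF linear_frame_conj])
qed

end

theory Submission
  imports Defs
begin

text \<open>
  Let \<open>l\<close> be the ordered eigenvalue vector of \<open>M\<close>. By the spectral theorem the orbitope of \<open>M\<close> is
  that of the diagonal matrix of \<open>l\<close>, and everything rests on the top sums \<open>lead_sum l m\<close>, the sum of
  the \<open>m\<close> largest entries of \<open>l\<close>. For a matrix \<open>A\<close> in the orbitope, any \<open>m\<close> diagonal entries add up
  to at most \<open>lead_sum l m\<close> (Ky Fan, \<open>ky_fan\<close>), and a vector all of whose subset sums obey these
  bounds, with equal total, lies in the permutahedron (Rado, \<open>permutahedron_if_subset_sums_le\<close>).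
  Together they give Schur's theorem \<open>diag_proj_orbitope\<close>: taking diagonals maps the orbitope into the
  permutahedron, while the permutahedron embeds into the orbitope as diagonal matrices.

  For a set \<open>S\<close> of lengths, the standard face \<open>std_face l S\<close> consists of the matrices for which
  the Ky Fan bound of the first \<open>m\<close> diagonal entries is attained for every \<open>m\<close> in \<open>S\<close>; it is the
  pullback of the face of the permutahedron given by the same equations. The equality case of Ky
  Fan's bound forces the points of the orbit that lie in such a face to be block diagonal, and
  \<open>std_face_eq_hull\<close> identifies the face as the hull of the orbit of the diagonal matrix under
  the block diagonal orthogonal matrices.

  Every nonempty face \<open>F\<close> is conjugate to a standard one (\<open>face_is_conjugate_std_face\<close>). Pick a
  point in the relative interior of \<open>F\<close> and diagonalise it with decreasing diagonal \<open>x\<close>; let \<open>S\<close> record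
  the lengths at which the top sums of \<open>x\<close> and \<open>l\<close> agree. In this frame \<open>std_face l S\<close> is a face through
  a relative interior point of \<open>F\<close>, so it contains \<open>F\<close>. Conversely let \<open>a\<close> be the average of all permutations of \<open>l\<close> within the
  blocks cut out by \<open>S\<close>. The vector \<open>x\<close> may be pushed slightly beyond itself, away from \<open>a\<close>, without
  leaving the permutahedron, so \<open>a\<close> belongs to \<open>F\<close>. Since \<open>a\<close> is constant on blocks, its diagonal matrix
  is fixed by every block diagonal orthogonal \<open>h\<close>, and it is the average of the conjugates under \<open>h\<close>
  of the block permutations of \<open>l\<close>. All summands of that average then lie in the face \<open>F\<close>, among them
  the arbitrary orbit point of \<open>std_face l S\<close> determined by \<open>h\<close>.

  This gives the existence of the orbit of faces of the permutahedron. Uniqueness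
  (\<open>conjugate_pullbacks_imp_same_orbit\<close>): if \<open>g\<close> carries the pullback of \<open>G1\<close> to that of \<open>G2\<close>, take
  \<open>x\<close> in the relative interior of \<open>G1\<close>. The diagonal of the conjugate of its diagonal matrix lies in \<open>G2\<close>,
  and by Schur's theorem it is a convex combination of permutations of \<open>x\<close>, so the face \<open>G2\<close> contains
  a permutation of \<open>x\<close>. Hence \<open>G1\<close> lies in a permuted copy of \<open>G2\<close>; by symmetry and equality of
  dimensions the two coincide.

  Finally, a flag together with blocks of the prescribed spectra is the same as an orthonormal frame
  \<open>g\<close> adapted to the flag whose vectors are eigenvectors of the blocks (\<open>flag_frame\<close>). In that frame
  the product of the orbitopes of the blocks is exactly the conjugate under \<open>g\<close> of a standard face
  (\<open>orbitope_product_frame\<close>), because the convex hull of a Minkowski sum is the sum of the hulls.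
\<close>

section \<open>Diagonal matrices and the conjugation action\<close>

definition diag_mat :: "real^'n \<Rightarrow> real^'n^'n" where
  "diag_mat x = (\<chi> i j. if i = j then x $ i else 0)"

lemma diag_mat_nth: "diag_mat x $ i $ j = (if i = j then x $ i else 0)"
  by (simp add: diag_mat_def)

lemma transpose_diag_mat [simp]: "transpose (diag_mat x) = diag_mat x"
  by (simp add: transpose_def diag_mat_def vec_eq_iff)

lemma diag_proj_diag_mat [simp]: "diag_proj (diag_mat x) = x"
  by (simp add: diag_proj_def diag_mat_def vec_eq_iff)

lemma linear_diag_mat: "linear diag_mat"
  by (rule linearI) (auto simp: diag_mat_def vec_eq_iff)

lemma linear_conj_act: "linear (conj_act g)"
  unfolding conj_act_def[abs_def] by (rule linear_frame_conj)

lemma conj_act_mult: "conj_act (g ** h) A = conj_act g (conj_act h A)"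
  by (simp add: conj_act_def matrix_transpose_mul matrix_mul_assoc)

lemma conj_act_id [simp]: "conj_act (mat 1) A = A"
  by (simp add: conj_act_def)

lemma conj_act_transpose_cancel:
  assumes "orthogonal_matrix g"
  shows "conj_act g (conj_act (transpose g) A) = A" "conj_act (transpose g) (conj_act g A) = A"
  using assms by (simp_all add: orthogonal_matrix_def flip: conj_act_mult)

lemma inj_conj_act: "orthogonal_matrix g \<Longrightarrow> inj (conj_act g)"
  by (rule inj_on_inverseI) (rule conj_act_transpose_cancel(2))

lemma conj_act_image_cancel:
  assumes "orthogonal_matrix g"
  shows "conj_act g ` conj_act (transpose g) ` F = F" "conj_act (transpose g) ` conj_act g ` F = F"
  using assms by (simp_all add: image_image conj_act_transpose_cancel)

lemma transpose_conj_act: "transpose A = A \<Longrightarrow> transpose (conj_act g A) = conj_act g A"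
  by (simp add: conj_act_def matrix_transpose_mul matrix_mul_assoc)

lemma conj_act_diag_mat_nth:
  "conj_act g (diag_mat x) $ i $ j = (\<Sum>k\<in>UNIV. x $ k * g $ i $ k * g $ j $ k)"
  by (simp add: conj_act_def diag_mat_def matrix_matrix_mult_def transpose_def if_distrib
      if_distribR sum.delta mult_ac cong: if_cong)

section \<open>The spectral theorem on an invariant subspace\<close>

lemma symmetric_inner:
  fixes A :: "real^'n^'n"
  assumes "transpose A = A"
  shows "(A *v x) \<bullet> y = x \<bullet> (A *v y)"
  by (metis assms dot_lmul_matrix transpose_matrix_vector)

text \<open>
  A maximiser \<open>v\<close> of the Rayleigh quotient on the unit sphere of \<open>V\<close> is an eigenvector: with maximal value
  \<open>c\<close>, the quadratic form \<open>w \<mapsto> c * (w \<bullet> w) - w \<bullet> (A *v w)\<close> is nonnegative on \<open>V\<close> and vanishes at \<open>v\<close>, so its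
  first variation at \<open>v\<close>, which is \<open>c v - A v\<close>, is orthogonal to \<open>V\<close>.
\<close>

lemma symmetric_eigenvector_in_subspace:
  fixes A :: "real^'n^'n"
  assumes A: "transpose A = A" and V: "subspace V" "V \<noteq> {0}" "\<And>x. x \<in> V \<Longrightarrow> A *v x \<in> V"
  obtains v c where "v \<in> V" "norm v = 1" "A *v v = c *\<^sub>R v"
proof -
  let ?S = "V \<inter> sphere 0 1"
  have "compact ?S"
    using closed_subspace[OF V(1)] by (simp add: closed_Int_compact)
  moreover have "?S \<noteq> {}"
  proof -
    obtain u where "u \<in> V" "u \<noteq> 0" using V subspace_0 by blast
    then have "(1 / norm u) *\<^sub>R u \<in> ?S" using V(1) by (simp add: subspace_scale)
    then show ?thesis by blast
  qed
  moreover have "continuous_on ?S (\<lambda>x. x \<bullet> (A *v x))"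
    by (intro continuous_intros linear_continuous_on matrix_vector_mul_bounded_linear)
  ultimately obtain v where v: "v \<in> ?S" and vmax: "\<And>w. w \<in> ?S \<Longrightarrow> w \<bullet> (A *v w) \<le> v \<bullet> (A *v v)"
    using continuous_attains_sup[of ?S "\<lambda>x. x \<bullet> (A *v x)"] by blast
  define c where "c = v \<bullet> (A *v v)"
  define q where "q w = c * (w \<bullet> w) - w \<bullet> (A *v w)" for w
  have v1: "v \<bullet> v = 1" using v by (simp add: norm_eq_1)
  have q0: "q w \<ge> 0" if "w \<in> V" for w
  proof (cases "w = 0")
    case False
    then have "(1 / norm w) *\<^sub>R w \<in> ?S" using that V(1) by (simp add: subspace_scale)
    from vmax[OF this] have "(1 / norm w)^2 * (w \<bullet> (A *v w)) \<le> c"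
      by (simp add: c_def matrix_vector_mult_scaleR power2_eq_square)
    then have "w \<bullet> (A *v w) \<le> c * (norm w)^2"
      using False by (simp add: field_simps)
    then show ?thesis by (simp add: q_def power2_norm_eq_inner)
  qed (simp add: q_def)
  have orth: "w \<bullet> (c *\<^sub>R v - A *v v) = 0" if w: "w \<in> V" for w
  proof -
    define b where "b = w \<bullet> (c *\<^sub>R v - A *v v)"
    have sym: "v \<bullet> (A *v w) = w \<bullet> (A *v v)"
      using symmetric_inner[OF A, of v w] by (simp add: inner_commute)
    have exp: "q (v + t *\<^sub>R w) = 2 * t * b + t^2 * q w" for t
      by (simp add: q_def b_def matrix_vector_right_distrib matrix_vector_mult_scaleR inner_add_left
          inner_add_right inner_diff_right sym v1 inner_commute[of w v] algebra_simps power2_eq_square)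
         (simp add: c_def)
    have nn: "0 \<le> 2 * t * b + t^2 * q w" for t
      using q0[of "v + t *\<^sub>R w"] v w V(1) exp[of t] by (simp add: subspace_add subspace_scale)
    \<comment> \<open>A step at which the linear term outweighs the quadratic one; the \<open>+ 1\<close> avoids a division by zero.\<close>
    define t where "t = - b / (q w + 1)"
    have qw: "q w \<ge> 0" using q0 w .
    have tb: "t * (q w + 1) = - b" using qw by (simp add: t_def)
    have "2 * t * b + t^2 * q w = t * (2 * b + t * (q w + 1) - t)"
      by (simp add: algebra_simps power2_eq_square)
    also have "\<dots> = t * b - t * t" unfolding tb by (simp add: algebra_simps)
    also have "t * b = - (t * t) * (q w + 1)" 
    proof -
      have "b = - (t * (q w + 1))" using tb by linarith
      then show ?thesis by (simp add: mult.assoc)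
    qed
    finally have "(t * t) * (q w + 2) \<le> 0" using nn[of t] by (simp add: algebra_simps)
    then have "t = 0" using qw by (smt (verit) mult_pos_pos not_real_square_gt_zero)
    then show ?thesis using tb b_def by simp
  qed
  have "c *\<^sub>R v - A *v v \<in> V" using v V by (simp add: subspace_diff subspace_scale)
  from orth[OF this] have "A *v v = c *\<^sub>R v" by simp
  with v show ?thesis by (intro that) auto
qed

definition orthonormal :: "(real^'n) set \<Rightarrow> bool" where
  "orthonormal B \<longleftrightarrow> pairwise orthogonal B \<and> (\<forall>b\<in>B. norm b = 1)"

lemma orthonormal_independent: "orthonormal B \<Longrightarrow> independent B"
  unfolding orthonormal_def by (metis norm_zero pairwise_orthogonal_independent zero_neq_one)

lemma orthonormal_finite: "orthonormal B \<Longrightarrow> finite B"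
  by (metis orthonormal_independent independent_imp_finite)

lemma orthonormal_card: "orthonormal B \<Longrightarrow> card B = dim (span B)"
  by (simp add: orthonormal_independent dim_eq_card_independent)

text \<open>
  Split off an eigenvector and continue in its orthogonal complement within \<open>V\<close>, which the symmetric \<open>A\<close>
  preserves. Working in a subspace of a fixed space, instead of with matrices of smaller size, is what
  later allows a matrix to be diagonalised one block at a time.
\<close>

lemma spectral_theorem_on_subspace:
  fixes A :: "real^'n^'n"
  assumes A: "transpose A = A" and "subspace V" "\<And>x. x \<in> V \<Longrightarrow> A *v x \<in> V"
  shows "\<exists>B. orthonormal B \<and> span B = V \<and> (\<forall>b\<in>B. \<exists>c. A *v b = c *\<^sub>R b)"
  using assms(2,3)
proof (induction "dim V" arbitrary: V rule: less_induct)
  case less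
  show ?case
  proof (cases "V = {0}")
    case True
    then show ?thesis by (intro exI[of _ "{}"]) (simp add: orthonormal_def pairwise_def)
  next
    case False
    obtain v c where v: "v \<in> V" "norm v = 1" "A *v v = c *\<^sub>R v"
      using symmetric_eigenvector_in_subspace[OF A less.prems(1) False less.prems(2)] by blast
    define V' where "V' = V \<inter> {w. orthogonal v w}"
    have sub: "subspace V'"
      unfolding V'_def by (intro subspace_inter less.prems subspace_orthogonal_to_vector)
    have "v \<notin> V'" using v by (auto simp: V'_def orthogonal_def norm_eq_1)
    then have "V' \<subset> V" using v by (auto simp: V'_def)
    then have "dim V' < dim V"
      using dim_psubset sub less.prems(1) by (metis span_eq_iff)
    moreover have "A *v x \<in> V'" if "x \<in> V'" for x
    proof -
      have "v \<bullet> (A *v x) = (A *v v) \<bullet> x" by (simp add: symmetric_inner[OF A])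
      then show ?thesis using that less.prems(2) v by (simp add: V'_def orthogonal_def)
    qed
    ultimately obtain B where B: "orthonormal B" "span B = V'" "\<forall>b\<in>B. \<exists>c. A *v b = c *\<^sub>R b"
      using less.hyps[OF _ sub] by blast
    have BV: "B \<subseteq> V'" using B span_superset by blast
    have "orthonormal (insert v B)"
      using B(1) BV v unfolding orthonormal_def
      by (auto simp: pairwise_insert V'_def orthogonal_commute)
    moreover have "span (insert v B) = V"
    proof
      show "span (insert v B) \<subseteq> V"
        using BV v less.prems(1) by (intro span_minimal) (auto simp: V'_def)
      show "V \<subseteq> span (insert v B)"
      proof
        fix w assume w: "w \<in> V"
        have "w - (v \<bullet> w) *\<^sub>R v \<in> V'"
          using w v less.prems(1)
          by (simp add: V'_def subspace_diff subspace_scale orthogonal_def inner_diff_right norm_eq_1)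
        then have "w - (v \<bullet> w) *\<^sub>R v \<in> span B" using B by simp
        then show "w \<in> span (insert v B)" unfolding span_insert by blast
      qed
    qed
    ultimately show ?thesis using B(3) v(3) by blast
  qed
qed

lemma orthonormal_expansion:
  assumes "orthonormal B" "v \<in> span B"
  shows "(\<Sum>b\<in>B. (v \<bullet> b) *\<^sub>R b) = v"
  using assms orthonormal_finite[OF assms(1)]
  by (intro orthonormal_basis_expand) (auto simp: orthonormal_def)

text \<open>
  By symmetry of \<open>A\<close>, an eigenvector for \<open>\<mu>\<close> is orthogonal to all basis vectors with other eigenvalues, so
  the eigenspace is spanned by part of the basis.
\<close>

lemma eig_mult_on_eigenbasis:
  fixes A :: "real^'n^'n"
  assumes A: "transpose A = A" and B: "orthonormal B" "span B = V"
    and c: "\<And>b. b \<in> B \<Longrightarrow> A *v b = c b *\<^sub>R b"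
  shows "eig_mult_on V A \<mu> = card {b\<in>B. c b = \<mu>}"
proof -
  let ?E = "{b\<in>B. c b = \<mu>}"
  have "{v \<in> V. A *v v = \<mu> *\<^sub>R v} = span ?E"
  proof
    show "{v \<in> V. A *v v = \<mu> *\<^sub>R v} \<subseteq> span ?E"
    proof clarify
      fix v assume v: "v \<in> V" "A *v v = \<mu> *\<^sub>R v"
      have 0: "v \<bullet> b = 0" if "b \<in> B" "c b \<noteq> \<mu>" for b
        using symmetric_inner[OF A, of b v] that v by (simp add: c inner_commute)
      have "v = (\<Sum>b\<in>B. (v \<bullet> b) *\<^sub>R b)"
        using orthonormal_expansion B v by metis
      also have "\<dots> = (\<Sum>b\<in>?E. (v \<bullet> b) *\<^sub>R b)"
        using 0 orthonormal_finite[OF B(1)] by (intro sum.mono_neutral_right) auto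
      also have "\<dots> \<in> span ?E" by (intro span_sum span_scale span_base)
      finally show "v \<in> span ?E" .
    qed
    have "subspace {v \<in> V. A *v v = \<mu> *\<^sub>R v}"
      using B(2) subspace_span[of B]
      by (auto simp: subspace_def matrix_vector_right_distrib matrix_vector_mult_scaleR algebra_simps)
    then show "span ?E \<subseteq> {v \<in> V. A *v v = \<mu> *\<^sub>R v}"
      using c B(2) span_base[of _ B] by (intro span_minimal) auto
  qed
  moreover have "orthonormal ?E" using B(1) by (auto simp: orthonormal_def pairwise_def)
  ultimately show ?thesis by (simp add: eig_mult_on_def orthonormal_card)
qed

section \<open>Eigenbases as orthogonal matrices\<close>

lemma mult_column: "(A ** g) $ i $ j = (A *v column j g) $ i"
  by (simp add: matrix_matrix_mult_def matrix_vector_mult_def column_def)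

lemma mult_diag_mat_nth: "(g ** diag_mat x) $ i $ j = x $ j * g $ i $ j"
  by (simp add: matrix_matrix_mult_def diag_mat_def if_distrib sum.delta mult.commute cong: if_cong)

lemma orthogonal_matrix_from_basis:
  fixes f :: "'n::finite \<Rightarrow> real^'n"
  assumes "inj f" "orthonormal (range f)"
  obtains g where "orthogonal_matrix g" "\<And>j. column j g = f j"
proof
  let ?g = "(\<chi> i j. f j $ i) :: real^'n^'n"
  show col: "column j ?g = f j" for j by (simp add: column_def vec_eq_iff)
  show "orthogonal_matrix ?g"
    unfolding orthogonal_matrix_orthonormal_columns col
    using assms by (auto simp: orthonormal_def pairwise_def inj_def)
qed

lemma eigenvectors_imp_conj_diag_mat:
  fixes g :: "real^'n^'n"
  assumes g: "orthogonal_matrix g" and "\<And>j. A *v column j g = x $ j *\<^sub>R column j g"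
  shows "A = conj_act g (diag_mat x)"
proof -
  have "A ** g = g ** diag_mat x"
    by (simp add: vec_eq_iff mult_column[of A] mult_diag_mat_nth assms(2)) (simp add: column_def)
  then have "A ** (g ** transpose g) = conj_act g (diag_mat x)"
    by (simp add: conj_act_def matrix_mul_assoc)
  then show ?thesis using g by (simp add: orthogonal_matrix_def)
qed

lemma conj_diag_mat_column:
  fixes g :: "real^'n^'n"
  assumes g: "orthogonal_matrix g"
  shows "conj_act g (diag_mat x) *v column j g = x $ j *\<^sub>R column j g"
proof -
  have "conj_act g (diag_mat x) ** g = g ** diag_mat x"
    using g by (simp add: conj_act_def orthogonal_matrix_def flip: matrix_mul_assoc)
  then have "(conj_act g (diag_mat x) *v column j g) $ i = (g ** diag_mat x) $ i $ j" for i
    by (metis mult_column)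
  then show ?thesis
    by (simp add: vec_eq_iff mult_diag_mat_nth) (simp add: column_def)
qed

lemma orthonormal_columns:
  fixes g :: "real^'n^'n"
  assumes "orthogonal_matrix g"
  shows "orthonormal ((\<lambda>j. column j g) ` J)" "inj (\<lambda>j. column j g)"
proof -
  have *: "norm (column i g) = 1" "i \<noteq> j \<Longrightarrow> orthogonal (column i g) (column j g)" for i j
    using assms by (auto simp: orthogonal_matrix_orthonormal_columns)
  show "orthonormal ((\<lambda>j. column j g) ` J)"
    by (auto simp: orthonormal_def pairwise_def *(1) intro!: *(2))
  show "inj (\<lambda>j. column j g)"
    by (rule injI) (metis * orthogonal_self norm_zero zero_neq_one)
qed

lemma eig_mult_on_columns:
  fixes g :: "real^'n^'n"
  assumes g: "orthogonal_matrix g"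
  shows "eig_mult_on (span ((\<lambda>j. column j g) ` J)) (conj_act g (diag_mat x)) \<mu> = card {j\<in>J. x $ j = \<mu>}"
proof -
  let ?f = "\<lambda>j. column j g"
  define c where "c b = x $ (inv ?f b)" for b
  have inj: "inj ?f" by (rule orthonormal_columns(2)[OF g])
  have c: "c (?f j) = x $ j" for j by (simp add: c_def inv_f_f[OF inj])
  have "eig_mult_on (span (?f ` J)) (conj_act g (diag_mat x)) \<mu> = card {b\<in>?f ` J. c b = \<mu>}"
    by (rule eig_mult_on_eigenbasis)
       (auto simp: transpose_conj_act orthonormal_columns[OF g] c conj_diag_mat_column[OF g])
  also have "{b\<in>?f ` J. c b = \<mu>} = ?f ` {j\<in>J. x $ j = \<mu>}" by (auto simp: c)
  also have "card \<dots> = card {j\<in>J. x $ j = \<mu>}" using inj by (intro card_image) (auto simp: inj_on_def)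
  finally show ?thesis .
qed

lemma span_columns_UNIV:
  fixes g :: "real^'n^'n"
  assumes g: "orthogonal_matrix g"
  shows "span (range (\<lambda>j. column j g)) = UNIV"
proof -
  have "dim (span (range (\<lambda>j. column j g))) = CARD('n)"
    using orthonormal_card[OF orthonormal_columns(1)[OF g, of UNIV]] orthonormal_columns(2)[OF g]
    by (simp add: card_image del: dim_span)
  then show ?thesis by (simp flip: dim_eq_full)
qed

lemma eig_mult_conj_diag_mat:
  fixes g :: "real^'n^'n"
  assumes g: "orthogonal_matrix g"
  shows "eig_mult_on UNIV (conj_act g (diag_mat x)) \<mu> = card {j. x $ j = \<mu>}"
  using eig_mult_on_columns[OF g, of UNIV x \<mu>] by (simp add: span_columns_UNIV[OF g])

section \<open>Matching and sorting finite families\<close>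

lemma bij_matching_fibres:
  fixes y :: "'a \<Rightarrow> real"
  assumes "finite J" "finite B" and eq: "\<And>\<mu>. card {j\<in>J. y j = \<mu>} = card {b\<in>B. c b = \<mu>}"
  obtains f where "bij_betw f J B" "\<And>j. j \<in> J \<Longrightarrow> c (f j) = y j"
proof -
  have "\<exists>h. bij_betw h {j\<in>J. y j = \<mu>} {b\<in>B. c b = \<mu>}" for \<mu>
    using assms by (intro finite_same_card_bij) auto
  then obtain h where h: "\<And>\<mu>. bij_betw (h \<mu>) {j\<in>J. y j = \<mu>} {b\<in>B. c b = \<mu>}" by metis
  define f where "f j = h (y j) j" for j
  have f: "f j \<in> B" "c (f j) = y j" if "j \<in> J" for j
    using h[of "y j"] that by (auto simp: f_def bij_betw_def)
  have "inj_on f J"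
  proof (rule inj_onI)
    fix i j assume ij: "i \<in> J" "j \<in> J" "f i = f j"
    then have "y i = y j" using f by metis
    then show "i = j" using h[of "y i"] ij by (auto simp: f_def bij_betw_def inj_on_def)
  qed
  moreover have "b \<in> f ` J" if b: "b \<in> B" for b
  proof -
    have "b \<in> h (c b) ` {j\<in>J. y j = c b}" using h[of "c b"] b by (simp add: bij_betw_def)
    then obtain j where "j \<in> J" "y j = c b" "b = h (c b) j" by blast
    then have "b = f j" by (simp add: f_def)
    then show ?thesis using \<open>j \<in> J\<close> by blast
  qed
  ultimately have "bij_betw f J B" using f by (auto simp: bij_betw_def)
  then show ?thesis using that f by blast
qed

lemma bij_sorting:
  fixes c :: "'b \<Rightarrow> real" and J :: "'a::linorder set"
  assumes "finite J" "finite B" "card J = card B"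
  shows "\<exists>f. bij_betw f J B \<and> (\<forall>i\<in>J. \<forall>j\<in>J. i \<le> j \<longrightarrow> c (f j) \<le> c (f i))"
  using assms
proof (induction J arbitrary: B rule: finite_linorder_min_induct)
  case empty
  then show ?case by (auto simp: bij_betw_def)
next
  case (insert a J)
  have aJ: "a \<notin> J" using insert.hyps by auto
  then have card: "card B = Suc (card J)" using insert by simp
  then have "B \<noteq> {}" by auto
  then obtain b where b: "b \<in> B" "\<And>b'. b' \<in> B \<Longrightarrow> c b' \<le> c b"
    using Max_in[of "c ` B"] Max_ge[of "c ` B"] insert.prems
    by (metis (no_types, lifting) finite_imageI image_iff image_is_empty rev_image_eqI)
  obtain f where f: "bij_betw f J (B - {b})" "\<forall>i\<in>J. \<forall>j\<in>J. i \<le> j \<longrightarrow> c (f j) \<le> c (f i)"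
    using insert.IH[of "B - {b}"] insert.prems b card by auto
  let ?f = "f(a := b)"
  have "bij_betw ?f (insert a J) (insert b (B - {b}))"
    using f(1) aJ by (intro bij_betw_combine[of _ "{a}" "{b}", simplified]) 
      (auto simp: bij_betw_def inj_on_def)
  then have "bij_betw ?f (insert a J) B" using b by (simp add: insert_absorb)
  moreover have "c (?f j) \<le> c (?f i)" if "i \<in> insert a J" "j \<in> insert a J" "i \<le> j" for i j
  proof (cases "i = a")
    case True
    have "?f j \<in> B" using \<open>bij_betw ?f (insert a J) B\<close> that by (auto simp: bij_betw_def)
    then show ?thesis using b True by simp
  next
    case False
    then have "i \<in> J" "a < i" using that insert.hyps by auto
    then have "j \<in> J" "j \<noteq> a" using that by auto
    then show ?thesis using f(2) False that \<open>i \<in> J\<close> by simp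
  qed
  ultimately show ?case by blast
qed

section \<open>Initial segments and decreasing vectors\<close>

definition pos :: "'n::{finite,linorder} \<Rightarrow> nat" where
  "pos j = card {l. l < j}"

definition initial :: "nat \<Rightarrow> 'n::{finite,linorder} set" where
  "initial m = {j. pos j < m}"

definition entry_at :: "nat \<Rightarrow> 'n::{finite,linorder}" where
  "entry_at = inv pos"

definition decreasing :: "real^'n::{finite,linorder} \<Rightarrow> bool" where
  "decreasing x \<longleftrightarrow> (\<forall>i j. i \<le> j \<longrightarrow> x $ j \<le> x $ i)"

definition lead_sum :: "real^'n::{finite,linorder} \<Rightarrow> nat \<Rightarrow> real" where
  "lead_sum x m = (\<Sum>j\<in>initial m. x $ j)"

lemma pos_mono: "i < j \<Longrightarrow> pos i < pos j"
  unfolding pos_def by (rule psubset_card_mono) (auto simp: psubset_eq)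

lemma pos_less_iff [simp]: "pos i < pos j \<longleftrightarrow> i < j"
  by (metis pos_mono less_asym less_linear less_irrefl)

lemma pos_le_iff [simp]: "pos i \<le> pos j \<longleftrightarrow> i \<le> j"
  by (meson linorder_not_less pos_less_iff)

lemma inj_pos: "inj pos"
  by (rule injI) (metis antisym order_refl pos_le_iff)

lemma pos_less_card: "pos (j::'n::{finite,linorder}) < CARD('n)"
  unfolding pos_def by (rule psubset_card_mono) auto

lemma range_pos: "range (pos :: 'n::{finite,linorder} \<Rightarrow> nat) = {..<CARD('n)}"
proof (rule card_subset_eq)
  show "card (range (pos :: 'n \<Rightarrow> nat)) = card {..<CARD('n)}" by (simp add: card_image inj_pos)
qed (auto simp: pos_less_card)

lemma entry_at_pos [simp]: "entry_at (pos j) = j"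
  by (simp add: entry_at_def inj_pos)

lemma pos_entry_at: "p < CARD('n) \<Longrightarrow> pos (entry_at p :: 'n::{finite,linorder}) = p"
  unfolding entry_at_def by (rule f_inv_into_f) (simp add: range_pos)

lemma mem_initial: "j \<in> initial m \<longleftrightarrow> pos j < m"
  by (simp add: initial_def)

lemma initial_0 [simp]: "initial 0 = {}"
  by (simp add: initial_def)

lemma initial_full [simp]: "initial (CARD('n)) = (UNIV :: 'n::{finite,linorder} set)"
  by (simp add: initial_def pos_less_card)

lemma initial_Suc:
  "m < CARD('n) \<Longrightarrow> initial (Suc m) = insert (entry_at m) (initial m :: 'n::{finite,linorder} set)"
  by (auto simp: mem_initial pos_entry_at less_Suc_eq)

lemma entry_at_notin_initial: "m < CARD('n) \<Longrightarrow> (entry_at m :: 'n::{finite,linorder}) \<notin> initial m"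
  by (simp add: mem_initial pos_entry_at)

lemma card_initial: "m \<le> CARD('n) \<Longrightarrow> card (initial m :: 'n::{finite,linorder} set) = m"
  by (induction m) (auto simp: initial_Suc entry_at_notin_initial)

lemma sum_initial_Suc:
  "m < CARD('n) \<Longrightarrow> sum f (initial (Suc m)) = sum f (initial m) + (f (entry_at m :: 'n::{finite,linorder}) :: real)"
  by (simp add: initial_Suc entry_at_notin_initial)

lemma lead_sum_Suc:
  "m < CARD('n) \<Longrightarrow> lead_sum x (Suc m) = lead_sum x m + x $ (entry_at m :: 'n::{finite,linorder})"
  by (simp add: lead_sum_def sum_initial_Suc)

lemma lead_sum_0 [simp]: "lead_sum x 0 = 0"
  by (simp add: lead_sum_def)

lemma lead_sum_arith:
  "lead_sum (x + y) m = lead_sum x m + lead_sum y m"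
  "lead_sum (x - y) m = lead_sum x m - lead_sum y m"
  "lead_sum (c *\<^sub>R x) m = c * lead_sum x m"
  by (simp_all add: lead_sum_def sum.distrib sum_subtractf sum_distrib_left)

lemma decreasing_adjacent:
  fixes x :: "real^'n::{finite,linorder}"
  assumes "\<And>p. Suc p < CARD('n) \<Longrightarrow> x $ entry_at (Suc p) \<le> x $ entry_at p"
  shows "decreasing x"
  unfolding decreasing_def
proof (intro allI impI)
  fix i j :: 'n assume "i \<le> j"
  have "q < CARD('n) \<Longrightarrow> p \<le> q \<Longrightarrow> x $ entry_at q \<le> x $ entry_at p" for p q
  proof (induction q)
    case (Suc q)
    then show ?case using assms[of q] by (cases "p = Suc q") force+
  qed simp
  from this[of "pos j" "pos i"] show "x $ j \<le> x $ i" using \<open>i \<le> j\<close> by (simp add: pos_less_card)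
qed

text \<open>
  The number of entries at or above a threshold \<open>c\<close> depends only on the fibres. If \<open>x\<close> exceeded \<open>y\<close> at the index
  \<open>j\<close>, then at the threshold \<open>x $ j\<close> the vector \<open>x\<close> would have all entries up to \<open>j\<close> at or above it, whereas
  \<open>y\<close> could have only entries strictly before \<open>j\<close> there.
\<close>

lemma decreasing_determined_by_fibres:
  fixes x y :: "real^'n::{finite,linorder}"
  assumes "decreasing x" "decreasing y" and eq: "\<And>\<mu>. card {i. x $ i = \<mu>} = card {i. y $ i = \<mu>}"
  shows "x = y"
proof -
  have count: "card {i. c \<le> x $ i} = card {i. c \<le> y $ i}" for c
  proof -
    obtain f where f: "bij_betw f UNIV UNIV" "\<And>i. y $ f i = x $ i"
      using bij_matching_fibres[of UNIV UNIV "($) x" "($) y"] eq by auto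
    have "{i. c \<le> y $ i} = f ` {i. c \<le> x $ i}"
      using f by (auto simp: bij_betw_def) (metis (mono_tags) UNIV_I image_iff mem_Collect_eq)
    moreover have "inj_on f {i. c \<le> x $ i}" using f(1) by (auto simp: bij_betw_def inj_on_def)
    ultimately show ?thesis by (simp add: card_image)
  qed
  have le: "x $ j \<le> y $ j"
    if d: "decreasing x" "decreasing y" and cnt: "\<And>c. card {i. c \<le> x $ i} = card {i. c \<le> y $ i}"
    for x y :: "real^('n::{finite,linorder})" and j
  proof (rule ccontr)
    assume less: "\<not> x $ j \<le> y $ j"
    have "{i. i \<le> j} \<subseteq> {i. x $ j \<le> x $ i}" using d by (auto simp: decreasing_def)
    moreover have "{i. x $ j \<le> y $ i} \<subseteq> {i. i < j}"
    proof clarify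
      fix i assume "x $ j \<le> y $ i"
      then have "y $ j < y $ i" using less by linarith
      then show "i < j" using d by (meson decreasing_def linorder_not_less)
    qed
    ultimately have "card {i. i \<le> j} \<le> card {i. i < j}"
      using cnt by (metis card_mono finite order_trans)
    moreover have "card {i. i < j} < card {i. i \<le> j}"
      by (rule psubset_card_mono) auto
    ultimately show False by simp
  qed
  show ?thesis using le[of x y] le[of y x] assms count by (simp add: vec_eq_iff antisym)
qed

section \<open>Top sums and the theorem of Rado\<close>

lemma decreasing_threshold:
  fixes x :: "real^'n::{finite,linorder}"
  assumes "decreasing x"
  obtains c where "\<And>k. k \<in> initial m \<Longrightarrow> c \<le> x $ k" "\<And>k. k \<notin> initial m \<Longrightarrow> x $ k \<le> c"
proof (cases "initial m = ({} :: 'n set)")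
  case True
  then show ?thesis using that[of "Max (range (($) x))"] by simp
next
  case False
  have "x $ k \<le> Min (($) x ` initial m)" if "k \<notin> initial m" for k
  proof -
    have "x $ k \<le> x $ j" if "j \<in> initial m" for j
    proof -
      have "pos j < pos k" using that \<open>k \<notin> initial m\<close> by (simp add: mem_initial del: pos_less_iff)
      then show ?thesis using assms by (simp add: decreasing_def)
    qed
    then show ?thesis using False by simp
  qed
  then show ?thesis using that[of "Min (($) x ` initial m)"] by simp
qed

text \<open>
  Both sides agree for any \<open>c\<close> because the weights \<open>w\<close> and the indicator of the initial segment have the
  same total \<open>m\<close>. For a threshold \<open>c\<close> separating the first \<open>m\<close> entries from the others every summand
  on the right is nonnegative, which yields the inequality and its equality case together.
\<close>

lemma lead_sum_minus_weighted:
  fixes x :: "real^'n::{finite,linorder}"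
  assumes w: "(\<Sum>k\<in>UNIV. w k) = real m" and m: "m \<le> CARD('n)"
  shows "lead_sum x m - (\<Sum>k\<in>UNIV. w k * x $ k) =
    (\<Sum>k\<in>UNIV. if k \<in> initial m then (1 - w k) * (x $ k - c) else w k * (c - x $ k))"
proof -
  have 1: "(\<Sum>k\<in>UNIV. (if k \<in> initial m then f k else 0)) = sum f (initial m)" for f :: "'n \<Rightarrow> real"
    by (simp add: sum.If_cases)
  have "(\<Sum>k\<in>UNIV. if k \<in> initial m then (1 - w k) * (x $ k - c) else w k * (c - x $ k)) =
     (\<Sum>k\<in>UNIV. (if k \<in> initial m then x $ k else 0) - w k * x $ k
        - c * (if k \<in> initial m then 1 else 0) + c * w k)"
    by (intro sum.cong) (auto simp: algebra_simps)
  also have "\<dots> = lead_sum x m - (\<Sum>k\<in>UNIV. w k * x $ k) - c * (\<Sum>k\<in>(initial m :: 'n set). 1) + c * (\<Sum>k\<in>UNIV. w k)"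
    by (simp add: sum.distrib sum_subtractf 1 lead_sum_def 1[of "\<lambda>_. 1"] del: sum_constant flip: sum_distrib_left)
  also have "\<dots> = lead_sum x m - (\<Sum>k\<in>UNIV. w k * x $ k)"
    using m by (simp add: w card_initial)
  finally show ?thesis by simp
qed

lemma weighted_sum_le_lead_sum:
  fixes x :: "real^'n::{finite,linorder}"
  assumes x: "decreasing x" and w01: "\<And>k. 0 \<le> w k" "\<And>k. w k \<le> 1"
    and w: "(\<Sum>k\<in>UNIV. w k) = real m" and m: "m \<le> CARD('n)"
  shows "(\<Sum>k\<in>UNIV. w k * x $ k) \<le> lead_sum x m"
    and "(\<Sum>k\<in>UNIV. w k * x $ k) = lead_sum x m \<Longrightarrow> \<exists>c. \<forall>k. (c < x $ k \<longrightarrow> w k = 1) \<and> (x $ k < c \<longrightarrow> w k = 0)"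
proof -
  obtain c where c: "\<And>k. k \<in> initial m \<Longrightarrow> c \<le> x $ k" "\<And>k. k \<notin> initial m \<Longrightarrow> x $ k \<le> c"
    using decreasing_threshold[OF x] by blast
  let ?t = "\<lambda>k. if k \<in> initial m then (1 - w k) * (x $ k - c) else w k * (c - x $ k)"
  have nn: "0 \<le> ?t k" for k using c w01 by simp
  note eq = lead_sum_minus_weighted[OF w m, of x c]
  show "(\<Sum>k\<in>UNIV. w k * x $ k) \<le> lead_sum x m"
    using eq sum_nonneg[of UNIV ?t] nn by simp
  assume "(\<Sum>k\<in>UNIV. w k * x $ k) = lead_sum x m"
  then have "sum ?t UNIV = 0" using eq by simp
  then have t0: "?t k = 0" for k using sum_nonneg_eq_0_iff[of UNIV ?t] nn by simp
  have "(c < x $ k \<longrightarrow> w k = 1) \<and> (x $ k < c \<longrightarrow> w k = 0)" for k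
    using t0[of k] c(1)[of k] c(2)[of k] by (auto split: if_splits)
  then show "\<exists>c. \<forall>k. (c < x $ k \<longrightarrow> w k = 1) \<and> (x $ k < c \<longrightarrow> w k = 0)" by blast
qed

lemma subset_sum_le_lead_sum:
  fixes x :: "real^'n::{finite,linorder}"
  assumes "decreasing x"
  shows "(\<Sum>k\<in>T. x $ k) \<le> lead_sum x (card T)"
proof -
  have "(\<Sum>k\<in>UNIV. (if k \<in> T then 1 else 0) * x $ k) = (\<Sum>k\<in>T. x $ k)"
    by (simp add: if_distrib[where f = "\<lambda>u. u * _"] sum.If_cases cong: if_cong)
  then show ?thesis
    using weighted_sum_le_lead_sum(1)[OF assms, of "\<lambda>k. if k \<in> T then 1 else 0" "card T"]
    by (simp add: sum.If_cases card_mono)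
qed

text \<open>
  Summation by parts: \<open>a \<bullet> d\<close> is a combination of the partial sums of \<open>d\<close> whose coefficients, the
  decrements of \<open>a\<close>, are nonnegative, except for the total of \<open>d\<close>, which vanishes.
\<close>

lemma abel_nonpos:
  fixes a d :: "real^'n::{finite,linorder}"
  assumes a: "decreasing a" and d: "\<And>m. m \<le> CARD('n) \<Longrightarrow> lead_sum d m \<le> 0" "lead_sum d (CARD('n)) = 0"
  shows "a \<bullet> d \<le> 0"
proof -
  have "m < CARD('n) \<Longrightarrow> (\<Sum>i\<in>initial (Suc m). a $ i * d $ i) \<le> a $ entry_at m * lead_sum d (Suc m)" for m
  proof (induction m)
    case 0
    then show ?case by (simp add: sum_initial_Suc lead_sum_def)
  next
    case (Suc m)
    have "pos (entry_at m :: 'n) \<le> pos (entry_at (Suc m) :: 'n)" using Suc.prems by (simp add: pos_entry_at del: pos_le_iff)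
    then have "a $ entry_at (Suc m) \<le> a $ entry_at m" using a by (simp add: decreasing_def)
    then have "a $ entry_at m * lead_sum d (Suc m) \<le> a $ entry_at (Suc m) * lead_sum d (Suc m)"
      using d(1)[of "Suc m"] Suc.prems by (intro mult_right_mono_neg) auto
    then have "(\<Sum>i\<in>initial (Suc m). a $ i * d $ i) \<le> a $ entry_at (Suc m) * lead_sum d (Suc m)"
      using Suc by force
    then show ?case
      using Suc.prems by (simp add: sum_initial_Suc[of "Suc m"] lead_sum_Suc[of "Suc m"] algebra_simps)
  qed
  from this[of "CARD('n) - 1"] d(2) show ?thesis by (simp add: inner_vec_def)
qed

lemma finite_perm_orbit: "finite {perm_act \<pi> p |\<pi>. \<pi> permutes (UNIV :: 'n::finite set)}"
  by (rule finite_image_set) (simp add: finite_permutations)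

lemma perm_act_in_permutahedron: "\<pi> permutes UNIV \<Longrightarrow> perm_act \<pi> p \<in> permutahedron p"
  unfolding permutahedron_def by (rule hull_inc) blast

text \<open>
  Rado's theorem. A point outside would be separated from the permutahedron by a linear functional.
  Sorting its coefficients turns the bounds on subset sums into bounds on initial sums, and
  summation by parts shows that a suitable permutation of \<open>l\<close> does at least as well as \<open>y\<close>.
\<close>

lemma permutahedron_if_subset_sums_le:
  fixes l y :: "real^'n::{finite,linorder}"
  assumes le: "\<And>T. (\<Sum>i\<in>T. y $ i) \<le> lead_sum l (card T)"
    and eq: "(\<Sum>i\<in>UNIV. y $ i) = lead_sum l (CARD('n))"
  shows "y \<in> permutahedron l"
proof (rule ccontr)
  assume "y \<notin> permutahedron l"
  moreover have "convex (permutahedron l)" "closed (permutahedron l)"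
    unfolding permutahedron_def using finite_perm_orbit[of l]
    by (simp_all add: compact_imp_closed compact_convex_hull finite_imp_compact)
  ultimately obtain a b where ab: "a \<bullet> y < b" "\<And>x. x \<in> permutahedron l \<Longrightarrow> b < a \<bullet> x"
    using separating_hyperplane_closed_point[of "permutahedron l" y] by metis
  obtain f :: "'n \<Rightarrow> 'n" where f: "bij f" and sorted: "\<And>i j. i \<le> j \<Longrightarrow> - a $ f j \<le> - a $ f i"
    using bij_sorting[of "UNIV :: 'n set" "UNIV :: 'n set" "\<lambda>i. - a $ i"] by auto
  define \<alpha> :: "(real, 'n) vec" where "\<alpha> = (\<chi> i. - a $ f i)"
  define d :: "(real, 'n) vec" where "d = (\<chi> i. y $ f i - l $ i)"
  have inj: "inj_on f S" for S using f by (auto simp: bij_def inj_on_def)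
  have lead: "lead_sum d m = (\<Sum>i\<in>f ` initial m. y $ i) - lead_sum l m" for m
    by (simp add: lead_sum_def d_def sum_subtractf sum.reindex[OF inj])
  have "\<alpha> \<bullet> d \<le> 0"
  proof (rule abel_nonpos)
    show "decreasing \<alpha>" using sorted by (simp add: decreasing_def \<alpha>_def)
    show "lead_sum d m \<le> 0" if "m \<le> CARD('n)" for m
      using le[of "f ` initial m"] that by (simp add: lead card_image[OF inj] card_initial)
    show "lead_sum d (CARD('n)) = 0" using eq f by (simp add: lead bij_def)
  qed
  moreover have "\<alpha> \<bullet> d = - (a \<bullet> y) + a \<bullet> perm_act (inv f) l"
  proof -
    have "\<alpha> \<bullet> d = - (\<Sum>i\<in>UNIV. a $ f i * y $ f i) + (\<Sum>i\<in>UNIV. a $ f i * l $ inv f (f i))"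
      using f by (simp add: inner_vec_def \<alpha>_def d_def algebra_simps sum_subtractf bij_def)
    also have "(\<Sum>i\<in>UNIV. a $ f i * y $ f i) = a \<bullet> y"
      using sum.reindex_bij_betw[of f UNIV UNIV "\<lambda>i. a $ i * y $ i"] f by (simp add: inner_vec_def)
    also have "(\<Sum>i\<in>UNIV. a $ f i * l $ inv f (f i)) = a \<bullet> perm_act (inv f) l"
      using sum.reindex_bij_betw[of f UNIV UNIV "\<lambda>i. a $ i * l $ inv f i"] f
      by (simp add: inner_vec_def perm_act_def)
    finally show ?thesis .
  qed
  moreover have "inv f permutes UNIV" using bij_imp_bij_inv[OF f] by (intro bij_imp_permutes) auto
  then have "b < a \<bullet> perm_act (inv f) l" by (intro ab(2) perm_act_in_permutahedron)
  ultimately show False using ab(1) by linarith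
qed

section \<open>Ky Fan's bounds and Schur's theorem\<close>

lemma orthogonal_matrix_row_sum:
  fixes g :: "real^'n^'n"
  assumes "orthogonal_matrix g"
  shows "(\<Sum>k\<in>UNIV. g $ i $ k * g $ j $ k) = (if i = j then 1 else 0)"
proof -
  have "(g ** transpose g) $ i $ j = (mat 1 :: real^'n^'n) $ i $ j" using assms by (simp add: orthogonal_matrix_def)
  then show ?thesis by (simp add: matrix_matrix_mult_def transpose_def mat_def)
qed

lemma orthogonal_matrix_column_sum:
  fixes g :: "real^'n^'n"
  assumes "orthogonal_matrix g"
  shows "(\<Sum>k\<in>UNIV. g $ k $ i * g $ k $ j) = (if i = j then 1 else 0)"
  using orthogonal_matrix_row_sum[of "transpose g" i j] assms by (simp add: transpose_def orthogonal_matrix_transpose[unfolded transpose_def])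

text \<open>
  A sum of diagonal entries of a conjugate of a diagonal matrix is a weighted sum of its diagonal, and
  the squares of the entries of an orthogonal matrix supply weights between 0 and 1 of total \<open>card T\<close>.
\<close>

lemma orbit_diagonal_weights:
  fixes g :: "real^'n^'n"
  assumes g: "orthogonal_matrix g"
  defines "w T k \<equiv> \<Sum>i\<in>T. (g $ i $ k)\<^sup>2"
  shows "(\<Sum>i\<in>T. conj_act g (diag_mat x) $ i $ i) = (\<Sum>k\<in>UNIV. w T k * x $ k)"
    and "0 \<le> w T k" "w T k \<le> 1" "(\<Sum>k\<in>UNIV. w T k) = real (card T)"
proof -
  show "(\<Sum>i\<in>T. conj_act g (diag_mat x) $ i $ i) = (\<Sum>k\<in>UNIV. w T k * x $ k)"
    unfolding w_def conj_act_diag_mat_nth sum_distrib_right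
    by (subst sum.swap) (simp add: power2_eq_square mult_ac)
  show "0 \<le> w T k" by (simp add: w_def sum_nonneg)
  have "w T k \<le> w UNIV k" unfolding w_def by (rule sum_mono2) auto
  also have "w UNIV k = 1" using orthogonal_matrix_column_sum[OF g, of k k] by (simp add: w_def power2_eq_square)
  finally show "w T k \<le> 1" .
  have "(\<Sum>k\<in>UNIV. w T k) = (\<Sum>i\<in>T. \<Sum>k\<in>UNIV. (g $ i $ k)\<^sup>2)" unfolding w_def by (rule sum.swap)
  also have "\<dots> = real (card T)" using orthogonal_matrix_row_sum[OF g] by (simp add: power2_eq_square)
  finally show "(\<Sum>k\<in>UNIV. w T k) = real (card T)" .
qed

lemma inner_diag_mat: "diag_mat x \<bullet> A = (\<Sum>i\<in>UNIV. x $ i * A $ i $ i)"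
proof -
  have "diag_mat x \<bullet> A = (\<Sum>i\<in>UNIV. \<Sum>j\<in>UNIV. if j = i then x $ i * A $ i $ i else 0)"
    unfolding inner_vec_def by (intro sum.cong refl) (auto simp: diag_mat_nth)
  then show ?thesis by simp
qed

definition indicator_vec :: "'n set \<Rightarrow> real^'n" where
  "indicator_vec T = (\<chi> i. if i \<in> T then 1 else 0)"

lemma inner_diag_mat_indicator_vec: "diag_mat (indicator_vec T) \<bullet> A = (\<Sum>i\<in>T. A $ i $ i)"
  by (simp add: inner_diag_mat indicator_vec_def if_distrib[where f = "\<lambda>u. u * _"] sum.If_cases cong: if_cong)

lemma orbit_subset_orbitope: "orthogonal_matrix g \<Longrightarrow> conj_act g M \<in> schur_horn_orbitope M"
  unfolding schur_horn_orbitope_def by (rule hull_inc) blast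

lemma ky_fan:
  fixes l :: "real^'n::{finite,linorder}"
  assumes l: "decreasing l" and A: "A \<in> schur_horn_orbitope (diag_mat l)"
  shows "(\<Sum>i\<in>T. A $ i $ i) \<le> lead_sum l (card T)"
proof -
  have "schur_horn_orbitope (diag_mat l) \<subseteq> {A. diag_mat (indicator_vec T) \<bullet> A \<le> lead_sum l (card T)}"
    unfolding schur_horn_orbitope_def
    by (intro hull_minimal convex_halfspace_le)
       (auto simp: inner_diag_mat_indicator_vec orbit_diagonal_weights(1)
          intro!: weighted_sum_le_lead_sum(1)[OF l] orbit_diagonal_weights(2-) card_mono)
  with A show ?thesis by (auto simp: inner_diag_mat_indicator_vec)
qed

lemma orbitope_trace:
  fixes l :: "real^'n::{finite,linorder}"
  assumes A: "A \<in> schur_horn_orbitope (diag_mat l)"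
  shows "(\<Sum>i\<in>UNIV. A $ i $ i) = lead_sum l (CARD('n))"
proof -
  have "(\<Sum>i\<in>UNIV. conj_act g (diag_mat l) $ i $ i) = (\<Sum>i\<in>UNIV. l $ i)" if "orthogonal_matrix g" for g
    using orthogonal_matrix_column_sum[OF that]
    by (simp add: orbit_diagonal_weights(1)[OF that] power2_eq_square)
  then have "schur_horn_orbitope (diag_mat l) \<subseteq> {A. diag_mat (indicator_vec UNIV) \<bullet> A = lead_sum l (CARD('n))}"
    unfolding schur_horn_orbitope_def
    by (intro hull_minimal convex_hyperplane) (auto simp: inner_diag_mat_indicator_vec lead_sum_def)
  with A show ?thesis by (auto simp: inner_diag_mat_indicator_vec)
qed

text \<open>
  Schur's theorem: Ky Fan's bounds are exactly the hypotheses of Rado's theorem.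
\<close>

lemma diag_proj_orbitope:
  fixes l :: "real^'n::{finite,linorder}"
  assumes "decreasing l" "A \<in> schur_horn_orbitope (diag_mat l)"
  shows "diag_proj A \<in> permutahedron l"
  by (rule permutahedron_if_subset_sums_le)
     (simp_all add: diag_proj_def ky_fan[OF assms] orbitope_trace[OF assms(2)])

lemma conj_diag_mat_perm:
  assumes \<pi>: "\<pi> permutes (UNIV :: 'n::finite set)"
  obtains R :: "real^'n^'n" where "orthogonal_matrix R" "\<And>x. conj_act R (diag_mat x) = diag_mat (perm_act \<pi> x)"
proof
  let ?R = "(\<chi> i j. if j = \<pi> i then 1 else 0) :: real^'n^'n"
  have inj: "\<pi> i = \<pi> j \<longleftrightarrow> i = j" for i j using permutes_inj[OF \<pi>] by (simp add: inj_eq)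
  have prod: "(if a = u then 1 else 0) * (if a = v then 1 else 0) = (if a = u then if u = v then 1 else 0 else (0::real))"
    for a u v :: 'n by simp
  show "orthogonal_matrix ?R"
    by (auto simp: orthogonal_matrix_orthonormal_rows norm_eq_1 orthogonal_def inner_vec_def row_def inj prod)
  show "conj_act ?R (diag_mat x) = diag_mat (perm_act \<pi> x)" for x
    by (simp add: vec_eq_iff conj_act_diag_mat_nth diag_mat_nth perm_act_def inj prod mult.assoc)
      (simp add: if_distrib[where f = "\<lambda>u. _ * u"] cong: if_cong)
qed

lemma diag_mat_permutahedron:
  fixes l :: "real^'n::finite"
  assumes "x \<in> permutahedron l"
  shows "diag_mat x \<in> schur_horn_orbitope (diag_mat l)"
proof -
  have "diag_mat ` {perm_act \<pi> l |\<pi>. \<pi> permutes UNIV} \<subseteq> {conj_act g (diag_mat l) |g. orthogonal_matrix g}"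
  proof clarify
    fix \<pi> :: "'n \<Rightarrow> 'n" assume "\<pi> permutes UNIV"
    then obtain R :: "real^'n^'n" where "orthogonal_matrix R" "\<And>x. conj_act R (diag_mat x) = diag_mat (perm_act \<pi> x)"
      by (rule conj_diag_mat_perm) blast
    then show "\<exists>g. diag_mat (perm_act \<pi> l) = conj_act g (diag_mat l) \<and> orthogonal_matrix g" by metis
  qed
  then have "convex hull diag_mat ` {perm_act \<pi> l |\<pi>. \<pi> permutes UNIV} \<subseteq> schur_horn_orbitope (diag_mat l)"
    unfolding schur_horn_orbitope_def by (rule hull_mono)
  then have "diag_mat ` permutahedron l \<subseteq> schur_horn_orbitope (diag_mat l)"
    unfolding permutahedron_def convex_hull_linear_image[OF linear_diag_mat] .
  with assms show ?thesis by blast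
qed

section \<open>Standard faces and block diagonal matrices\<close>

text \<open>
  The cuts in \<open>S\<close> divide the index set into consecutive blocks; \<open>separated S i j\<close> says that \<open>i\<close> and \<open>j\<close>
  belong to different blocks.
\<close>

definition separated :: "nat set \<Rightarrow> 'n::{finite,linorder} \<Rightarrow> 'n \<Rightarrow> bool" where
  "separated S i j \<longleftrightarrow> (\<exists>m\<in>S. (i \<in> initial m) \<noteq> (j \<in> initial m))"

definition block_diagonal :: "nat set \<Rightarrow> real^('n::{finite,linorder})^('n::{finite,linorder}) \<Rightarrow> bool" where
  "block_diagonal S A \<longleftrightarrow> (\<forall>i j. separated S i j \<longrightarrow> A $ i $ j = 0)"

definition std_face :: "real^('n::{finite,linorder}) \<Rightarrow> nat set \<Rightarrow> (real^('n::{finite,linorder})^('n::{finite,linorder})) set" where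
  "std_face l S = {A \<in> schur_horn_orbitope (diag_mat l). \<forall>m\<in>S. (\<Sum>i\<in>initial m. A $ i $ i) = lead_sum l m}"

lemma convex_orbitope: "convex (schur_horn_orbitope M)"
  by (simp add: schur_horn_orbitope_def)

text \<open>
  A convex combination with a positive weight on \<open>x i\<close> either equals \<open>x i\<close> or lies in the open segment
  between \<open>x i\<close> and the renormalised remainder, so a face containing it contains \<open>x i\<close>.
\<close>

lemma face_contains_summands:
  fixes S :: "'a::real_vector set"
  assumes F: "F face_of S" and S: "convex S" and I: "finite I" "i \<in> I"
    and x: "\<And>j. j \<in> I \<Longrightarrow> x j \<in> S" and u: "\<And>j. j \<in> I \<Longrightarrow> 0 \<le> u j" "sum u I = 1" "0 < u i"
    and sum: "(\<Sum>j\<in>I. u j *\<^sub>R x j) \<in> F"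
  shows "x i \<in> F"
proof -
  have split: "sum u I = u i + sum u (I - {i})" 
    "(\<Sum>j\<in>I. u j *\<^sub>R x j) = u i *\<^sub>R x i + (\<Sum>j\<in>I-{i}. u j *\<^sub>R x j)"
    using I by (simp_all add: sum.remove)
  show ?thesis
  proof (cases "u i = 1")
    case True
    then have "sum u (I - {i}) = 0" using split u by simp
    then have "\<forall>j\<in>I-{i}. u j = 0" using I u by (subst (asm) sum_nonneg_eq_0_iff) auto
    then have "(\<Sum>j\<in>I. u j *\<^sub>R x j) = x i" using split(2) True by simp
    then show ?thesis using sum by simp
  next
    case False
    have le: "sum u (I - {i}) \<ge> 0" using u by (intro sum_nonneg) auto
    then have lt: "u i < 1" using False split u by simp
    define r where "r = (\<Sum>j\<in>I-{i}. (u j / (1 - u i)) *\<^sub>R x j)"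
    have r: "r \<in> S"
      unfolding r_def using I S x u lt split
      by (intro convex_sum) (auto simp flip: sum_divide_distrib)
    have "(1 - u i) *\<^sub>R r = (\<Sum>j\<in>I-{i}. u j *\<^sub>R x j)"
      using lt by (simp add: r_def scaleR_sum_right)
    then have eq: "(\<Sum>j\<in>I. u j *\<^sub>R x j) = u i *\<^sub>R x i + (1 - u i) *\<^sub>R r" using split by simp
    show ?thesis
    proof (cases "x i = r")
      case True
      then have "(\<Sum>j\<in>I. u j *\<^sub>R x j) = x i" using eq by (simp flip: scaleR_add_left)
      then show ?thesis using sum by simp
    next
      case False
      then have "(\<Sum>j\<in>I. u j *\<^sub>R x j) \<in> open_segment r (x i)"
        using eq lt u(3) by (auto simp: in_segment intro!: exI[of _ "u i"])
      then show ?thesis using face_ofD[OF F] r x[OF I(2)] sum by blast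
    qed
  qed
qed

lemma face_of_convex_hull_eq:
  fixes X :: "'a::real_vector set"
  assumes F: "F face_of convex hull X"
  shows "F = convex hull (F \<inter> X)"
proof
  have "convex F" using F by (rule face_of_imp_convex)
  then show "convex hull (F \<inter> X) \<subseteq> F" by (intro hull_minimal) auto
  show "F \<subseteq> convex hull (F \<inter> X)"
  proof
    fix y assume y: "y \<in> F"
    then have "y \<in> convex hull X" using face_of_imp_subset[OF F] by blast
    then obtain T u where T: "finite T" "T \<subseteq> X" "\<forall>x\<in>T. 0 \<le> u x" "sum u T = 1" "(\<Sum>v\<in>T. u v *\<^sub>R v) = y"
      unfolding convex_hull_explicit by blast
    let ?T = "{v\<in>T. 0 < u v}"
    have in_F: "v \<in> F" if "v \<in> ?T" for v
      by (rule face_contains_summands[OF F, of T v "\<lambda>v. v" u])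
         (use that T y hull_subset[of X] in auto)
    have nz: "0 < u v \<or> u v = 0" if "v \<in> T" for v using that T(3) by force
    have "sum u ?T = sum u T" "(\<Sum>v\<in>?T. u v *\<^sub>R v) = (\<Sum>v\<in>T. u v *\<^sub>R v)"
      using T(1) by (auto intro!: sum.mono_neutral_left dest: nz)
    then have sums: "sum u ?T = 1" "(\<Sum>v\<in>?T. u v *\<^sub>R v) = y" using T(4,5) by simp_all
    have "?T \<subseteq> convex hull (F \<inter> X)" using in_F T(2) hull_subset[of "F \<inter> X"] by blast
    then show "y \<in> convex hull (F \<inter> X)"
      unfolding sums(2)[symmetric] using T(1) sums(1) by (intro convex_sum) auto
  qed
qed

lemma std_face_face_of:
  fixes l :: "real^'n::{finite,linorder}"
  assumes l: "decreasing l" and S: "S \<subseteq> {..CARD('n)}"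
  shows "std_face l S face_of schur_horn_orbitope (diag_mat l)"
proof -
  let ?O = "schur_horn_orbitope (diag_mat l)"
  let ?H = "\<lambda>m. ?O \<inter> {A. diag_mat (indicator_vec (initial m)) \<bullet> A = lead_sum l m}"
  have "?H m face_of ?O" if "m \<in> S" for m
  proof (rule face_of_Int_supporting_hyperplane_le[OF convex_orbitope])
    fix A assume "A \<in> ?O"
    then show "diag_mat (indicator_vec (initial m)) \<bullet> A \<le> lead_sum l m"
      using ky_fan[OF l, of A "initial m"] that S by (auto simp: inner_diag_mat_indicator_vec card_initial)
  qed
  then have "\<Inter> (insert ?O (?H ` S)) face_of ?O"
    by (intro face_of_Inter) (auto simp: face_of_refl convex_orbitope)
  moreover have "std_face l S = \<Inter> (insert ?O (?H ` S))"
    by (auto simp: std_face_def inner_diag_mat_indicator_vec)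
  ultimately show ?thesis by simp
qed

text \<open>
  This is the equality case of Ky Fan's bound. If the first \<open>m\<close> diagonal entries of \<open>A = g diag(l) g\<^sup>T\<close> reach the
  top sum, there is a threshold \<open>c\<close> such that each column of \<open>g\<close> with eigenvalue above \<open>c\<close> is supported on
  the first \<open>m\<close> coordinates and each column with eigenvalue below \<open>c\<close> on the others. Hence
  \<open>A - c I\<close> has no entry coupling the two groups of coordinates.
\<close>

lemma orbit_std_face_block_diagonal:
  fixes l :: "real^'n::{finite,linorder}"
  assumes l: "decreasing l" and S: "S \<subseteq> {..CARD('n)}" and g: "orthogonal_matrix g"
    and A: "conj_act g (diag_mat l) \<in> std_face l S"
  shows "block_diagonal S (conj_act g (diag_mat l))"
proof -
  have 0: "conj_act g (diag_mat l) $ i $ j = 0" if m: "m \<in> S" and i: "i \<in> initial m" and j: "j \<notin> initial m" for m i j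
  proof -
    define w where "w T k = (\<Sum>i\<in>T. (g $ i $ k)\<^sup>2)" for T k
    note W = orbit_diagonal_weights[OF g, folded w_def]
    have mn: "m \<le> CARD('n)" using m S by auto
    have "(\<Sum>k\<in>UNIV. w (initial m) k * l $ k) = lead_sum l m"
      using A m W(1)[of l "initial m"] by (simp add: std_face_def)
    then have "\<exists>c. \<forall>k. (c < l $ k \<longrightarrow> w (initial m) k = 1) \<and> (l $ k < c \<longrightarrow> w (initial m) k = 0)"
      using W(4)[of "initial m"] mn by (intro weighted_sum_le_lead_sum(2)[OF l W(2,3)]) (auto simp: card_initial)
    then obtain c where c: "\<And>k. c < l $ k \<Longrightarrow> w (initial m) k = 1" "\<And>k. l $ k < c \<Longrightarrow> w (initial m) k = 0"
      by blast
    have term0: "(l $ k - c) * (g $ i $ k * g $ j $ k) = 0" for k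
    proof (cases "l $ k" c rule: linorder_cases)
      case less
      then have "(\<Sum>i\<in>initial m. (g $ i $ k)\<^sup>2) = 0" using c by (simp add: w_def)
      then have "g $ i $ k = 0" using i by (subst (asm) sum_nonneg_eq_0_iff) auto
      then show ?thesis by simp
    next
      case greater
      have "w UNIV k = w (initial m) k + w (- initial m) k"
        unfolding w_def by (subst sum.union_disjoint[symmetric]) auto
      moreover have "w UNIV k = 1"
        using orthogonal_matrix_column_sum[OF g, of k k] by (simp add: w_def power2_eq_square)
      ultimately have "(\<Sum>i\<in>- initial m. (g $ i $ k)\<^sup>2) = 0" using c(1)[OF greater] by (simp add: w_def)
      then have "g $ j $ k = 0" using j by (subst (asm) sum_nonneg_eq_0_iff) auto
      then show ?thesis by simp
    qed simp
    have "i \<noteq> j" using i j by auto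
    have "conj_act g (diag_mat l) $ i $ j = (\<Sum>k\<in>UNIV. (l $ k - c) * (g $ i $ k * g $ j $ k) + c * (g $ i $ k * g $ j $ k))"
      by (simp add: conj_act_diag_mat_nth algebra_simps)
    also have "\<dots> = 0"
      using orthogonal_matrix_row_sum[OF g, of i j] \<open>i \<noteq> j\<close>
      by (simp add: term0 flip: sum_distrib_left)
    finally show ?thesis .
  qed
  have sym: "conj_act g (diag_mat l) $ i $ j = conj_act g (diag_mat l) $ j $ i" for i j
    by (simp add: conj_act_diag_mat_nth mult_ac)
  show ?thesis
    unfolding block_diagonal_def separated_def using 0 sym by metis
qed

definition block_of :: "nat set \<Rightarrow> 'n::{finite,linorder} \<Rightarrow> 'n set" where
  "block_of S i = {j. \<not> separated S i j}"

lemma block_of_self: "i \<in> block_of S i"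
  by (simp add: block_of_def separated_def)

lemma block_of_eq_iff: "block_of S i = block_of S j \<longleftrightarrow> \<not> separated S i j"
  by (auto simp: block_of_def separated_def)

lemma mem_block_of_iff: "j \<in> block_of S i \<longleftrightarrow> block_of S j = block_of S i"
  by (auto simp: block_of_eq_iff) (auto simp: block_of_def separated_def)

definition coord_space :: "'n set \<Rightarrow> (real^'n) set" where
  "coord_space J = {v. \<forall>a. a \<notin> J \<longrightarrow> v $ a = 0}"

lemma subspace_coord_space: "subspace (coord_space J)"
  by (simp add: subspace_def coord_space_def)

lemma dim_coord_space: "dim (coord_space J :: (real^'n) set) = card J"
  unfolding coord_space_def dim_vec_eq[symmetric] by (rule dim_substandard_cart)

lemma coord_space_orthogonal:
  assumes "J \<inter> K = {}" "v \<in> coord_space J" "w \<in> coord_space K"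
  shows "orthogonal v w"
proof -
  have "v $ a * w $ a = 0" for a using assms by (cases "a \<in> J") (auto simp: coord_space_def)
  then show ?thesis unfolding orthogonal_def inner_vec_def inner_real_def by (intro sum.neutral) blast
qed

text \<open>
  The spectral theorem is applied in the coordinate subspace of each block and the eigenvectors are sorted
  there; eigenvectors of different blocks are orthogonal because their supports are disjoint.
\<close>

lemma block_diagonalize:
  fixes A :: "real^('n::{finite,linorder})^('n::{finite,linorder})"
  assumes sym: "transpose A = A" and bd: "block_diagonal S A"
  obtains h y where "orthogonal_matrix h" "block_diagonal S h" "A = conj_act h (diag_mat y)"
    "\<And>i j. \<not> separated S i j \<Longrightarrow> i \<le> j \<Longrightarrow> y $ j \<le> y $ i"
proof -
  have "\<exists>f c. bij_betw f \<beta> (f ` \<beta>) \<and> orthonormal (f ` \<beta>) \<and> f ` \<beta> \<subseteq> coord_space \<beta> \<and>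
      (\<forall>j\<in>\<beta>. A *v f j = c j *\<^sub>R f j) \<and> (\<forall>i\<in>\<beta>. \<forall>j\<in>\<beta>. i \<le> j \<longrightarrow> c j \<le> (c i :: real))"
    if "\<beta> \<in> range (block_of S)" for \<beta>
  proof -
    have "A *v v \<in> coord_space \<beta>" if v: "v \<in> coord_space \<beta>" for v
    proof -
      have "A $ a $ b * v $ b = 0" if "a \<notin> \<beta>" for a b
      proof (cases "b \<in> \<beta>")
        case True
        then have "\<beta> = block_of S b" using \<open>\<beta> \<in> range (block_of S)\<close> by (auto simp: mem_block_of_iff)
        then have "separated S a b" using \<open>a \<notin> \<beta>\<close> by (metis mem_block_of_iff block_of_eq_iff)
        then show ?thesis using bd by (simp add: block_diagonal_def)
      next
        case False
        then show ?thesis using v by (simp add: coord_space_def)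
      qed
      then show ?thesis
        unfolding coord_space_def matrix_vector_mult_def by (auto intro!: sum.neutral simp del: mult_eq_0_iff)
    qed
    then obtain B where B: "orthonormal B" "span B = coord_space \<beta>" "\<forall>b\<in>B. \<exists>c. A *v b = c *\<^sub>R b"
      using spectral_theorem_on_subspace[OF sym subspace_coord_space, of \<beta>] by blast
    then obtain c where c: "\<forall>b\<in>B. A *v b = c b *\<^sub>R b" by metis
    have "card \<beta> = card B" using orthonormal_card[OF B(1)] B(2) by (simp add: dim_coord_space del: dim_span)
    then obtain f where f: "bij_betw f \<beta> B" "\<forall>i\<in>\<beta>. \<forall>j\<in>\<beta>. i \<le> j \<longrightarrow> c (f j) \<le> c (f i)"
      using bij_sorting[of \<beta> B c] orthonormal_finite[OF B(1)] by auto
    have fB: "f ` \<beta> = B" using f(1) by (simp add: bij_betw_def)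
    show ?thesis
      by (rule exI[of _ f], rule exI[of _ "\<lambda>j. c (f j)"])
         (use f B c fB span_superset[of B] in auto)
  qed
  then obtain F c where F: "\<And>\<beta>. \<beta> \<in> range (block_of S) \<Longrightarrow> bij_betw (F \<beta>) \<beta> (F \<beta> ` \<beta>) \<and> orthonormal (F \<beta> ` \<beta>) \<and>
      F \<beta> ` \<beta> \<subseteq> coord_space \<beta> \<and> (\<forall>j\<in>\<beta>. A *v F \<beta> j = c \<beta> j *\<^sub>R F \<beta> j) \<and>
      (\<forall>i\<in>\<beta>. \<forall>j\<in>\<beta>. i \<le> j \<longrightarrow> c \<beta> j \<le> (c \<beta> i :: real))"
    by metis
  define f where "f j = F (block_of S j) j" for j
  define y :: "(real, 'n) vec" where "y = (\<chi> j. c (block_of S j) j)"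
  have f_space: "f j \<in> coord_space (block_of S j)" for j
    using F[of "block_of S j"] block_of_self[of j S] by (auto simp: f_def)
  have norm_f: "norm (f j) = 1" for j
    using F[of "block_of S j"] block_of_self[of j S] by (auto simp: f_def orthonormal_def)
  have orth: "orthogonal (f i) (f j)" if "i \<noteq> j" for i j
  proof (cases "separated S i j")
    case True
    have "block_of S i \<inter> block_of S j = {}"
    proof (rule equals0I)
      fix k assume "k \<in> block_of S i \<inter> block_of S j"
      then have "block_of S i = block_of S j" by (metis IntE mem_block_of_iff)
      then show False using True by (simp add: block_of_eq_iff)
    qed
    then show ?thesis using f_space coord_space_orthogonal by blast
  next
    case False
    then have same: "block_of S i = block_of S j" by (simp add: block_of_eq_iff)
    let ?b = "block_of S j"
    have Fb: "inj_on (F ?b) ?b" "orthonormal (F ?b ` ?b)" using F[of ?b] by (auto simp: bij_betw_def)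
    have ij: "i \<in> ?b" "j \<in> ?b" using same block_of_self by blast+
    then have "F ?b i \<noteq> F ?b j" using Fb(1) that by (auto simp: inj_on_def)
    then show ?thesis using Fb(2) ij unfolding orthonormal_def pairwise_def f_def same by blast
  qed
  have "inj f" by (rule injI) (metis norm_f orth norm_zero orthogonal_self zero_neq_one)
  moreover have "orthonormal (range f)"
    by (auto simp: orthonormal_def pairwise_def norm_f intro!: orth)
  ultimately obtain h where h: "orthogonal_matrix h" "\<And>j. column j h = f j"
    using orthogonal_matrix_from_basis by blast
  have "block_diagonal S h"
    unfolding block_diagonal_def
  proof (intro allI impI)
    fix i j :: 'n assume "separated S i j"
    then have "i \<notin> block_of S j" by (simp add: mem_block_of_iff block_of_eq_iff)
    then have "f j $ i = 0" using f_space[of j] by (simp add: coord_space_def)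
    then show "h $ i $ j = 0" using h(2)[of j] by (simp add: column_def vec_eq_iff)
  qed
  moreover have "A = conj_act h (diag_mat y)"
  proof (rule eigenvectors_imp_conj_diag_mat[OF h(1)])
    fix j
    show "A *v column j h = y $ j *\<^sub>R column j h"
      using F[of "block_of S j"] block_of_self[of j S] by (simp add: h(2) f_def y_def)
  qed
  moreover have "y $ j \<le> y $ i" if "\<not> separated S i j" "i \<le> j" for i j
  proof -
    have "block_of S i = block_of S j" using that by (simp add: block_of_eq_iff)
    then show ?thesis
      using F[of "block_of S j"] that block_of_self[of i S] block_of_self[of j S] by (auto simp: y_def)
  qed
  ultimately show ?thesis using that h(1) by blast
qed

text \<open>
  For a block diagonal \<open>h\<close> the weights of \<open>orbit_diagonal_weights\<close> are the indicator of the initial segment,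
  since each column of \<open>h\<close> has its whole unit mass on one side of the cut.
\<close>

lemma block_diagonal_weights:
  fixes h :: "real^('n::{finite,linorder})^('n::{finite,linorder})"
  assumes h: "orthogonal_matrix h" "block_diagonal S h" and m: "m \<in> S"
  shows "(\<Sum>i\<in>initial m. conj_act h (diag_mat x) $ i $ i) = lead_sum x m"
proof -
  have w: "(\<Sum>i\<in>initial m. (h $ i $ k)\<^sup>2) = (if k \<in> initial m then 1 else 0)" for k
  proof -
    have 0: "h $ i $ k = 0" if "(i \<in> initial m) \<noteq> (k \<in> initial m)" for i
      using h(2) m that by (auto simp: block_diagonal_def separated_def)
    show ?thesis
    proof (cases "k \<in> initial m")
      case True
      then have "(\<Sum>i\<in>initial m. (h $ i $ k)\<^sup>2) = (\<Sum>i\<in>UNIV. (h $ i $ k)\<^sup>2)"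
        using 0 by (intro sum.mono_neutral_left) auto
      then show ?thesis using orthogonal_matrix_column_sum[OF h(1), of k k] True by (simp add: power2_eq_square)
    qed (use 0 in auto)
  qed
  show ?thesis
    by (simp add: orbit_diagonal_weights(1)[OF h(1)] w lead_sum_def
        if_distrib[where f = "\<lambda>u. u * _"] sum.If_cases cong: if_cong)
qed

lemma conj_act_mem_orbitope:
  assumes "orthogonal_matrix h"
  shows "conj_act h A \<in> schur_horn_orbitope M \<longleftrightarrow> A \<in> schur_horn_orbitope M"
proof -
  have *: "conj_act g ` schur_horn_orbitope M \<subseteq> schur_horn_orbitope M" if "orthogonal_matrix g" for g
  proof -
    have "conj_act g ` {conj_act h M |h. orthogonal_matrix h} \<subseteq> {conj_act h M |h. orthogonal_matrix h}"
      using that by (auto simp flip: conj_act_mult) (metis orthogonal_matrix_mul)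
    then have "convex hull (conj_act g ` {conj_act h M |h. orthogonal_matrix h}) \<subseteq> schur_horn_orbitope M"
      unfolding schur_horn_orbitope_def by (rule hull_mono)
    then show ?thesis
      unfolding schur_horn_orbitope_def convex_hull_linear_image[OF linear_conj_act] .
  qed
  have "A \<in> schur_horn_orbitope M" if "conj_act h A \<in> schur_horn_orbitope M"
    using *[of "transpose h"] that assms by (metis conj_act_transpose_cancel(2) image_subset_iff orthogonal_matrix_transpose)
  with *[OF assms] show ?thesis by blast
qed

lemma conj_act_image_orbitope:
  "orthogonal_matrix g \<Longrightarrow> conj_act g ` schur_horn_orbitope M = schur_horn_orbitope M"
  by (auto simp: conj_act_mem_orbitope image_iff)
     (metis conj_act_mem_orbitope conj_act_transpose_cancel(1) orthogonal_matrix_transpose)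

text \<open>
  Diagonalise block by block, with diagonal \<open>y\<close> decreasing inside each block. Then \<open>y\<close> is decreasing
  altogether: at each cut its initial sum is already the top sum, so exchanging an earlier entry for a
  later, larger one across the cut would violate Ky Fan's bound. Having the same spectrum as \<open>l\<close>, the
  vector \<open>y\<close> equals \<open>l\<close>.
\<close>

lemma orbit_std_face_imp_block_orbit:
  fixes l :: "real^'n::{finite,linorder}"
  assumes l: "decreasing l" and S: "S \<subseteq> {..CARD('n)}" and g: "orthogonal_matrix g"
    and A: "conj_act g (diag_mat l) \<in> std_face l S"
  obtains h where "orthogonal_matrix h" "block_diagonal S h" "conj_act g (diag_mat l) = conj_act h (diag_mat l)"
proof -
  let ?A = "conj_act g (diag_mat l)"
  obtain h y where h: "orthogonal_matrix h" "block_diagonal S h" and Ay: "?A = conj_act h (diag_mat y)"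
    and y: "\<And>i j. \<not> separated S i j \<Longrightarrow> i \<le> j \<Longrightarrow> y $ j \<le> y $ i"
    using block_diagonalize[OF _ orbit_std_face_block_diagonal[OF l S g A]] by (auto simp: transpose_conj_act)
  have yO: "diag_mat y \<in> schur_horn_orbitope (diag_mat l)"
    using A by (simp add: std_face_def Ay conj_act_mem_orbitope[OF h(1)])
  have "y $ j \<le> y $ i" if "i \<le> j" and sep: "separated S i j" for i j
  proof -
    obtain m where m: "m \<in> S" "(i \<in> initial m) \<noteq> (j \<in> initial m)" using sep by (auto simp: separated_def)
    have "pos i \<le> pos j" using \<open>i \<le> j\<close> by simp
    then have ij: "i \<in> initial m" "j \<notin> initial m" using m(2) by (auto simp: mem_initial simp del: pos_le_iff)
    \<comment> \<open>The exchange across the cut at \<open>m\<close>.\<close>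
    let ?T = "insert j (initial m - {i})"
    have "card ?T = card (initial m :: 'n set)" using ij card.remove[of "initial m" i] by simp
    then have cT: "card ?T = m" using m S by (auto simp: card_initial)
    have "(\<Sum>k\<in>?T. y $ k) \<le> lead_sum l m"
      using ky_fan[OF l yO, of ?T] cT by (simp add: diag_mat_nth)
    also have "lead_sum l m = lead_sum y m"
      using A m block_diagonal_weights[OF h m(1), of y] by (simp add: std_face_def Ay)
    also have "lead_sum y m = y $ i + (\<Sum>k\<in>initial m - {i}. y $ k)"
      using ij by (simp add: lead_sum_def sum.remove)
    finally show ?thesis using ij by simp
  qed
  then have "decreasing y" using y by (auto simp: decreasing_def)
  moreover have "card {i. y $ i = \<mu>} = card {i. l $ i = \<mu>}" for \<mu>
    using eig_mult_conj_diag_mat[OF h(1), of y \<mu>] eig_mult_conj_diag_mat[OF g, of l \<mu>] Ay by simp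
  ultimately have "y = l" using decreasing_determined_by_fibres l by blast
  then show ?thesis using that h Ay by blast
qed

lemma block_orbit_in_std_face:
  assumes "orthogonal_matrix h" "block_diagonal S h"
  shows "conj_act h (diag_mat l) \<in> std_face l S"
  using assms by (simp add: std_face_def orbit_subset_orbitope block_diagonal_weights)

lemma std_face_eq_hull:
  fixes l :: "real^'n::{finite,linorder}"
  assumes l: "decreasing l" and S: "S \<subseteq> {..CARD('n)}"
  shows "std_face l S = convex hull {conj_act h (diag_mat l) |h. orthogonal_matrix h \<and> block_diagonal S h}"
proof -
  have "std_face l S = convex hull (std_face l S \<inter> {conj_act g (diag_mat l) |g. orthogonal_matrix g})"
    using std_face_face_of[OF l S] unfolding schur_horn_orbitope_def by (rule face_of_convex_hull_eq)
  also have "std_face l S \<inter> {conj_act g (diag_mat l) |g. orthogonal_matrix g} =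
      {conj_act h (diag_mat l) |h. orthogonal_matrix h \<and> block_diagonal S h}"
    using block_orbit_in_std_face orbit_std_face_imp_block_orbit[OF l S] by blast
  finally show ?thesis .
qed

section \<open>Every face is conjugate to a standard face\<close>

lemma symmetric_decreasing_diagonalization:
  fixes A :: "real^('n::{finite,linorder})^('n::{finite,linorder})"
  assumes "transpose A = A"
  obtains g x where "orthogonal_matrix g" "decreasing x" "A = conj_act g (diag_mat x)"
proof -
  have "block_diagonal {} A" by (simp add: block_diagonal_def separated_def)
  then obtain g x where "orthogonal_matrix g" "A = conj_act g (diag_mat x)"
    "\<And>i j. \<not> separated {} i j \<Longrightarrow> i \<le> j \<Longrightarrow> x $ j \<le> x $ i"
    using block_diagonalize[OF assms, of "{}"] by metis
  then show ?thesis using that by (auto simp: decreasing_def separated_def)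
qed

lemma orbitope_symmetric:
  assumes "transpose M = M" "A \<in> schur_horn_orbitope M"
  shows "transpose A = A"
proof -
  have "subspace {A :: real^'a^'a. transpose A = A}"
    by (auto simp: subspace_def transpose_def vec_eq_iff)
  then have "schur_horn_orbitope M \<subseteq> {A. transpose A = A}"
    unfolding schur_horn_orbitope_def using assms(1)
    by (intro hull_minimal subspace_imp_convex) (auto simp: transpose_conj_act)
  then show ?thesis using assms(2) by blast
qed

text \<open>
  Finitely many inequalities survive a small perturbation if each is strict or is tight and perturbed
  in the allowed direction. The conclusion covers all small \<open>t\<close>, so that two families can be combined.
\<close>

lemma small_perturbation:
  fixes u v :: "'a \<Rightarrow> real"
  assumes "finite K" "\<And>k. k \<in> K \<Longrightarrow> 0 < u k \<or> u k = 0 \<and> 0 \<le> v k"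
  shows "\<exists>e>0. \<forall>t. 0 < t \<and> t \<le> e \<longrightarrow> (\<forall>k\<in>K. 0 \<le> u k + t * v k)"
  using assms
proof (induction K rule: finite_induct)
  case empty
  then show ?case by (auto intro: exI[of _ 1])
next
  case (insert k K)
  then obtain e where e: "e > 0" "\<And>t k. 0 < t \<Longrightarrow> t \<le> e \<Longrightarrow> k \<in> K \<Longrightarrow> 0 \<le> u k + t * v k" by blast
  define e' where "e' = (if 0 \<le> v k then 1 else u k / - v k)"
  have uk: "0 < u k \<or> u k = 0 \<and> 0 \<le> v k" using insert.prems by simp
  have "e' > 0" using uk by (auto simp: e'_def divide_pos_neg)
  moreover have "0 \<le> u k + t * v k" if "0 < t" "t \<le> e'" for t
  proof (cases "0 \<le> v k")
    case True
    then show ?thesis using uk that by (auto intro: add_nonneg_nonneg)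
  next
    case False
    then have "t \<le> u k / - v k" using that(2) by (simp add: e'_def)
    then have "t * - v k \<le> u k" using False by (subst (asm) pos_le_divide_eq) auto
    then show ?thesis by simp
  qed
  ultimately show ?case using e by (intro exI[of _ "min e e'"]) auto
qed

definition block_perms :: "nat set \<Rightarrow> ('n::{finite,linorder} \<Rightarrow> 'n) set" where
  "block_perms S = {\<pi>. \<pi> permutes UNIV \<and> (\<forall>i. \<not> separated S i (\<pi> i))}"

definition block_average :: "real^('n::{finite,linorder}) \<Rightarrow> nat set \<Rightarrow> real^('n::{finite,linorder})" where
  "block_average l S = (\<Sum>\<pi>\<in>block_perms S. (1 / real (card (block_perms S :: ('n \<Rightarrow> 'n) set))) *\<^sub>R perm_act \<pi> l)"

lemma block_perms_basics:
  "finite (block_perms S :: ('n::{finite,linorder} \<Rightarrow> 'n) set)"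
  "(id :: 'n \<Rightarrow> 'n) \<in> block_perms S" "0 < card (block_perms S :: ('n::{finite,linorder} \<Rightarrow> 'n) set)"
proof -
  have "finite {\<pi>. \<pi> permutes (UNIV :: 'n set)}" by (simp add: finite_permutations)
  then show fin: "finite (block_perms S :: ('n \<Rightarrow> 'n) set)"
    by (rule rev_finite_subset) (auto simp: block_perms_def)
  have id: "(id :: 'n \<Rightarrow> 'n) \<in> block_perms S"
    by (auto simp: block_perms_def separated_def permutes_id)
  then show "(id :: 'n \<Rightarrow> 'n) \<in> block_perms S" .
  show "0 < card (block_perms S :: ('n \<Rightarrow> 'n) set)"
    using fin id by (auto simp: card_gt_0_iff)
qed

lemma block_perms_permutes: "\<pi> \<in> block_perms S \<Longrightarrow> \<pi> permutes UNIV"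
  by (simp add: block_perms_def)

lemma block_average_nth:
  fixes l :: "real^('n::{finite,linorder})"
  shows "block_average l S $ i = (\<Sum>\<pi>\<in>block_perms S. l $ \<pi> i) / real (card (block_perms S :: ('n \<Rightarrow> 'n) set))"
  by (simp add: block_average_def perm_act_def flip: sum_divide_distrib)

lemma not_separatedD: "\<not> separated S i j \<Longrightarrow> m \<in> S \<Longrightarrow> i \<in> initial m \<longleftrightarrow> j \<in> initial m"
  by (auto simp: separated_def)

text \<open>
  A permutation that respects the blocks maps every initial segment \<open>initial m\<close> with \<open>m \<in> S\<close> to itself.
\<close>

lemma lead_sum_block_average:
  fixes l :: "real^('n::{finite,linorder})"
  assumes m: "m \<in> S"
  shows "lead_sum (block_average l S) m = lead_sum l m"
proof -
  have "(\<Sum>i\<in>initial m. l $ \<pi> i) = lead_sum l m" if \<pi>: "\<pi> \<in> block_perms S" for \<pi>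
  proof -
    have inj: "inj_on \<pi> (initial m)"
      using \<pi> by (auto simp: block_perms_def dest: permutes_inj_on)
    have "\<pi> ` initial m \<subseteq> initial m"
      using \<pi> m not_separatedD by (fastforce simp: block_perms_def)
    then have "\<pi> ` initial m = initial m" using inj by (simp add: endo_inj_surj)
    then show ?thesis unfolding lead_sum_def using sum.reindex[OF inj, of "($) l"] by simp
  qed
  then have "(\<Sum>i\<in>initial m. \<Sum>\<pi>\<in>block_perms S. l $ \<pi> i) =
      real (card (block_perms S :: ('n \<Rightarrow> 'n) set)) * lead_sum l m"
    by (subst sum.swap) simp
  then show ?thesis
    using block_perms_basics(3)[where 'n = 'n, of S]
    by (auto simp: lead_sum_def block_average_nth simp flip: sum_divide_distrib)
qed

text \<open>
  Composition with the transposition of \<open>i\<close> and \<open>j\<close> permutes the block permutations over which one averages.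
\<close>

lemma block_average_constant_on_blocks:
  fixes l :: "real^('n::{finite,linorder})"
  assumes ij: "\<not> separated S i j"
  shows "block_average l S $ i = block_average l S $ j"
proof -
  let ?t = "Transposition.transpose i j"
  have cl: "\<pi> \<circ> ?t \<in> block_perms S" if "\<pi> \<in> block_perms S" for \<pi>
  proof -
    have "\<not> separated S k (?t k)" for k
      using ij by (auto simp: Transposition.transpose_def separated_def)
    moreover have "\<not> separated S (?t k) (\<pi> (?t k))" for k using that by (simp add: block_perms_def)
    ultimately have "\<not> separated S k (\<pi> (?t k))" for k by (metis block_of_eq_iff)
    moreover have "\<pi> \<circ> ?t permutes UNIV"
      using that by (intro permutes_compose) (auto simp: block_perms_def intro: permutes_swap_id)
    ultimately show ?thesis by (simp add: block_perms_def)
  qed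
  have "(\<Sum>\<pi>\<in>block_perms S. l $ \<pi> i) = (\<Sum>\<pi>\<in>block_perms S. l $ \<pi> j)"
    by (rule sum.reindex_bij_witness[where i = "\<lambda>\<pi>. \<pi> \<circ> ?t" and j = "\<lambda>\<pi>. \<pi> \<circ> ?t"])
       (auto simp: cl comp_assoc)
  then show ?thesis by (simp add: block_average_nth)
qed

lemma convex_permutahedron: "convex (permutahedron p)"
  by (simp add: permutahedron_def)

lemma block_average_in_permutahedron:
  fixes l :: "real^('n::{finite,linorder})"
  shows "block_average l S \<in> permutahedron l"
  unfolding block_average_def
proof (rule convex_sum[OF block_perms_basics(1) convex_permutahedron])
  show "perm_act \<pi> l \<in> permutahedron l" if "\<pi> \<in> block_perms S" for \<pi>
    using that by (simp add: block_perms_def perm_act_in_permutahedron)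
qed (use block_perms_basics(3)[where 'n = 'n, of S] in auto)

text \<open>
  With \<open>a\<close> the block average of \<open>l\<close>, the heart is that \<open>z = x + t (x - a)\<close> still lies in the
  permutahedron for small \<open>t > 0\<close>. Its initial sums stay below those of \<open>l\<close>, as they are equal at lengths in
  \<open>S\<close> and strictly smaller elsewhere. It remains decreasing: strict descents of \<open>x\<close> survive, and
  where \<open>x\<close> has equal neighbouring entries \<open>a\<close> has them too. That is clear inside a block. At a cut, equal
  neighbours of \<open>x\<close> must agree with the entries of \<open>l\<close> on both sides, which makes the neighbouring
  lengths belong to \<open>S\<close> as well; both entries then form blocks of their own, and \<open>a = l\<close> there. For a decreasing \<open>z\<close>
  bounds on initial sums are bounds on all subset sums, and Rado's theorem applies.
\<close>

lemma std_face_subset_face: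
  fixes l x :: "real^('n::{finite,linorder})"
  assumes l: "decreasing l" and x: "decreasing x"
    and F: "F face_of schur_horn_orbitope (diag_mat l)" and xF: "diag_mat x \<in> F"
  defines "S \<equiv> {m. m \<le> CARD('n) \<and> lead_sum x m = lead_sum l m}"
  shows "std_face l S \<subseteq> F"
proof -
  let ?O = "schur_horn_orbitope (diag_mat l)"
  define a where "a = block_average l S"
  have xO: "diag_mat x \<in> ?O" using face_of_imp_subset[OF F] xF by blast
  have x_le: "lead_sum x m \<le> lead_sum l m" if "m \<le> CARD('n)" for m
    using ky_fan[OF l xO, of "initial m"] that by (simp add: diag_mat_nth lead_sum_def card_initial)
  have nS: "CARD('n) \<in> S"
    using orbitope_trace[OF xO] by (simp add: S_def diag_mat_nth lead_sum_def)
  have aS: "lead_sum a m = lead_sum l m" if "m \<in> S" for m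
    unfolding a_def by (rule lead_sum_block_average[OF that])
  have "\<exists>e>0. \<forall>t. 0 < t \<and> t \<le> e \<longrightarrow>
      (\<forall>m\<in>{..CARD('n)}. 0 \<le> (lead_sum l m - lead_sum x m) + t * (lead_sum a m - lead_sum x m))"
  proof (rule small_perturbation)
    fix m assume "m \<in> {..CARD('n)}"
    then show "0 < lead_sum l m - lead_sum x m \<or> lead_sum l m - lead_sum x m = 0 \<and> 0 \<le> lead_sum a m - lead_sum x m"
      using x_le[of m] aS[of m] by (cases "m \<in> S") (auto simp: S_def)
  qed simp
  then obtain e1 where e1: "e1 > 0" "\<And>t m. 0 < t \<Longrightarrow> t \<le> e1 \<Longrightarrow> m \<le> CARD('n) \<Longrightarrow>
      0 \<le> (lead_sum l m - lead_sum x m) + t * (lead_sum a m - lead_sum x m)"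
    by auto
  let ?i = "\<lambda>p. entry_at p :: 'n"
  let ?u = "\<lambda>p. x $ ?i p - x $ ?i (Suc p)" and ?v = "\<lambda>p. (x $ ?i p - a $ ?i p) - (x $ ?i (Suc p) - a $ ?i (Suc p))"
  have "\<exists>e>0. \<forall>t. 0 < t \<and> t \<le> e \<longrightarrow> (\<forall>p\<in>{p. Suc p < CARD('n)}. 0 \<le> ?u p + t * ?v p)"
  proof (rule small_perturbation)
    have "{p. Suc p < CARD('n)} \<subseteq> {..<CARD('n)}" by auto
    then show "finite {p. Suc p < CARD('n)}" using finite_subset by blast
    fix p assume "p \<in> {p. Suc p < CARD('n)}"
    then have p: "Suc p < CARD('n)" by simp
    have pos: "pos (?i p) = p" "pos (?i (Suc p)) = Suc p" using p by (simp_all add: pos_entry_at)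
    then have le: "?i p \<le> ?i (Suc p)" by (simp flip: pos_le_iff)
    show "0 < ?u p \<or> ?u p = 0 \<and> 0 \<le> ?v p"
    proof (cases "?u p = 0")
      case False
      then show ?thesis using x le by (auto simp: decreasing_def less_le)
    next
      case True
      have "a $ ?i p = a $ ?i (Suc p)"
      proof (cases "Suc p \<in> S")
        case False
        have "\<not> separated S (?i p) (?i (Suc p))"
        proof
          assume "separated S (?i p) (?i (Suc p))"
          then obtain m where "m \<in> S" "(p < m) \<noteq> (Suc p < m)" by (auto simp: separated_def mem_initial pos)
          then have "m = Suc p" by linarith
          then show False using False \<open>m \<in> S\<close> by simp
        qed
        then show ?thesis unfolding a_def by (rule block_average_constant_on_blocks)
      next
        case tight: True
        have l_le: "l $ ?i (Suc p) \<le> l $ ?i p" using l le by (simp add: decreasing_def)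
        \<comment> \<open>Squeeze: \<open>l\<close> lies below \<open>x\<close> just before the cut and above \<open>x\<close> just after it, and \<open>l\<close> is decreasing.\<close>
        have s1: "lead_sum v (Suc p) = lead_sum v p + v $ ?i p"
          and s2: "lead_sum v (Suc (Suc p)) = lead_sum v (Suc p) + v $ ?i (Suc p)" for v :: "(real, 'n) vec"
          using p by (simp_all add: lead_sum_Suc)
        have t: "lead_sum x (Suc p) = lead_sum l (Suc p)" using tight by (simp add: S_def)
        have "l $ ?i p \<le> x $ ?i p" using t s1[of x] s1[of l] x_le[of p] p by simp
        moreover have "x $ ?i (Suc p) \<le> l $ ?i (Suc p)" using t s2[of x] s2[of l] x_le[of "Suc (Suc p)"] p by simp
        ultimately have eqs: "l $ ?i p = x $ ?i p" "l $ ?i (Suc p) = x $ ?i (Suc p)" using l_le True by linarith+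
        \<comment> \<open>Hence the entries before and after the cut are singleton blocks.\<close>
        have "p \<in> S" "Suc (Suc p) \<in> S" using t s1[of x] s1[of l] s2[of x] s2[of l] eqs p by (auto simp: S_def)
        then have "a $ ?i p = l $ ?i p" "a $ ?i (Suc p) = l $ ?i (Suc p)"
          using aS[of p] aS[of "Suc p"] aS[of "Suc (Suc p)"] tight s1[of a] s1[of l] s2[of a] s2[of l] by linarith+
        then show ?thesis using eqs True by simp
      qed
      then show ?thesis using True by simp
    qed
  qed
  then obtain e2 where e2: "e2 > 0" "\<And>t p. 0 < t \<Longrightarrow> t \<le> e2 \<Longrightarrow> Suc p < CARD('n) \<Longrightarrow> 0 \<le> ?u p + t * ?v p"
    by auto
  define t where "t = min e1 e2"
  have t: "0 < t" "t \<le> e1" "t \<le> e2" using e1 e2 by (auto simp: t_def)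
  define z where "z = x + t *\<^sub>R (x - a)"
  have z_le: "lead_sum z m \<le> lead_sum l m" if "m \<le> CARD('n)" for m
    using e1(2)[OF t(1,2) that] by (simp add: z_def lead_sum_arith algebra_simps)
  have "decreasing z"
    by (rule decreasing_adjacent) (use e2(2)[OF t(1,3)] in \<open>simp add: z_def algebra_simps\<close>)
  have "z \<in> permutahedron l"
  proof (rule permutahedron_if_subset_sums_le)
    show "(\<Sum>i\<in>T. z $ i) \<le> lead_sum l (card T)" for T
      using subset_sum_le_lead_sum[OF \<open>decreasing z\<close>, of T] z_le[of "card T"] by (simp add: card_mono)
    have "lead_sum z (CARD('n)) = lead_sum l (CARD('n))"
      using nS aS[OF nS] by (simp add: z_def lead_sum_arith S_def)
    then show "(\<Sum>i\<in>UNIV. z $ i) = lead_sum l (CARD('n))" by (simp add: lead_sum_def)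
  qed
  then have zO: "diag_mat z \<in> ?O" by (rule diag_mat_permutahedron)
  have aO: "diag_mat a \<in> ?O" unfolding a_def by (intro diag_mat_permutahedron block_average_in_permutahedron)
  have aF: "diag_mat a \<in> F"
  proof -
    \<comment> \<open>\<open>x\<close> is a proper convex combination of \<open>z\<close> and \<open>a\<close>, so the face \<open>F\<close> contains \<open>a\<close>.\<close>
    have "(1 / (1 + t)) *\<^sub>R ((1 + t) *\<^sub>R x) = x" using t(1) by simp
    moreover have "(1 + t) *\<^sub>R x = z + t *\<^sub>R a" by (simp add: z_def algebra_simps)
    ultimately have "x = (1 / (1 + t)) *\<^sub>R z + (t / (1 + t)) *\<^sub>R a"
      by (simp add: scaleR_add_right)
    then have "diag_mat x = diag_mat ((1 / (1 + t)) *\<^sub>R z + (t / (1 + t)) *\<^sub>R a)" by (rule arg_cong)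
    then have "diag_mat x = (1 / (1 + t)) *\<^sub>R diag_mat z + (t / (1 + t)) *\<^sub>R diag_mat a"
      by (simp add: linear_add[OF linear_diag_mat] linear_scale[OF linear_diag_mat])
    then have comb: "(\<Sum>b\<in>UNIV. (if b then t / (1 + t) else 1 / (1 + t)) *\<^sub>R (if b then diag_mat a else diag_mat z)) \<in> F"
      using xF by (simp add: UNIV_bool)
    have "(if True then diag_mat a else diag_mat z) \<in> F"
      by (rule face_contains_summands[OF F convex_orbitope _ _ _ _ _ _ comb])
         (use t(1) zO aO in \<open>auto simp: UNIV_bool add_divide_distrib[symmetric]\<close>)
    then show ?thesis by simp
  qed
  have "conj_act h (diag_mat l) \<in> F" if h: "orthogonal_matrix h" "block_diagonal S h" for h
  proof -
    \<comment> \<open>The diagonal matrix of \<open>a\<close> commutes with \<open>h\<close>; conjugating the average by \<open>h\<close> writes it in terms of orbit points.\<close>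
    let ?c = "1 / real (card (block_perms S :: ('n \<Rightarrow> 'n) set))"
    have "conj_act h (diag_mat a) = diag_mat a"
    proof -
      have "a $ k * h $ i $ k * h $ j $ k = a $ i * h $ i $ k * h $ j $ k" for i j k
        using block_average_constant_on_blocks[of S i k l] h(2)
        by (cases "separated S i k") (auto simp: block_diagonal_def a_def)
      then have "conj_act h (diag_mat a) $ i $ j = (\<Sum>k\<in>UNIV. a $ i * h $ i $ k * h $ j $ k)" for i j
        unfolding conj_act_diag_mat_nth by (intro sum.cong refl)
      then have "conj_act h (diag_mat a) $ i $ j = a $ i * (\<Sum>k\<in>UNIV. h $ i $ k * h $ j $ k)" for i j
        by (simp add: sum_distrib_left mult.assoc)
      then show ?thesis
        by (simp add: vec_eq_iff orthogonal_matrix_row_sum[OF h(1)] diag_mat_nth)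
    qed
    then have "(\<Sum>\<pi>\<in>block_perms S. ?c *\<^sub>R conj_act h (diag_mat (perm_act \<pi> l))) \<in> F"
      using aF by (simp add: a_def block_average_def linear_sum[OF linear_diag_mat] linear_scale[OF linear_diag_mat]
          linear_sum[OF linear_conj_act] linear_scale[OF linear_conj_act])
    then have "conj_act h (diag_mat (perm_act id l)) \<in> F"
      by (rule face_contains_summands[OF F convex_orbitope block_perms_basics(1) block_perms_basics(2), rotated -1])
         (use block_perms_basics(3)[where 'n = 'n, of S] h(1) in
           \<open>auto simp: conj_act_mem_orbitope intro!: diag_mat_permutahedron perm_act_in_permutahedron block_perms_permutes\<close>)
    then show ?thesis by (simp add: perm_act_def)
  qed
  moreover have "S \<subseteq> {..CARD('n)}" by (auto simp: S_def)
  ultimately show ?thesis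
    unfolding std_face_eq_hull[OF l \<open>S \<subseteq> _\<close>]
    by (intro hull_minimal face_of_imp_convex[OF F]) auto
qed

lemma face_of_conj_act_image:
  assumes "orthogonal_matrix g"
  shows "conj_act g ` F face_of schur_horn_orbitope M \<longleftrightarrow> F face_of schur_horn_orbitope M"
  using face_of_linear_image[OF linear_conj_act inj_conj_act[OF assms], of F "schur_horn_orbitope M"]
  by (simp add: conj_act_image_orbitope[OF assms])

lemma face_is_conjugate_std_face:
  fixes l :: "real^('n::{finite,linorder})"
  assumes l: "decreasing l" and F: "F face_of schur_horn_orbitope (diag_mat l)" "F \<noteq> {}"
  obtains g S where "orthogonal_matrix g" "S \<subseteq> {..CARD('n)}" "0 \<in> S" "CARD('n) \<in> S"
    "F = conj_act g ` std_face l S"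
proof -
  have "rel_interior F \<noteq> {}" using F face_of_imp_convex by (metis rel_interior_eq_empty)
  then obtain A where A: "A \<in> rel_interior F" by blast
  then have AF: "A \<in> F" using rel_interior_subset by blast
  then have AO: "A \<in> schur_horn_orbitope (diag_mat l)" using face_of_imp_subset[OF F(1)] by blast
  then obtain g x where g: "orthogonal_matrix g" and x: "decreasing x" and Ax: "A = conj_act g (diag_mat x)"
    using symmetric_decreasing_diagonalization orbitope_symmetric[OF transpose_diag_mat] by metis
  define S where "S = {m. m \<le> CARD('n) \<and> lead_sum x m = lead_sum l m}"
  have S: "S \<subseteq> {..CARD('n)}" by (auto simp: S_def)
  have xO: "diag_mat x \<in> schur_horn_orbitope (diag_mat l)" using AO by (simp add: Ax conj_act_mem_orbitope[OF g])
  let ?E = "conj_act g ` std_face l S"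
  have "diag_mat x \<in> std_face l S"
    using xO by (auto simp: std_face_def S_def diag_mat_nth lead_sum_def)
  then have "A \<in> ?E" by (simp add: Ax)
  moreover have "?E face_of schur_horn_orbitope (diag_mat l)"
    by (simp add: face_of_conj_act_image[OF g] std_face_face_of[OF l S])
  ultimately have "F \<subseteq> ?E"
    using subset_of_face_of[OF _ face_of_imp_subset[OF F(1)]] A by blast
  moreover have "?E \<subseteq> F"
  proof -
    let ?F = "conj_act (transpose g) ` F"
    have "std_face l S \<subseteq> ?F"
      unfolding S_def
    proof (rule std_face_subset_face[OF l x])
      show "?F face_of schur_horn_orbitope (diag_mat l)" using F(1) g by (simp add: face_of_conj_act_image)
      have "conj_act (transpose g) A \<in> ?F" using AF by blast
      then show "diag_mat x \<in> ?F" using g by (simp add: Ax conj_act_transpose_cancel)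
    qed
    then have "?E \<subseteq> conj_act g ` ?F" by (rule image_mono)
    then show ?thesis using conj_act_image_cancel(1)[OF g] by simp
  qed
  moreover have "0 \<in> S" by (simp add: S_def)
  moreover have "CARD('n) \<in> S" using orbitope_trace[OF xO] by (simp add: S_def diag_mat_nth lead_sum_def)
  ultimately show ?thesis using that g S by blast
qed

section \<open>Orbits of faces\<close>

lemma schur_horn_orbitope_conj_act:
  assumes "orthogonal_matrix g"
  shows "schur_horn_orbitope (conj_act g A) = schur_horn_orbitope A"
proof -
  have "{conj_act h (conj_act g A) |h. orthogonal_matrix h} = {conj_act h A |h. orthogonal_matrix h}"
  proof (intro set_eqI iffI)
    fix B assume "B \<in> {conj_act h (conj_act g A) |h. orthogonal_matrix h}"
    then obtain h where "orthogonal_matrix h" "B = conj_act (h ** g) A" by (auto simp: conj_act_mult)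
    then show "B \<in> {conj_act h A |h. orthogonal_matrix h}"
      using assms orthogonal_matrix_mul by blast
  next
    fix B assume "B \<in> {conj_act h A |h. orthogonal_matrix h}"
    then obtain h where h: "orthogonal_matrix h" "B = conj_act h A" by auto
    then have "B = conj_act (h ** transpose g) (conj_act g A)"
      using assms by (simp add: conj_act_mult conj_act_transpose_cancel)
    moreover have "orthogonal_matrix (h ** transpose g)"
      using assms h by (simp add: orthogonal_matrix_mul)
    ultimately show "B \<in> {conj_act h (conj_act g A) |h. orthogonal_matrix h}" by blast
  qed
  then show ?thesis by (simp add: schur_horn_orbitope_def)
qed

lemma eigenvalue_vector_conj_diag_mat:
  fixes l :: "real^('n::{finite,linorder})"
  assumes g: "orthogonal_matrix g" and l: "decreasing l"
  shows "eigenvalue_vector (conj_act g (diag_mat l)) = l"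
  unfolding eigenvalue_vector_def eig_mult_conj_diag_mat[OF g]
proof (rule the_equality)
  show "(\<forall>i j. i \<le> j \<longrightarrow> l $ j \<le> l $ i) \<and> (\<forall>\<mu>. card {i. l $ i = \<mu>} = card {j. l $ j = \<mu>})"
    using l by (simp add: decreasing_def)
  show "x = l" if "(\<forall>i j. i \<le> j \<longrightarrow> x $ j \<le> x $ i) \<and> (\<forall>\<mu>. card {i. x $ i = \<mu>} = card {j. l $ j = \<mu>})" for x
    using that by (intro decreasing_determined_by_fibres[OF _ l]) (auto simp: decreasing_def)
qed

lemma eigenvalue_decomposition:
  fixes M :: "real^('n::{finite,linorder})^('n::{finite,linorder})"
  assumes "transpose M = M"
  obtains g where "orthogonal_matrix g" "M = conj_act g (diag_mat (eigenvalue_vector M))"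
    "decreasing (eigenvalue_vector M)"
proof -
  obtain g x where "orthogonal_matrix g" "decreasing x" "M = conj_act g (diag_mat x)"
    by (rule symmetric_decreasing_diagonalization[OF assms])
  then show ?thesis using that eigenvalue_vector_conj_diag_mat by metis
qed

lemma orbitope_eigenvalues:
  fixes M :: "real^('n::{finite,linorder})^('n::{finite,linorder})"
  assumes "transpose M = M"
  shows "schur_horn_orbitope M = schur_horn_orbitope (diag_mat (eigenvalue_vector M))"
  using eigenvalue_decomposition[OF assms] schur_horn_orbitope_conj_act by metis

lemma perm_act_compose: "perm_act \<pi> (perm_act \<sigma> p) = perm_act (\<sigma> \<circ> \<pi>) p"
  by (simp add: perm_act_def vec_eq_iff)

lemma perm_act_id [simp]: "perm_act id p = p"
  by (simp add: perm_act_def)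

lemma perm_act_inv [simp]:
  assumes "\<pi> permutes UNIV"
  shows "perm_act (inv \<pi>) (perm_act \<pi> p) = p" "perm_act \<pi> (perm_act (inv \<pi>) p) = p"
  using assms by (simp_all add: perm_act_compose permutes_inv_o)

lemma linear_perm_act: "linear (perm_act \<pi>)"
  by (rule linearI) (simp_all add: perm_act_def vec_eq_iff)

lemma inj_perm_act: "\<pi> permutes UNIV \<Longrightarrow> inj (perm_act \<pi>)"
  by (rule inj_on_inverseI) (rule perm_act_inv(1))

lemma perm_act_permutahedron:
  assumes "\<pi> permutes UNIV"
  shows "perm_act \<pi> ` permutahedron p = permutahedron p"
proof -
  have sub: "perm_act \<pi> ` permutahedron p \<subseteq> permutahedron p" if "\<pi> permutes UNIV" for \<pi>
  proof -
    have "perm_act \<pi> ` {perm_act \<sigma> p |\<sigma>. \<sigma> permutes UNIV} \<subseteq> {perm_act \<sigma> p |\<sigma>. \<sigma> permutes UNIV}"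
      using that by (auto simp: perm_act_compose) (metis permutes_compose)
    then have "convex hull (perm_act \<pi> ` {perm_act \<sigma> p |\<sigma>. \<sigma> permutes UNIV}) \<subseteq> permutahedron p"
      unfolding permutahedron_def by (rule hull_mono)
    then show ?thesis unfolding permutahedron_def convex_hull_linear_image[OF linear_perm_act] .
  qed
  have "perm_act (inv \<pi>) ` permutahedron p \<subseteq> permutahedron p"
    using assms by (intro sub permutes_inv)
  then have "perm_act \<pi> ` perm_act (inv \<pi>) ` permutahedron p \<subseteq> perm_act \<pi> ` permutahedron p"
    by (rule image_mono)
  then have "permutahedron p \<subseteq> perm_act \<pi> ` permutahedron p"
    using assms by (simp add: image_image)
  with sub[OF assms] show ?thesis by blast
qed

lemma perm_act_face_of:
  assumes "\<pi> permutes UNIV"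
  shows "perm_act \<pi> ` G face_of permutahedron p \<longleftrightarrow> G face_of permutahedron p"
  using face_of_linear_image[OF linear_perm_act inj_perm_act[OF assms], of G "permutahedron p"]
  by (simp add: perm_act_permutahedron[OF assms])

lemma perm_orbit_of_image:
  assumes \<sigma>: "\<sigma> permutes UNIV"
  shows "{perm_act \<pi> ` perm_act \<sigma> ` G |\<pi>. \<pi> permutes UNIV} = {perm_act \<pi> ` G |\<pi>. \<pi> permutes UNIV}"
proof (intro set_eqI iffI)
  fix H assume "H \<in> {perm_act \<pi> ` perm_act \<sigma> ` G |\<pi>. \<pi> permutes UNIV}"
  then show "H \<in> {perm_act \<pi> ` G |\<pi>. \<pi> permutes UNIV}"
    using permutes_compose[OF _ \<sigma>] by (auto simp: image_image perm_act_compose)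
next
  fix H assume "H \<in> {perm_act \<pi> ` G |\<pi>. \<pi> permutes UNIV}"
  then obtain \<pi> where \<pi>: "\<pi> permutes UNIV" "H = perm_act \<pi> ` G" by blast
  have "H = perm_act (inv \<sigma> \<circ> \<pi>) ` perm_act \<sigma> ` G"
  proof -
    have "\<sigma> \<circ> (inv \<sigma> \<circ> \<pi>) = \<pi>" using \<sigma> by (simp add: permutes_inv_o flip: comp_assoc)
    then show ?thesis by (simp add: image_image perm_act_compose \<pi>)
  qed
  moreover have "inv \<sigma> \<circ> \<pi> permutes UNIV" using \<pi> \<sigma> by (simp add: permutes_compose permutes_inv)
  ultimately show "H \<in> {perm_act \<pi> ` perm_act \<sigma> ` G |\<pi>. \<pi> permutes UNIV}" by blast
qed

definition perm_face :: "real^('n::{finite,linorder}) \<Rightarrow> nat set \<Rightarrow> (real^('n::{finite,linorder})) set" where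
  "perm_face l S = {y \<in> permutahedron l. \<forall>m\<in>S. lead_sum y m = lead_sum l m}"

lemma lead_sum_inner: "lead_sum y m = indicator_vec (initial m) \<bullet> y"
  by (simp add: lead_sum_def inner_vec_def indicator_vec_def if_distrib[where f = "\<lambda>u. u * _"] sum.If_cases cong: if_cong)

lemma perm_face_face_of:
  fixes l :: "real^('n::{finite,linorder})"
  assumes l: "decreasing l" and S: "S \<subseteq> {..CARD('n)}"
  shows "perm_face l S face_of permutahedron l"
proof -
  let ?H = "\<lambda>m. permutahedron l \<inter> {y. indicator_vec (initial m) \<bullet> y = lead_sum l m}"
  have "?H m face_of permutahedron l" if "m \<in> S" for m
  proof (rule face_of_Int_supporting_hyperplane_le[OF convex_permutahedron])
    fix y assume "y \<in> permutahedron l"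
    then show "indicator_vec (initial m) \<bullet> y \<le> lead_sum l m"
      using ky_fan[OF l diag_mat_permutahedron, of y "initial m"] that S
      by (auto simp: diag_mat_nth card_initial lead_sum_def simp flip: lead_sum_inner)
  qed
  then have "\<Inter> (insert (permutahedron l) (?H ` S)) face_of permutahedron l"
    by (intro face_of_Inter) (auto simp: face_of_refl convex_permutahedron)
  moreover have "perm_face l S = \<Inter> (insert (permutahedron l) (?H ` S))"
    by (auto simp: perm_face_def lead_sum_inner)
  ultimately show ?thesis by simp
qed

lemma pullback_perm_face:
  fixes l :: "real^('n::{finite,linorder})"
  assumes l: "decreasing l"
  shows "pullback (diag_mat l) (perm_face l S) = std_face l S"
proof -
  have "lead_sum (diag_proj A) m = (\<Sum>i\<in>initial m. A $ i $ i)"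
    for A :: "((real, 'n) vec, 'n) vec" and m
    by (simp add: lead_sum_def diag_proj_def)
  then show ?thesis
    using diag_proj_orbitope[OF l] by (auto simp: pullback_def perm_face_def std_face_def)
qed

lemma diag_mat_pullback_iff:
  assumes "G \<subseteq> permutahedron l"
  shows "diag_mat y \<in> pullback (diag_mat l) G \<longleftrightarrow> y \<in> G"
  using assms diag_mat_permutahedron by (auto simp: pullback_def)

text \<open>
  Schur's theorem for a diagonal in arbitrary order: sorting \<open>x\<close> changes neither its orbitope nor its
  permutahedron.
\<close>

lemma diag_proj_conj_diag_mat:
  fixes x :: "real^('n::{finite,linorder})"
  assumes g: "orthogonal_matrix g"
  shows "diag_proj (conj_act g (diag_mat x)) \<in> permutahedron x"
proof -
  obtain f :: "'n \<Rightarrow> 'n" where f: "bij f" and sorted: "\<And>i j. i \<le> j \<Longrightarrow> x $ f j \<le> x $ f i"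
    using bij_sorting[of "UNIV :: 'n set" "UNIV :: 'n set" "($) x"] by auto
  have fp: "f permutes UNIV" using f by (intro bij_imp_permutes) auto
  obtain R :: "real^('n::{finite,linorder})^('n::{finite,linorder})"
    where R: "orthogonal_matrix R" "conj_act R (diag_mat x) = diag_mat (perm_act f x)"
    using conj_diag_mat_perm[OF fp] by metis
  have "conj_act g (diag_mat x) \<in> schur_horn_orbitope (diag_mat (perm_act f x))"
    using orbit_subset_orbitope[OF g] schur_horn_orbitope_conj_act[OF R(1)] R(2) by metis
  moreover have "decreasing (perm_act f x)" using sorted by (simp add: decreasing_def perm_act_def)
  ultimately have "diag_proj (conj_act g (diag_mat x)) \<in> permutahedron (perm_act f x)"
    by (intro diag_proj_orbitope)
  also have "permutahedron (perm_act f x) \<subseteq> permutahedron x"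
    unfolding permutahedron_def
    by (rule hull_mono) (auto simp: perm_act_compose dest: permutes_compose[OF _ fp])
  finally show ?thesis .
qed

text \<open>
  Transport a relative interior point \<open>x\<close> of \<open>G1\<close> by \<open>g\<close> and take the diagonal. The result lies in \<open>G2\<close> and in
  the convex hull of the permutations of \<open>x\<close>; a face of a hull is the hull of the generators it contains,
  so \<open>G2\<close> contains a permutation of \<open>x\<close>.
\<close>

lemma conjugate_pullback_imp_subset:
  fixes l :: "real^('n::{finite,linorder})"
  assumes G1: "G1 face_of permutahedron l" "G1 \<noteq> {}" and G2: "G2 face_of permutahedron l"
    and g: "orthogonal_matrix g" and sub: "conj_act g ` pullback (diag_mat l) G1 \<subseteq> pullback (diag_mat l) G2"
  obtains \<pi> where "\<pi> permutes UNIV" "G1 \<subseteq> perm_act \<pi> ` G2"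
proof -
  have "rel_interior G1 \<noteq> {}" using G1 face_of_imp_convex by (metis rel_interior_eq_empty)
  then obtain x where x: "x \<in> rel_interior G1" by blast
  then have "x \<in> G1" using rel_interior_subset by blast
  then have xP: "x \<in> permutahedron l" using face_of_imp_subset[OF G1(1)] by blast
  have "diag_mat x \<in> pullback (diag_mat l) G1"
    using \<open>x \<in> G1\<close> by (simp add: diag_mat_pullback_iff face_of_imp_subset[OF G1(1)])
  then have yG: "diag_proj (conj_act g (diag_mat x)) \<in> G2"
    using sub unfolding pullback_def by blast
  let ?X = "{perm_act \<pi> x |\<pi>. \<pi> permutes UNIV}"
  have X: "?X \<subseteq> permutahedron l" using xP perm_act_permutahedron[of _ l] by blast
  then have hullX: "convex hull ?X \<subseteq> permutahedron l" by (intro hull_minimal convex_permutahedron)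
  then have "G2 \<inter> convex hull ?X face_of convex hull ?X"
    using face_of_slice[OF G2, of "convex hull ?X"] by (simp add: Int_absorb1)
  then have "G2 \<inter> convex hull ?X = convex hull ((G2 \<inter> convex hull ?X) \<inter> ?X)" by (rule face_of_convex_hull_eq)
  moreover have "G2 \<inter> convex hull ?X \<noteq> {}"
    using yG diag_proj_conj_diag_mat[OF g, of x] by (auto simp: permutahedron_def)
  ultimately have "(G2 \<inter> convex hull ?X) \<inter> ?X \<noteq> {}" by (metis convex_hull_empty)
  then obtain \<pi> where \<pi>: "\<pi> permutes UNIV" "perm_act \<pi> x \<in> G2" by auto
  have inv: "inv \<pi> permutes UNIV" using \<pi>(1) by (rule permutes_inv)
  have "x \<in> perm_act (inv \<pi>) ` G2" using \<pi> perm_act_inv(1)[OF \<pi>(1), of x] by (metis image_eqI)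
  moreover have "perm_act (inv \<pi>) ` G2 face_of permutahedron l" using G2 inv by (simp add: perm_act_face_of)
  ultimately have "G1 \<subseteq> perm_act (inv \<pi>) ` G2"
    using subset_of_face_of[OF _ face_of_imp_subset[OF G1(1)]] x by blast
  then show ?thesis using that inv by blast
qed

lemma conjugate_pullbacks_imp_same_orbit:
  fixes l :: "real^('n::{finite,linorder})"
  assumes G1: "G1 face_of permutahedron l" and G2: "G2 face_of permutahedron l"
    and g: "orthogonal_matrix g" and eq: "conj_act g ` pullback (diag_mat l) G1 = pullback (diag_mat l) G2"
  shows "{perm_act \<pi> ` G1 |\<pi>. \<pi> permutes UNIV} = {perm_act \<pi> ` G2 |\<pi>. \<pi> permutes UNIV}"
proof -
  have empty: "G = {} \<longleftrightarrow> pullback (diag_mat l) G = {}" if "G face_of permutahedron l" for G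
    using diag_mat_pullback_iff[OF face_of_imp_subset[OF that]] unfolding pullback_def by blast
  show ?thesis
  proof (cases "G1 = {}")
    case True
    then have "G2 = {}" using empty[OF G1] empty[OF G2] eq by simp
    then show ?thesis using True by simp
  next
    case False
    then have ne2: "G2 \<noteq> {}" using empty[OF G1] empty[OF G2] eq by auto
    obtain \<sigma> where \<sigma>: "\<sigma> permutes UNIV" "G1 \<subseteq> perm_act \<sigma> ` G2"
      using conjugate_pullback_imp_subset[OF G1 False G2 g] eq by auto
    have "conj_act (transpose g) ` pullback (diag_mat l) G2 = pullback (diag_mat l) G1"
      unfolding eq[symmetric] by (rule conj_act_image_cancel(2)[OF g])
    then obtain \<tau> where \<tau>: "\<tau> permutes UNIV" "G2 \<subseteq> perm_act \<tau> ` G1"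
      using conjugate_pullback_imp_subset[OF G2 ne2 G1, of "transpose g"] g by (metis orthogonal_matrix_transpose subset_refl)
    have dim: "aff_dim (perm_act \<pi> ` G) = aff_dim G" if "\<pi> permutes UNIV" for \<pi> and G :: "(real, 'n) vec set"
      by (rule aff_dim_injective_linear_image[OF linear_perm_act inj_perm_act[OF that]])
    have face: "perm_act \<sigma> ` G2 face_of permutahedron l" using G2 \<sigma> by (simp add: perm_act_face_of)
    have "G1 = perm_act \<sigma> ` G2"
    proof (rule ccontr)
      assume "G1 \<noteq> perm_act \<sigma> ` G2"
      moreover have "G1 face_of perm_act \<sigma> ` G2"
        using face_of_subset[OF G1 \<sigma>(2) face_of_imp_subset[OF face]] .
      ultimately have "aff_dim G1 < aff_dim (perm_act \<sigma> ` G2)"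
        using face_of_aff_dim_lt face_of_imp_convex[OF face] by blast
      also have "\<dots> \<le> aff_dim (perm_act \<tau> ` G1)" using aff_dim_subset[OF \<tau>(2)] by (simp add: dim[OF \<sigma>(1)])
      finally show False by (simp add: dim[OF \<tau>(1)])
    qed
    then show ?thesis using perm_orbit_of_image[OF \<sigma>(1), of G2] by simp
  qed
qed

text \<open>
  Existence holds because each face is conjugate to a standard face, which is itself a pullback; uniqueness
  is \<open>conjugate_pullbacks_imp_same_orbit\<close>.
\<close>

lemma orbit_correspondence:
  fixes l :: "real^('n::{finite,linorder})"
  assumes l: "decreasing l" and orbit: "\<F> \<in> orbitope_face_orbits (diag_mat l)"
  shows "\<exists>!\<G>. \<G> \<in> permutahedron_face_orbits l \<and> \<F> \<inter> pullback (diag_mat l) ` \<G> \<noteq> {}"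
proof -
  obtain F where F: "F face_of schur_horn_orbitope (diag_mat l)"
    and FF: "\<F> = {conj_act g ` F |g. orthogonal_matrix g}"
    using orbit by (auto simp: orbitope_face_orbits_def)
  have "\<exists>G. G face_of permutahedron l \<and> pullback (diag_mat l) G \<in> \<F>"
  proof (cases "F = {}")
    case True
    then have "pullback (diag_mat l) {} \<in> \<F>" using orthogonal_matrix_id by (auto simp: FF pullback_def)
    then show ?thesis by blast
  next
    case False
    obtain g S where g: "orthogonal_matrix g" and S: "S \<subseteq> {..CARD('n)}" and FS: "F = conj_act g ` std_face l S"
      using face_is_conjugate_std_face[OF l F False] by metis
    have "std_face l S = conj_act (transpose g) ` F"
      unfolding FS by (rule conj_act_image_cancel(2)[OF g, symmetric])
    then have "pullback (diag_mat l) (perm_face l S) \<in> \<F>"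
      using g by (auto simp: FF pullback_perm_face[OF l] intro!: exI[of _ "transpose g"])
    then show ?thesis using perm_face_face_of[OF l S] by blast
  qed
  then obtain G where G: "G face_of permutahedron l" "pullback (diag_mat l) G \<in> \<F>" by blast
  show ?thesis
  proof (rule ex1I[of _ "{perm_act \<pi> ` G |\<pi>. \<pi> permutes UNIV}"])
    have "G \<in> {perm_act \<pi> ` G |\<pi>. \<pi> permutes UNIV}"
      using permutes_id by (auto intro!: exI[of _ id])
    then have "\<F> \<inter> pullback (diag_mat l) ` {perm_act \<pi> ` G |\<pi>. \<pi> permutes UNIV} \<noteq> {}"
      using G(2) by blast
    then show "{perm_act \<pi> ` G |\<pi>. \<pi> permutes UNIV} \<in> permutahedron_face_orbits l \<and>
        \<F> \<inter> pullback (diag_mat l) ` {perm_act \<pi> ` G |\<pi>. \<pi> permutes UNIV} \<noteq> {}"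
      using G by (auto simp: permutahedron_face_orbits_def)
  next
    fix \<G> assume "\<G> \<in> permutahedron_face_orbits l \<and> \<F> \<inter> pullback (diag_mat l) ` \<G> \<noteq> {}"
    then obtain H \<sigma> where H: "H face_of permutahedron l" "\<G> = {perm_act \<pi> ` H |\<pi>. \<pi> permutes UNIV}"
      and \<sigma>: "\<sigma> permutes UNIV" "pullback (diag_mat l) (perm_act \<sigma> ` H) \<in> \<F>"
      by (auto simp: permutahedron_face_orbits_def)
    obtain g h where g: "orthogonal_matrix g" "pullback (diag_mat l) (perm_act \<sigma> ` H) = conj_act g ` F"
      and h: "orthogonal_matrix h" "pullback (diag_mat l) G = conj_act h ` F"
      using \<sigma>(2) G(2) by (auto simp: FF)
    have "conj_act (h ** transpose g) ` conj_act g ` F = conj_act h ` F"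
      using g(1) by (simp add: image_image conj_act_mult conj_act_transpose_cancel)
    then have "{perm_act \<pi> ` perm_act \<sigma> ` H |\<pi>. \<pi> permutes UNIV} = {perm_act \<pi> ` G |\<pi>. \<pi> permutes UNIV}"
      unfolding g(2)[symmetric] h(2)[symmetric] using G(1) H(1) \<sigma>(1) g(1) h(1)
      by (intro conjugate_pullbacks_imp_same_orbit[where g = "h ** transpose g"])
         (simp_all add: perm_act_face_of orthogonal_matrix_mul)
    then show "\<G> = {perm_act \<pi> ` G |\<pi>. \<pi> permutes UNIV}"
      by (simp add: H(2) perm_orbit_of_image[OF \<sigma>(1)])
  qed
qed

section \<open>Sums of blocks in an orthonormal frame\<close>

definition column_span :: "real^'n^'n \<Rightarrow> 'n set \<Rightarrow> (real^'n) set" where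
  "column_span g J = span ((\<lambda>j. column j g) ` J)"

definition restrict_entries :: "'n set \<Rightarrow> real^'n \<Rightarrow> real^'n" where
  "restrict_entries J l = (\<chi> j. if j \<in> J then l $ j else 0)"

lemma column_in_column_span: "j \<in> J \<Longrightarrow> column j g \<in> column_span g J"
  unfolding column_span_def by (intro span_base) blast

lemma subspace_column_span: "subspace (column_span g J)"
  by (simp add: column_span_def)

lemma inner_columns:
  fixes g :: "real^'n^'n"
  assumes "orthogonal_matrix g"
  shows "column i g \<bullet> column j g = (if i = j then 1 else 0)"
  using orthogonal_matrix_column_sum[OF assms, of i j] by (simp add: inner_vec_def column_def)

lemma orthogonal_matrix_inner:
  fixes g :: "real^'n^'n"
  assumes "orthogonal_matrix g"
  shows "(g *v v) \<bullet> (g *v w) = v \<bullet> w"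
proof -
  have "orthogonal_transformation ((*v) g)"
    using assms by (simp add: orthogonal_transformation_matrix matrix_of_matrix_vector_mul matrix_vector_mul_linear)
  then show ?thesis by (simp add: orthogonal_transformation_def)
qed

lemma orthonormal_family_matrix:
  fixes f :: "'n::finite \<Rightarrow> real^'n"
  assumes "\<And>c d. f c \<bullet> f d = (if c = d then 1 else 0)"
  obtains h where "orthogonal_matrix h" "\<And>c. column c h = f c"
proof -
  have "inj f" by (rule injI) (metis assms zero_neq_one)
  moreover have "orthonormal (range f)"
    unfolding orthonormal_def pairwise_def orthogonal_def by (auto simp: assms norm_eq_1)
  ultimately show ?thesis using orthogonal_matrix_from_basis that by blast
qed

lemma matrix_vector_mult_sum_left:
  fixes A :: "'i \<Rightarrow> real^'n^'m"
  shows "(\<Sum>i\<in>I. A i) *v x = (\<Sum>i\<in>I. A i *v x)"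
  by (induction I rule: infinite_finite_induct) (simp_all add: matrix_vector_mult_add_rdistrib)

lemma mem_column_span:
  fixes g :: "real^'n^'n"
  assumes g: "orthogonal_matrix g"
  shows "v \<in> column_span g J \<longleftrightarrow> (\<forall>j. j \<notin> J \<longrightarrow> column j g \<bullet> v = 0)"
proof
  assume "v \<in> column_span g J"
  then have "v \<in> {v. \<forall>j. j \<notin> J \<longrightarrow> column j g \<bullet> v = 0}"
    unfolding column_span_def
  proof (rule span_subspace_induct)
    show "subspace {v. \<forall>j. j \<notin> J \<longrightarrow> column j g \<bullet> v = 0}"
      by (auto simp: subspace_def inner_add_right)
    show "x \<in> {v. \<forall>j. j \<notin> J \<longrightarrow> column j g \<bullet> v = 0}" if "x \<in> (\<lambda>j. column j g) ` J" for x
      using that by (auto simp: inner_columns[OF g])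
  qed
  then show "\<forall>j. j \<notin> J \<longrightarrow> column j g \<bullet> v = 0" by simp
next
  assume 0: "\<forall>j. j \<notin> J \<longrightarrow> column j g \<bullet> v = 0"
  have "v = (\<Sum>b\<in>range (\<lambda>j. column j g). (v \<bullet> b) *\<^sub>R b)"
    using orthonormal_expansion[OF orthonormal_columns(1)[OF g], of v UNIV] span_columns_UNIV[OF g] by simp
  also have "\<dots> = (\<Sum>j\<in>UNIV. (v \<bullet> column j g) *\<^sub>R column j g)"
    using orthonormal_columns(2)[OF g] by (simp add: sum.reindex)
  also have "\<dots> \<in> column_span g J"
  proof (intro subspace_sum subspace_column_span)
    fix j
    show "(v \<bullet> column j g) *\<^sub>R column j g \<in> column_span g J"
      using 0 by (cases "j \<in> J")
        (auto simp: inner_commute[of v] intro: subspace_scale subspace_0 subspace_column_span column_in_column_span)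
  qed
  finally show "v \<in> column_span g J" .
qed

lemma column_span_mono: "J \<subseteq> K \<Longrightarrow> column_span g J \<subseteq> column_span g K"
  unfolding column_span_def by (intro span_mono image_mono)

lemma column_span_empty [simp]: "column_span g {} = {0}"
  by (simp add: column_span_def)

lemma column_span_UNIV: "orthogonal_matrix g \<Longrightarrow> column_span g UNIV = UNIV"
  by (simp add: column_span_def span_columns_UNIV)

lemma dim_column_span:
  fixes g :: "real^'n^'n"
  assumes g: "orthogonal_matrix g"
  shows "dim (column_span g J) = card J"
proof -
  have "inj_on (\<lambda>j. column j g) J" using orthonormal_columns(2)[OF g] by (rule inj_on_subset) simp
  then show ?thesis
    unfolding column_span_def using orthonormal_card[OF orthonormal_columns(1)[OF g, of J]] by (simp add: card_image)
qed

lemma orthogonal_comp_column_span: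
  fixes g :: "real^'n^'n"
  assumes g: "orthogonal_matrix g"
  shows "orthogonal_comp (column_span g J) = column_span g (- J)"
proof (intro set_eqI iffI)
  fix v assume "v \<in> orthogonal_comp (column_span g J)"
  then show "v \<in> column_span g (- J)"
    using column_in_column_span[of _ J g] by (auto simp: mem_column_span[OF g] orthogonal_comp_def orthogonal_def)
next
  fix v assume v: "v \<in> column_span g (- J)"
  have "w \<in> {w. w \<bullet> v = 0}" if "w \<in> column_span g J" for w
    using that unfolding column_span_def
  proof (rule span_subspace_induct)
    show "subspace {w. w \<bullet> v = 0}" by (auto simp: subspace_def inner_add_left)
    show "x \<in> {w. w \<bullet> v = 0}" if "x \<in> (\<lambda>j. column j g) ` J" for x
      using that v by (auto simp: mem_column_span[OF g])
  qed
  then show "v \<in> orthogonal_comp (column_span g J)" by (simp add: orthogonal_comp_def orthogonal_def)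
qed

lemma column_span_Int_orthogonal_comp:
  fixes g :: "real^'n^'n"
  assumes g: "orthogonal_matrix g"
  shows "column_span g K \<inter> orthogonal_comp (column_span g J) = column_span g (K - J)"
  unfolding orthogonal_comp_column_span[OF g] by (auto simp: mem_column_span[OF g])

lemma block_kills_complement:
  fixes g :: "real^'n^'n"
  assumes g: "orthogonal_matrix g" and v: "v \<in> column_span g (- J)"
  shows "conj_act g (diag_mat (restrict_entries J l)) *v v = 0"
proof -
  have "v \<in> {v. conj_act g (diag_mat (restrict_entries J l)) *v v = 0}"
    using v unfolding column_span_def
  proof (rule span_subspace_induct)
    show "subspace {v. conj_act g (diag_mat (restrict_entries J l)) *v v = 0}"
      by (auto simp: subspace_def matrix_vector_right_distrib matrix_vector_mult_scaleR)
    show "x \<in> {v. conj_act g (diag_mat (restrict_entries J l)) *v v = 0}" if "x \<in> (\<lambda>j. column j g) ` (- J)" for x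
      using that by (auto simp: conj_diag_mat_column[OF g] restrict_entries_def)
  qed
  then show ?thesis by simp
qed

text \<open>
  An orthogonal \<open>h\<close> fixing the orthogonal complement of \<open>V\<close> pointwise preserves orthogonality to it.
\<close>

lemma orthogonal_group_on_preserves:
  fixes h :: "real^'n^'n"
  assumes h: "h \<in> orthogonal_group_on V" and V: "subspace V" and v: "v \<in> V"
  shows "h *v v \<in> V"
proof -
  have oh: "orthogonal_matrix h" using h by (simp add: orthogonal_group_on_def)
  have "w \<bullet> (h *v v) = 0" if w: "w \<in> orthogonal_comp V" for w
  proof -
    have "h *v w = w" using h w by (simp add: orthogonal_group_on_def)
    then have "w \<bullet> (h *v v) = (h *v w) \<bullet> (h *v v)" by simp
    also have "\<dots> = w \<bullet> v"
      by (rule orthogonal_matrix_inner[OF oh])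
    also have "\<dots> = 0" using w v by (simp add: orthogonal_comp_def orthogonal_def inner_commute)
    finally show ?thesis .
  qed
  then have "h *v v \<in> orthogonal_comp (orthogonal_comp V)"
    by (simp add: orthogonal_comp_def orthogonal_def)
  then show ?thesis using orthogonal_comp_self[OF V] by simp
qed

text \<open>
  Here \<open>\<beta>\<close> assigns the vectors of the frame \<open>g\<close> to blocks. The columns of \<open>h'\<close> are eigenvectors of the
  sum: a column of the block \<open>i\<close> is an eigenvector of the \<open>i\<close>-th summand and is killed by all others.
\<close>

lemma sum_of_conjugated_blocks:
  fixes g h' :: "real^'n^'n" and \<beta> :: "'n \<Rightarrow> nat"
  assumes g: "orthogonal_matrix g" and h': "orthogonal_matrix h'" and \<beta>: "\<And>c. \<beta> c < k"
    and h: "\<And>i. i < k \<Longrightarrow> h i \<in> orthogonal_group_on (column_span g {c. \<beta> c = i})"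
    and col: "\<And>c. column c h' = h (\<beta> c) *v column c g"
  shows "(\<Sum>i<k. conj_act (h i) (conj_act g (diag_mat (restrict_entries {c. \<beta> c = i} l)))) = conj_act h' (diag_mat l)"
proof (rule eigenvectors_imp_conj_diag_mat[OF h'])
  fix c
  let ?V = "\<lambda>i. column_span g {c. \<beta> c = i}" and ?N = "\<lambda>i. conj_act g (diag_mat (restrict_entries {c. \<beta> c = i} l))"
  have oh: "orthogonal_matrix (h i)" if "i < k" for i
    using h[OF that] by (simp add: orthogonal_group_on_def)
  have own: "conj_act (h (\<beta> c)) (?N (\<beta> c)) *v column c h' = l $ c *\<^sub>R column c h'"
  proof -
    have "transpose (h (\<beta> c)) *v (h (\<beta> c) *v column c g) = column c g"
      using oh[OF \<beta>] by (simp add: matrix_vector_mul_assoc orthogonal_matrix_def del: transpose_matrix_vector)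
    then have "conj_act (h (\<beta> c)) (?N (\<beta> c)) *v column c h' = h (\<beta> c) *v (?N (\<beta> c) *v column c g)"
      by (simp add: conj_act_def[of "h (\<beta> c)"] col flip: matrix_vector_mul_assoc del: transpose_matrix_vector)
    then show ?thesis
      by (simp add: conj_diag_mat_column[OF g] restrict_entries_def matrix_vector_mult_scaleR col)
  qed
  have other: "conj_act (h i) (?N i) *v column c h' = 0" if i: "i < k" "i \<noteq> \<beta> c" for i
  proof -
    have "column c h' \<in> ?V (\<beta> c)"
      unfolding col using orthogonal_group_on_preserves[OF h[OF \<beta>] subspace_column_span]
      by (simp add: column_in_column_span)
    also have "?V (\<beta> c) \<subseteq> column_span g (- {c. \<beta> c = i})" using i by (intro column_span_mono) auto
    finally have cmem: "column c h' \<in> column_span g (- {c. \<beta> c = i})" .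
    then have "h i *v column c h' = column c h'"
      using h[OF i(1)] by (simp add: orthogonal_group_on_def orthogonal_comp_column_span[OF g])
    then have "transpose (h i) *v column c h' = transpose (h i) *v (h i *v column c h')" by simp
    also have "\<dots> = column c h'"
      using oh[OF i(1)] by (simp add: matrix_vector_mul_assoc orthogonal_matrix_def del: transpose_matrix_vector)
    finally have "conj_act (h i) (?N i) *v column c h' = h i *v (?N i *v column c h')"
      by (simp add: conj_act_def[of "h i"] flip: matrix_vector_mul_assoc del: transpose_matrix_vector)
    also have "?N i *v column c h' = 0" by (rule block_kills_complement[OF g cmem])
    finally show ?thesis by simp
  qed
  have "(\<Sum>i<k. conj_act (h i) (?N i)) *v column c h' = (\<Sum>i<k. conj_act (h i) (?N i) *v column c h')"
    by (simp add: matrix_vector_mult_sum_left)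
  also have "\<dots> = (\<Sum>i<k. if i = \<beta> c then l $ c *\<^sub>R column c h' else 0)"
    using own other by (intro sum.cong) auto
  also have "\<dots> = l $ c *\<^sub>R column c h'" using \<beta> by simp
  finally show "(\<Sum>i<k. conj_act (h i) (?N i)) *v column c h' = l $ c *\<^sub>R column c h'" .
qed

text \<open>
  A tuple of orthogonal transformations, one on each block, amounts to a single orthogonal matrix that is
  block diagonal in the frame \<open>g\<close>: its columns are the images of the frame vectors under the transformation of
  their own block.
\<close>

lemma block_sums_eq_block_orbit:
  fixes g :: "real^'n^'n" and \<beta> :: "'n \<Rightarrow> nat" and l :: "real^'n"
  assumes g: "orthogonal_matrix g" and \<beta>: "\<And>c. \<beta> c < k"
  shows "{(\<Sum>i<k. conj_act (h i) (conj_act g (diag_mat (restrict_entries {c. \<beta> c = i} l)))) |h.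
            \<forall>i<k. h i \<in> orthogonal_group_on (column_span g {c. \<beta> c = i})} =
         conj_act g ` {conj_act q (diag_mat l) |q. orthogonal_matrix q \<and> (\<forall>a b. \<beta> a \<noteq> \<beta> b \<longrightarrow> q $ a $ b = 0)}"
    (is "?L = ?R")
proof (intro set_eqI iffI)
  let ?V = "\<lambda>i. column_span g {c. \<beta> c = i}"
  have V_orth: "v \<bullet> w = 0" if "v \<in> ?V i" "w \<in> ?V j" "i \<noteq> j" for v w i j
  proof -
    have "?V j \<subseteq> column_span g (- {c. \<beta> c = i})" using that by (intro column_span_mono) auto
    then have "w \<in> orthogonal_comp (?V i)" using that by (auto simp: orthogonal_comp_column_span[OF g])
    then show ?thesis using that by (simp add: orthogonal_comp_def orthogonal_def)
  qed
  {
    fix A assume "A \<in> ?L"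
    then obtain h where h: "\<And>i. i < k \<Longrightarrow> h i \<in> orthogonal_group_on (?V i)"
      and A: "A = (\<Sum>i<k. conj_act (h i) (conj_act g (diag_mat (restrict_entries {c. \<beta> c = i} l))))" by auto
    define f where "f c = h (\<beta> c) *v column c g" for c
    have fV: "f c \<in> ?V (\<beta> c)" for c
      unfolding f_def using orthogonal_group_on_preserves[OF h[OF \<beta>] subspace_column_span]
      by (simp add: column_in_column_span)
    have inner_f: "f c \<bullet> f d = (if c = d then 1 else 0)" for c d
    proof (cases "\<beta> c = \<beta> d")
      case True
      have "orthogonal_matrix (h (\<beta> d))" using h[OF \<beta>] by (simp add: orthogonal_group_on_def)
      then show ?thesis by (simp add: f_def True orthogonal_matrix_inner inner_columns[OF g])
    next
      case False
      then show ?thesis using V_orth[OF fV fV] by auto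
    qed
    obtain h' where h': "orthogonal_matrix h'" "\<And>c. column c h' = f c"
      using orthonormal_family_matrix[of f] inner_f by metis
    define q where "q = transpose g ** h'"
    have gq: "h' = g ** q" using g by (simp add: q_def matrix_mul_assoc orthogonal_matrix_def)
    have "orthogonal_matrix q" using g h' by (simp add: q_def orthogonal_matrix_mul)
    moreover have "q $ a $ b = 0" if "\<beta> a \<noteq> \<beta> b" for a b
    proof -
      have "q $ a $ b = column a g \<bullet> column b h'"
        by (simp add: q_def matrix_matrix_mult_def transpose_def column_def inner_vec_def)
      then show ?thesis using fV[of b] that by (simp add: h' mem_column_span[OF g])
    qed
    moreover have "A = conj_act g (conj_act q (diag_mat l))"
      using sum_of_conjugated_blocks[OF g h'(1) \<beta> h, of l] h'(2) by (simp add: A f_def gq conj_act_mult)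
    ultimately show "A \<in> ?R" by blast
  next
    fix A assume "A \<in> ?R"
    then obtain q where q: "orthogonal_matrix q" "\<And>a b. \<beta> a \<noteq> \<beta> b \<Longrightarrow> q $ a $ b = 0"
      and A: "A = conj_act g (conj_act q (diag_mat l))" by blast
    define h' where "h' = g ** q"
    have oh': "orthogonal_matrix h'" using g q by (simp add: h'_def orthogonal_matrix_mul)
    have h'V: "column c h' \<in> ?V (\<beta> c)" for c
      unfolding mem_column_span[OF g]
    proof (intro allI impI)
      fix a assume "a \<notin> {d. \<beta> d = \<beta> c}"
      have "column a g \<bullet> column c h' = (transpose g ** h') $ a $ c"
        by (simp add: matrix_matrix_mult_def transpose_def column_def inner_vec_def)
      also have "transpose g ** h' = q" using g by (simp add: h'_def matrix_mul_assoc orthogonal_matrix_def)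
      finally show "column a g \<bullet> column c h' = 0" using q(2) \<open>a \<notin> _\<close> by simp
    qed
    have "\<exists>h. h \<in> orthogonal_group_on (?V i) \<and> (\<forall>c. \<beta> c = i \<longrightarrow> h *v column c g = column c h')" for i
    proof -
      define f where "f c = (if \<beta> c = i then column c h' else column c g)" for c
      have fV: "f c \<in> ?V (\<beta> c)" for c using h'V by (auto simp: f_def column_in_column_span)
      have inner_f: "f c \<bullet> f d = (if c = d then 1 else 0)" for c d
        using V_orth[OF fV[of c] fV[of d]] by (auto simp: f_def inner_columns[OF g] inner_columns[OF oh'])
      obtain F where F: "orthogonal_matrix F" "\<And>c. column c F = f c"
        using orthonormal_family_matrix[of f] inner_f by metis
      define h where "h = F ** transpose g"
      have hg: "h *v column c g = f c" for c
      proof -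
        have "h ** g = F" using g by (simp add: h_def orthogonal_matrix_def flip: matrix_mul_assoc)
        then have "(h *v column c g) $ a = F $ a $ c" for a by (metis mult_column)
        then show ?thesis using F(2)[of c] by (simp add: vec_eq_iff column_def)
      qed
      have "h *v x = x" if "x \<in> orthogonal_comp (?V i)" for x
      proof -
        have "x \<in> column_span g (- {c. \<beta> c = i})" using that by (simp add: orthogonal_comp_column_span[OF g])
        then have "x \<in> {x. h *v x = x}"
          unfolding column_span_def
        proof (rule span_subspace_induct)
          show "subspace {x. h *v x = x}"
            by (auto simp: subspace_def matrix_vector_right_distrib matrix_vector_mult_scaleR)
          show "x \<in> {x. h *v x = x}" if "x \<in> (\<lambda>j. column j g) ` (- {c. \<beta> c = i})" for x
            using that by (auto simp: hg f_def split: if_splits)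
        qed
        then show ?thesis by simp
      qed
      moreover have "orthogonal_matrix h" using F g by (simp add: h_def orthogonal_matrix_mul)
      ultimately have "h \<in> orthogonal_group_on (?V i)" by (simp add: orthogonal_group_on_def)
      then show ?thesis using hg by (auto simp: f_def)
    qed
    then obtain h where h: "\<And>i. h i \<in> orthogonal_group_on (?V i)"
      "\<And>i c. \<beta> c = i \<Longrightarrow> h i *v column c g = column c h'" by metis
    have "A = conj_act h' (diag_mat l)" by (simp add: A h'_def conj_act_mult)
    also have "\<dots> = (\<Sum>i<k. conj_act (h i) (conj_act g (diag_mat (restrict_entries {c. \<beta> c = i} l))))"
      by (rule sum_of_conjugated_blocks[OF g oh' \<beta> h(1), symmetric]) (simp add: h(2))
    finally show "A \<in> ?L" using h(1) by blast
  }
qed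

text \<open>
  Taking convex hulls commutes with Minkowski sums.
\<close>

lemma sum_of_orbitopes_eq_hull:
  fixes k :: nat
  shows "{(\<Sum>i<k. A i) |A. \<forall>i<k. A i \<in> schur_horn_orbitope_on (V i) (N i)} =
   convex hull {(\<Sum>i<k. conj_act (h i) (N i)) |h. \<forall>i<k. h i \<in> orthogonal_group_on (V i)}"
proof -
  let ?X = "\<lambda>i. {conj_act g (N i) |g. g \<in> orthogonal_group_on (V i)}"
  have "{(\<Sum>i<k. A i) |A. \<forall>i<k. A i \<in> schur_horn_orbitope_on (V i) (N i)} =
      (\<Sum>i\<in>{..<k}. convex hull (?X i))"
    unfolding schur_horn_orbitope_on_def by (subst set_sum_alt) auto
  also have "\<dots> = convex hull (\<Sum>i\<in>{..<k}. ?X i)" by (simp add: convex_hull_set_sum)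
  also have "(\<Sum>i\<in>{..<k}. ?X i) = {(\<Sum>i<k. conj_act (h i) (N i)) |h. \<forall>i<k. h i \<in> orthogonal_group_on (V i)}"
  proof -
    have "(\<Sum>i\<in>{..<k}. ?X i) = {sum s {..<k} |s. \<forall>i\<in>{..<k}. s i \<in> ?X i}"
      by (rule set_sum_alt) simp
    also have "\<dots> = {(\<Sum>i<k. conj_act (h i) (N i)) |h. \<forall>i<k. h i \<in> orthogonal_group_on (V i)}"
    proof (intro set_eqI iffI)
      fix B assume "B \<in> {sum s {..<k} |s. \<forall>i\<in>{..<k}. s i \<in> ?X i}"
      then obtain s where s: "B = sum s {..<k}" "\<forall>i\<in>{..<k}. \<exists>g. s i = conj_act g (N i) \<and> g \<in> orthogonal_group_on (V i)"
        by auto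
      then obtain h where "\<forall>i\<in>{..<k}. s i = conj_act (h i) (N i) \<and> h i \<in> orthogonal_group_on (V i)"
        by (meson bchoice)
      then show "B \<in> {(\<Sum>i<k. conj_act (h i) (N i)) |h. \<forall>i<k. h i \<in> orthogonal_group_on (V i)}"
        using s(1) by auto
    next
      fix B assume "B \<in> {(\<Sum>i<k. conj_act (h i) (N i)) |h. \<forall>i<k. h i \<in> orthogonal_group_on (V i)}"
      then show "B \<in> {sum s {..<k} |s. \<forall>i\<in>{..<k}. s i \<in> ?X i}" by auto
    qed
    finally show ?thesis .
  qed
  finally show ?thesis .
qed

section \<open>Flags and adapted frames\<close>

text \<open>
  The dimensions of the members of a flag in an \<open>n\<close>-dimensional space.
\<close>

definition step_sequence :: "nat \<Rightarrow> nat \<Rightarrow> (nat \<Rightarrow> nat) \<Rightarrow> bool" where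
  "step_sequence n k s \<longleftrightarrow> s 0 = 0 \<and> s k = n \<and> (\<forall>i<k. s i < s (Suc i))"

lemma step_sequence_mono:
  assumes "step_sequence n k s" "i \<le> j" "j \<le> k"
  shows "s i \<le> s j"
  using assms(2,3)
proof (induction j rule: dec_induct)
  case (step m)
  then have "s m < s (Suc m)" using assms(1) by (simp add: step_sequence_def)
  then show ?case using step by simp
qed simp

lemma step_sequence_le: "step_sequence n k s \<Longrightarrow> i \<le> k \<Longrightarrow> s i \<le> n"
  using step_sequence_mono[of n k s i k] by (simp add: step_sequence_def)

lemma step_sequence_block:
  assumes s: "step_sequence n k s" and p: "p < n"
  shows "\<exists>!i. i < k \<and> s i \<le> p \<and> p < s (Suc i)"
proof (rule ex_ex1I)
  have "p < s k" "\<not> p < s 0" using s p by (auto simp: step_sequence_def)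
  from ex_least_nat_less[of "\<lambda>i. p < s i", OF this]
  show "\<exists>i. i < k \<and> s i \<le> p \<and> p < s (Suc i)" by (auto simp: not_less)
next
  fix i j assume ij: "i < k \<and> s i \<le> p \<and> p < s (Suc i)" "j < k \<and> s j \<le> p \<and> p < s (Suc j)"
  have "\<not> Suc i \<le> j" "\<not> Suc j \<le> i"
    using step_sequence_mono[OF s, of "Suc i" j] step_sequence_mono[OF s, of "Suc j" i] ij by force+
  then show "i = j" by simp
qed

definition step_block :: "nat \<Rightarrow> (nat \<Rightarrow> nat) \<Rightarrow> 'n::{finite,linorder} \<Rightarrow> nat" where
  "step_block k s c = (THE i. i < k \<and> s i \<le> pos c \<and> pos c < s (Suc i))"

lemma step_block:
  fixes c :: "'n::{finite,linorder}"
  assumes "step_sequence (CARD('n)) k s"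
  shows "step_block k s c < k" "s (step_block k s c) \<le> pos c" "pos c < s (Suc (step_block k s c))"
  using theI'[OF step_sequence_block[OF assms pos_less_card[of c]]] by (auto simp: step_block_def)

lemma step_block_eqI:
  fixes c :: "'n::{finite,linorder}"
  assumes "step_sequence (CARD('n)) k s" "i < k" "s i \<le> pos c" "pos c < s (Suc i)"
  shows "step_block k s c = i"
  using step_sequence_block[OF assms(1) pos_less_card[of c]] step_block[OF assms(1), of c] assms(2-) by blast

lemma step_block_fibre:
  assumes "step_sequence (CARD('n)) k s" "i < k"
  shows "{c :: 'n::{finite,linorder}. step_block k s c = i} = initial (s (Suc i)) - initial (s i)"
proof (intro set_eqI iffI)
  fix c :: 'n assume "c \<in> {c. step_block k s c = i}"
  then show "c \<in> initial (s (Suc i)) - initial (s i)"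
    using step_block(2,3)[OF assms(1), of c] by (simp add: mem_initial not_less)
next
  fix c :: 'n assume "c \<in> initial (s (Suc i)) - initial (s i)"
  then show "c \<in> {c. step_block k s c = i}"
    using step_block_eqI[OF assms, of c] by (simp add: mem_initial not_less)
qed

lemma separated_iff_step_block:
  fixes a b :: "'n::{finite,linorder}"
  assumes s: "step_sequence (CARD('n)) k s"
  shows "separated (s ` {..k}) a b \<longleftrightarrow> step_block k s a \<noteq> step_block k s b"
proof
  assume "separated (s ` {..k}) a b"
  then obtain i where i: "i \<le> k" "(pos a < s i) \<noteq> (pos b < s i)" by (auto simp: separated_def mem_initial)
  show "step_block k s a \<noteq> step_block k s b"
  proof
    assume eq: "step_block k s a = step_block k s b"
    let ?j = "step_block k s b"
    have j: "?j < k" "s ?j \<le> pos a" "pos a < s (Suc ?j)" "s ?j \<le> pos b" "pos b < s (Suc ?j)"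
      using step_block[OF s, of a] step_block[OF s, of b] eq by auto
    have "s i \<le> s ?j \<or> s (Suc ?j) \<le> s i"
      using step_sequence_mono[OF s, of i ?j] step_sequence_mono[OF s, of "Suc ?j" i] j(1) i(1) by fastforce
    then show False using j i(2) by auto
  qed
next
  have *: "separated (s ` {..k}) a b" if less: "step_block k s a < step_block k s b" for a b :: 'n
  proof -
    let ?m = "Suc (step_block k s a)"
    have "pos a < s ?m" using step_block[OF s] by blast
    moreover have "s ?m \<le> pos b"
      using step_sequence_mono[OF s, of ?m "step_block k s b"] less step_block[OF s, of b] by simp
    moreover have "?m \<le> k" using step_block(1)[OF s, of a] by simp
    ultimately show ?thesis unfolding separated_def mem_initial by (metis atMost_iff image_eqI not_le)
  qed
  have sym: "separated S a b \<Longrightarrow> separated S b a" for S and a b :: 'n by (auto simp: separated_def)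
  assume "step_block k s a \<noteq> step_block k s b"
  then show "separated (s ` {..k}) a b" using * sym by (metis linorder_neqE_nat)
qed

lemma flag_step_frame:
  fixes g :: "real^('n::{finite,linorder})^('n::{finite,linorder})"
  assumes g: "orthogonal_matrix g" and s: "step_sequence (CARD('n)) k s"
    and W: "\<And>i. i \<le> k \<Longrightarrow> W i = column_span g (initial (s i))" and i: "i < k"
  shows "flag_step W i = column_span g {c. step_block k s c = i}"
  using i by (simp add: flag_step_def W column_span_Int_orthogonal_comp[OF g] step_block_fibre[OF s])

lemma orbitope_product_frame:
  fixes l :: "real^('n::{finite,linorder})"
  assumes l: "decreasing l" and g: "orthogonal_matrix g" and s: "step_sequence (CARD('n)) k s"
    and W: "\<And>i. i \<le> k \<Longrightarrow> W i = column_span g (initial (s i))"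
    and N: "\<And>i. i < k \<Longrightarrow> N i = conj_act g (diag_mat (restrict_entries {c. step_block k s c = i} l))"
  shows "orbitope_product k W N = conj_act g ` std_face l (s ` {..k})"
proof -
  let ?\<beta> = "step_block k s :: 'n \<Rightarrow> nat"
  let ?V = "\<lambda>i. column_span g {c. ?\<beta> c = i}" and ?N = "\<lambda>i. conj_act g (diag_mat (restrict_entries {c. ?\<beta> c = i} l))"
  have S: "s ` {..k} \<subseteq> {..CARD('n)}"
    using step_sequence_le[OF s] by auto
  have "orbitope_product k W N = {(\<Sum>i<k. A i) |A. \<forall>i<k. A i \<in> schur_horn_orbitope_on (?V i) (?N i)}"
    by (simp add: orbitope_product_def flag_step_frame[OF g s W] N)
  also have "\<dots> = convex hull {(\<Sum>i<k. conj_act (h i) (?N i)) |h. \<forall>i<k. h i \<in> orthogonal_group_on (?V i)}"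
    by (rule sum_of_orbitopes_eq_hull)
  also have "\<dots> = convex hull (conj_act g ` {conj_act q (diag_mat l) |q. orthogonal_matrix q \<and> (\<forall>a b. ?\<beta> a \<noteq> ?\<beta> b \<longrightarrow> q $ a $ b = 0)})"
    by (subst block_sums_eq_block_orbit[OF g step_block(1)[OF s]]) simp
  also have "\<dots> = conj_act g ` std_face l (s ` {..k})"
    by (simp add: std_face_eq_hull[OF l S] block_diagonal_def separated_iff_step_block[OF s]
        convex_hull_linear_image[OF linear_conj_act])
  finally show ?thesis .
qed

lemma frame_is_flag:
  fixes g :: "real^('n::{finite,linorder})^('n::{finite,linorder})"
  assumes g: "orthogonal_matrix g" and s: "step_sequence (CARD('n)) k s"
  shows "is_flag k (\<lambda>i. column_span g (initial (s i)))"
proof -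
  have dim: "dim (column_span g (initial (s i))) = s i" if "i \<le> k" for i
  proof -
    have "s i \<le> CARD('n)" using step_sequence_le[OF s that] .
    then show ?thesis by (simp add: dim_column_span[OF g] card_initial)
  qed
  have "column_span g (initial (s i)) \<subset> column_span g (initial (s (Suc i)))" if i: "i < k" for i
  proof
    have "s i < s (Suc i)" using s i by (simp add: step_sequence_def)
    then show "column_span g (initial (s i)) \<subseteq> column_span g (initial (s (Suc i)))"
      by (intro column_span_mono) (auto simp: mem_initial)
    show "column_span g (initial (s i)) \<noteq> column_span g (initial (s (Suc i)))"
      using dim[of i] dim[of "Suc i"] i \<open>s i < s (Suc i)\<close> by auto
  qed
  then show ?thesis
    using s by (simp add: is_flag_def step_sequence_def column_span_UNIV[OF g] subspace_column_span)
qed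

lemma frame_flag_blocks:
  fixes M g :: "real^('n::{finite,linorder})^('n::{finite,linorder})"
  assumes g: "orthogonal_matrix g" and s: "step_sequence (CARD('n)) k s"
  defines "l \<equiv> eigenvalue_vector M"
  shows "flag_blocks M k (\<lambda>i. column_span g (initial (s i)))
           (\<lambda>i. conj_act g (diag_mat (restrict_entries {c. step_block k s c = i} l)))"
  unfolding flag_blocks_def
proof (intro allI impI conjI)
  fix i assume i: "i < k"
  let ?W = "\<lambda>i. column_span g (initial (s i))"
  let ?J = "{c. step_block k s c = i}" and ?N = "\<lambda>i. conj_act g (diag_mat (restrict_entries {c. step_block k s c = i} l))"
  have V: "flag_step ?W i = column_span g ?J" by (rule flag_step_frame[OF g s _ i]) simp
  show "?N i \<in> symmetric_matrices_on (flag_step ?W i)"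
    unfolding V symmetric_matrices_on_def orthogonal_comp_column_span[OF g]
    by (simp add: transpose_conj_act block_kills_complement[OF g])
  fix \<mu>
  have "s i \<le> CARD('n)" "s (Suc i) \<le> CARD('n)"
    using step_sequence_le[OF s] i by simp_all
  then have dims: "dim (?W i) = s i" "dim (?W (Suc i)) = s (Suc i)"
    by (simp_all add: dim_column_span[OF g] card_initial)
  have "eig_mult_on (flag_step ?W i) (?N i) \<mu> = card {j\<in>?J. restrict_entries ?J l $ j = \<mu>}"
    unfolding V column_span_def[of g ?J] by (rule eig_mult_on_columns[OF g])
  also have "{j\<in>?J. restrict_entries ?J l $ j = \<mu>} = {j. s i \<le> pos j \<and> pos j < s (Suc i) \<and> l $ j = \<mu>}"
    unfolding step_block_fibre[OF s i] by (auto simp: restrict_entries_def mem_initial)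
  finally show "eig_mult_on (flag_step ?W i) (?N i) \<mu> = card {j. dim (?W i) \<le> card {l. l < j} \<and>
      card {l. l < j} < dim (?W (Suc i)) \<and> eigenvalue_vector M $ j = \<mu>}"
    unfolding dims by (simp add: pos_def l_def)
qed

text \<open>
  In each step of the flag choose an orthonormal eigenbasis of the block. The condition on multiplicities
  permits listing it so that the vector with index \<open>j\<close> has eigenvalue \<open>l $ j\<close>. The union of these bases is the
  frame; its first \<open>dim (W i)\<close> vectors lie in \<open>W i\<close>, hence span it.
\<close>

lemma flag_frame:
  fixes M :: "real^('n::{finite,linorder})^('n::{finite,linorder})"
  assumes flag: "is_flag k W" and blocks: "flag_blocks M k W N"
  defines "l \<equiv> eigenvalue_vector M"
  obtains g s where "orthogonal_matrix g" "step_sequence (CARD('n)) k s"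
    "\<And>i. i \<le> k \<Longrightarrow> W i = column_span g (initial (s i))"
    "\<And>i. i < k \<Longrightarrow> N i = conj_act g (diag_mat (restrict_entries {c. step_block k s c = i} l))"
proof -
  define s where "s i = dim (W i)" for i
  have sub: "subspace (W i)" if "i \<le> k" for i using flag that by (simp add: is_flag_def)
  have s: "step_sequence (CARD('n)) k s"
    unfolding step_sequence_def
  proof (intro conjI allI impI)
    show "s 0 = 0" "s k = CARD('n)" using flag by (simp_all add: s_def is_flag_def)
    fix i assume "i < k"
    then have "span (W i) \<subset> span (W (Suc i))" using flag sub by (simp add: is_flag_def span_eq_iff[THEN iffD2])
    then show "s i < s (Suc i)" unfolding s_def by (rule dim_psubset)
  qed
  have W_mono: "W i \<subseteq> W j" if "i \<le> j" "j \<le> k" for i j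
    using that
  proof (induction j rule: dec_induct)
    case (step m)
    then have "W m \<subset> W (Suc m)" using flag by (simp add: is_flag_def)
    then show ?case using step by auto
  qed simp
  let ?V = "flag_step W"
  let ?J = "\<lambda>i. {c :: 'n. step_block k s c = i}"
  have V_sub: "subspace (?V i)" if "i < k" for i
    unfolding flag_step_def using that by (intro subspace_inter sub subspace_orthogonal_comp) simp
  have N: "transpose (N i) = N i" "\<And>x. x \<in> orthogonal_comp (?V i) \<Longrightarrow> N i *v x = 0" if "i < k" for i
    using blocks that by (auto simp: flag_blocks_def symmetric_matrices_on_def)
  have "\<exists>f. bij_betw f (?J i) (f ` ?J i) \<and> orthonormal (f ` ?J i) \<and> f ` ?J i \<subseteq> ?V i \<and>
      (\<forall>j\<in>?J i. N i *v f j = l $ j *\<^sub>R f j)" if i: "i < k" for i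
  proof -
    have "N i *v x \<in> ?V i" for x
    proof -
      have "y \<bullet> (N i *v x) = 0" if "y \<in> orthogonal_comp (?V i)" for y
        using symmetric_inner[OF N(1)[OF i], of y x] N(2)[OF i that] by simp
      then have "N i *v x \<in> orthogonal_comp (orthogonal_comp (?V i))"
        by (simp add: orthogonal_comp_def orthogonal_def)
      then show ?thesis using orthogonal_comp_self[OF V_sub[OF i]] by simp
    qed
    then obtain B where B: "orthonormal B" "span B = ?V i" "\<forall>b\<in>B. \<exists>c. N i *v b = c *\<^sub>R b"
      using spectral_theorem_on_subspace[OF N(1)[OF i] V_sub[OF i]] by blast
    then obtain c where c: "\<forall>b\<in>B. N i *v b = c b *\<^sub>R b" by metis
    have "card {j\<in>?J i. l $ j = \<mu>} = card {b\<in>B. c b = \<mu>}" for \<mu>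
    proof -
      have "card {b\<in>B. c b = \<mu>} = eig_mult_on (?V i) (N i) \<mu>"
        using eig_mult_on_eigenbasis[OF N(1)[OF i] B(1,2), of c \<mu>] c by simp
      also have "\<dots> = card {j. s i \<le> pos j \<and> pos j < s (Suc i) \<and> l $ j = \<mu>}"
        using blocks i by (simp add: flag_blocks_def s_def pos_def l_def)
      also have "{j. s i \<le> pos j \<and> pos j < s (Suc i) \<and> l $ j = \<mu>} = {j\<in>?J i. l $ j = \<mu>}"
        unfolding step_block_fibre[OF s i] by (auto simp: mem_initial)
      finally show ?thesis by simp
    qed
    then obtain f where f: "bij_betw f (?J i) B" "\<And>j. j \<in> ?J i \<Longrightarrow> c (f j) = l $ j"
      using bij_matching_fibres[of "?J i" B "($) l" c] orthonormal_finite[OF B(1)] by auto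
    have fB: "f ` ?J i = B" using f(1) by (simp add: bij_betw_def)
    have "N i *v f j = l $ j *\<^sub>R f j" if "j \<in> ?J i" for j
      using f(2)[OF that] c fB that by (metis imageI)
    then show ?thesis using f(1) fB B(1,2) span_superset[of B] by (intro exI[of _ f]) auto
  qed
  then obtain F where F: "\<And>i. i < k \<Longrightarrow> bij_betw (F i) (?J i) (F i ` ?J i) \<and> orthonormal (F i ` ?J i) \<and>
      F i ` ?J i \<subseteq> ?V i \<and> (\<forall>j\<in>?J i. N i *v F i j = l $ j *\<^sub>R F i j)" by metis
  define f where "f j = F (step_block k s j) j" for j
  have fV: "f j \<in> ?V (step_block k s j)" and fN: "N (step_block k s j) *v f j = l $ j *\<^sub>R f j"
    and f_norm: "norm (f j) = 1" for j
    using F[OF step_block(1)[OF s, of j]] by (auto simp: f_def orthonormal_def)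
  have V_orth_less: "v \<bullet> w = 0" if "v \<in> ?V i" "w \<in> ?V j" "i < j" "j < k" for v w i j
  proof -
    have "v \<in> W j" using that W_mono[of "Suc i" j] by (auto simp: flag_step_def)
    then show ?thesis using that by (simp add: flag_step_def orthogonal_comp_def orthogonal_def)
  qed
  have V_orth: "v \<bullet> w = 0" if "v \<in> ?V i" "w \<in> ?V j" "i \<noteq> j" "i < k" "j < k" for v w i j
    using V_orth_less[of v i w j] V_orth_less[of w j v i] that by (auto simp: inner_commute neq_iff)
  have "f c \<bullet> f d = (if c = d then 1 else 0)" for c d
  proof (cases "step_block k s c = step_block k s d")
    case True
    let ?i = "step_block k s d"
    have Fi: "inj_on (F ?i) (?J ?i)" "orthonormal (F ?i ` ?J ?i)"
      using F[OF step_block(1)[OF s, of d]] by (auto simp: bij_betw_def)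
    show ?thesis
    proof (cases "c = d")
      case False
      then have "F ?i c \<noteq> F ?i d" using Fi(1) True by (auto simp: inj_on_def)
      then have "orthogonal (F ?i c) (F ?i d)"
        using Fi(2) True unfolding orthonormal_def pairwise_def by blast
      then show ?thesis using False True by (simp add: f_def orthogonal_def)
    qed (use f_norm[of d] in \<open>simp add: norm_eq_1\<close>)
  next
    case False
    then show ?thesis using V_orth[OF fV fV False step_block(1)[OF s] step_block(1)[OF s]] by auto
  qed
  then obtain g where g: "orthogonal_matrix g" "\<And>c. column c g = f c"
    using orthonormal_family_matrix[of f] by metis
  have "W i = column_span g (initial (s i))" if i: "i \<le> k" for i
  proof (rule sym, rule subspace_dim_equal[OF subspace_column_span sub[OF i]])
    have "column j g \<in> W i" if j: "j \<in> initial (s i)" for j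
    proof -
      let ?b = "step_block k s j"
      have "s ?b < s i" using j step_block(2)[OF s, of j] by (simp add: mem_initial)
      then have "\<not> i \<le> ?b" using step_sequence_mono[OF s, of i ?b] step_block(1)[OF s, of j] by auto
      then have "W (Suc ?b) \<subseteq> W i" using W_mono i by simp
      then show ?thesis using fV[of j] by (auto simp: g flag_step_def)
    qed
    then show "column_span g (initial (s i)) \<subseteq> W i"
      unfolding column_span_def by (intro span_minimal sub[OF i]) auto
    have "s i \<le> CARD('n)" using step_sequence_le[OF s i] .
    then show "dim (W i) \<le> dim (column_span g (initial (s i)))"
      by (simp add: dim_column_span[OF g(1)] card_initial) (simp add: s_def)
  qed
  moreover have "N i = conj_act g (diag_mat (restrict_entries (?J i) l))" if i: "i < k" for i
  proof (rule eigenvectors_imp_conj_diag_mat[OF g(1)])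
    fix j
    show "N i *v column j g = restrict_entries (?J i) l $ j *\<^sub>R column j g"
    proof (cases "step_block k s j = i")
      case True
      then show ?thesis using fN[of j] by (simp add: g restrict_entries_def)
    next
      case False
      then have "f j \<in> orthogonal_comp (?V i)"
        using V_orth[OF _ fV[of j] _ i step_block(1)[OF s]] by (auto simp: orthogonal_comp_def orthogonal_def)
      then show ?thesis using N(2)[OF i] False by (simp add: g restrict_entries_def)
    qed
  qed
  ultimately show ?thesis using that g(1) s by blast
qed

lemma step_sequence_enumeration:
  fixes S :: "nat set"
  assumes S: "S \<subseteq> {..n}" "0 \<in> S" "n \<in> S"
  obtains k s where "step_sequence n k s" "s ` {..k} = S"
proof -
  have fin: "finite S" using S(1) finite_subset by blast
  obtain s where bij: "bij_betw s {..<card S} S" and mono: "strict_mono_on {..<card S} s"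
    using ex_bij_betw_strict_mono_card[OF fin] by blast
  define k where "k = card S - 1"
  have "card S > 0" using fin S by (auto simp: card_gt_0_iff)
  then have k: "{..<card S} = {..k}" by (auto simp: k_def)
  have img: "s ` {..k} = S" using bij by (simp add: bij_betw_def k)
  have less: "s i < s j" if "i < j" "j \<le> k" for i j
    using mono that by (simp add: k strict_mono_on_def)
  have "s 0 = 0"
  proof -
    obtain i where "i \<le> k" "s i = 0" using S(2) img by (metis atMost_iff imageE)
    then show ?thesis using less[of 0 i] by (cases "i = 0") auto
  qed
  moreover have "s k = n"
  proof -
    obtain i where i: "i \<le> k" "s i = n" using S(3) img by (metis atMost_iff imageE)
    have "s k \<le> n" using img S(1) by auto
    then show ?thesis using less[of i k] i by (cases "i = k") auto
  qed
  ultimately have "step_sequence n k s" using less by (simp add: step_sequence_def)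
  then show ?thesis using that img by blast
qed

lemma std_face_whole:
  fixes l :: "real^('n::{finite,linorder})"
  shows "std_face l {0, CARD('n)} = schur_horn_orbitope (diag_mat l)"
  using orbitope_trace[of _ l] by (auto simp: std_face_def)

text \<open>
  A step of full dimension is the only step of the flag, and then the equations of the standard face say
  nothing beyond the constancy of the trace.
\<close>

lemma full_step_imp_whole_orbitope:
  fixes l :: "real^('n::{finite,linorder})"
  assumes g: "orthogonal_matrix g" and s: "step_sequence (CARD('n)) k s" and i: "i < k"
    and full: "CARD('n) \<le> card {c :: 'n. step_block k s c = i}"
  shows "conj_act g ` std_face l (s ` {..k}) = schur_horn_orbitope (diag_mat l)"
proof -
  have le: "s (Suc i) \<le> CARD('n)" using step_sequence_le[OF s] i by simp
  have lt: "s i < s (Suc i)" using s i by (simp add: step_sequence_def)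
  have "card {c :: 'n. step_block k s c = i} = s (Suc i) - s i"
    unfolding step_block_fibre[OF s i] using le lt
    by (subst card_Diff_subset) (auto simp: card_initial mem_initial)
  then have eqs: "s i = 0" "s (Suc i) = CARD('n)" using full le lt by linarith+
  have ends: "s 0 = 0" "s k = CARD('n)" using s by (simp_all add: step_sequence_def)
  have "i = 0"
  proof (rule ccontr)
    assume "i \<noteq> 0"
    then have "s (Suc 0) \<le> s i" using i by (intro step_sequence_mono[OF s]) auto
    moreover have "s 0 < s (Suc 0)" using s i by (auto simp: step_sequence_def)
    ultimately show False using eqs by simp
  qed
  moreover have "Suc i = k"
  proof (rule ccontr)
    assume "Suc i \<noteq> k"
    then have "Suc i < k" using i by simp
    then have "s (Suc i) < s (Suc (Suc i))" "s (Suc (Suc i)) \<le> s k"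
      using s step_sequence_mono[OF s, of "Suc (Suc i)" k] by (auto simp: step_sequence_def)
    then show False using eqs ends by simp
  qed
  ultimately have "{..k} = {0, 1}" "s 1 = CARD('n)" using eqs by auto
  then have "s ` {..k} = {0, CARD('n)}" using ends by simp
  then show ?thesis by (simp add: std_face_whole conj_act_image_orbitope[OF g])
qed

theorem theorem3p5:
  fixes M :: "real^('n::{finite,linorder})^('n::{finite,linorder})"
  assumes "transpose M = M"
  shows "(\<forall>\<F> \<in> orbitope_face_orbits M.
            \<exists>!\<G>. \<G> \<in> permutahedron_face_orbits (eigenvalue_vector M) \<and>
                 \<F> \<inter> pullback M ` \<G> \<noteq> {}) \<and>
         (\<forall>F. F face_of schur_horn_orbitope M \<and> F \<noteq> {} \<longleftrightarrow>
            (\<exists>k W N. is_flag k W \<and> flag_blocks M k W N \<and> F = orbitope_product k W N \<and>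
               (F \<noteq> schur_horn_orbitope M \<longrightarrow> (\<forall>i<k. dim (flag_step W i) < CARD('n)))))"
proof -
  define l where "l = eigenvalue_vector M"
  have l: "decreasing l" using eigenvalue_decomposition[OF assms] unfolding l_def by metis
  have orb: "schur_horn_orbitope M = schur_horn_orbitope (diag_mat l)"
    unfolding l_def by (rule orbitope_eigenvalues[OF assms])
  have "orbitope_face_orbits M = orbitope_face_orbits (diag_mat l)" "pullback M = pullback (diag_mat l)"
    by (auto simp: orbitope_face_orbits_def pullback_def orb fun_eq_iff)
  then have part1: "\<forall>\<F> \<in> orbitope_face_orbits M.
      \<exists>!\<G>. \<G> \<in> permutahedron_face_orbits l \<and> \<F> \<inter> pullback M ` \<G> \<noteq> {}"
    using orbit_correspondence[OF l] by simp
  have to_flag: "\<exists>k W N. is_flag k W \<and> flag_blocks M k W N \<and> F = orbitope_product k W N \<and>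
      (F \<noteq> schur_horn_orbitope M \<longrightarrow> (\<forall>i<k. dim (flag_step W i) < CARD('n)))"
    if F: "F face_of schur_horn_orbitope M" "F \<noteq> {}" for F
  proof -
    obtain g S where g: "orthogonal_matrix g" and S: "S \<subseteq> {..CARD('n)}" "0 \<in> S" "CARD('n) \<in> S"
      and FS: "F = conj_act g ` std_face l S"
      using face_is_conjugate_std_face[OF l] F orb by metis
    obtain k s where s: "step_sequence (CARD('n)) k s" and sS: "s ` {..k} = S"
      using step_sequence_enumeration[OF S] by blast
    let ?W = "\<lambda>i. column_span g (initial (s i))"
    let ?N = "\<lambda>i. conj_act g (diag_mat (restrict_entries {c. step_block k s c = i} l))"
    have FW: "F = orbitope_product k ?W ?N"
      using orbitope_product_frame[OF l g s, of ?W ?N] FS sS by simp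
    have "dim (flag_step ?W i) < CARD('n)" if ne: "F \<noteq> schur_horn_orbitope M" and i: "i < k" for i
    proof (rule ccontr)
      assume "\<not> dim (flag_step ?W i) < CARD('n)"
      then have "CARD('n) \<le> card {c :: 'n. step_block k s c = i}"
        using flag_step_frame[OF g s _ i, of ?W] by (simp add: dim_column_span[OF g])
      then have "F = schur_horn_orbitope M"
        using full_step_imp_whole_orbitope[OF g s i, of l] FS sS orb by simp
      then show False using ne by simp
    qed
    then show ?thesis
      using frame_is_flag[OF g s] frame_flag_blocks[OF g s, of M] FW unfolding l_def by blast
  qed
  have from_flag: "F face_of schur_horn_orbitope M \<and> F \<noteq> {}"
    if WN: "is_flag k W" "flag_blocks M k W N" "F = orbitope_product k W N" for F k W N
  proof -
    obtain g s where g: "orthogonal_matrix g" and s: "step_sequence (CARD('n)) k s"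
      and W: "\<And>i. i \<le> k \<Longrightarrow> W i = column_span g (initial (s i))"
      and N: "\<And>i. i < k \<Longrightarrow> N i = conj_act g (diag_mat (restrict_entries {c. step_block k s c = i} l))"
      using flag_frame[OF WN(1,2)] unfolding l_def by blast
    have F: "F = conj_act g ` std_face l (s ` {..k})"
      using orbitope_product_frame[OF l g s W N] WN(3) by simp
    have S: "s ` {..k} \<subseteq> {..CARD('n)}"
      using step_sequence_le[OF s] by auto
    have "block_diagonal (s ` {..k}) (mat 1)" by (auto simp: block_diagonal_def mat_def separated_def)
    then have "diag_mat l \<in> std_face l (s ` {..k})"
      using block_orbit_in_std_face[OF orthogonal_matrix_id, of "s ` {..k}" l] by simp
    moreover have "F face_of schur_horn_orbitope M"
      unfolding F orb face_of_conj_act_image[OF g] by (rule std_face_face_of[OF l S])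
    ultimately show ?thesis using F by blast
  qed
  show ?thesis
  proof (rule conjI)
    show "\<forall>\<F> \<in> orbitope_face_orbits M.
            \<exists>!\<G>. \<G> \<in> permutahedron_face_orbits (eigenvalue_vector M) \<and> \<F> \<inter> pullback M ` \<G> \<noteq> {}"
      using part1 unfolding l_def .
    show "\<forall>F. F face_of schur_horn_orbitope M \<and> F \<noteq> {} \<longleftrightarrow>
            (\<exists>k W N. is_flag k W \<and> flag_blocks M k W N \<and> F = orbitope_product k W N \<and>
               (F \<noteq> schur_horn_orbitope M \<longrightarrow> (\<forall>i<k. dim (flag_step W i) < CARD('n))))"
    proof (intro allI iffI)
      fix F assume "F face_of schur_horn_orbitope M \<and> F \<noteq> {}"
      then show "\<exists>k W N. is_flag k W \<and> flag_blocks M k W N \<and> F = orbitope_product k W N \<and>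
               (F \<noteq> schur_horn_orbitope M \<longrightarrow> (\<forall>i<k. dim (flag_step W i) < CARD('n)))"
        by (elim conjE) (rule to_flag)
    next
      fix F assume "\<exists>k W N. is_flag k W \<and> flag_blocks M k W N \<and> F = orbitope_product k W N \<and>
               (F \<noteq> schur_horn_orbitope M \<longrightarrow> (\<forall>i<k. dim (flag_step W i) < CARD('n)))"
      then show "F face_of schur_horn_orbitope M \<and> F \<noteq> {}"
        by (elim exE conjE) (rule from_flag)
    qed
  qed
qed

end
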